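(* Let $X$ be a complex manifold with almost complex tensor $J:TX\to TX$, let $N\subset X$ be a smooth maximally totally real submanifold, and let $E\to X$ be an involutive holomorphic subbundle of $T^{1,0}X$. Let $V\subset TX$ be the $J$-invariant involutive real subbundle with $V^{1,0}=E$ (i.e. $V_p=T_pL_p$, where $L_p$ is the leaf through $p$ of the holomorphic foliation defined by $E$), and let $V^{0,1}=\overline{V^{1,0}}$. Let $l:\mathbb{C}TN\to (TX|_N,-J)$ be the isomorphism of complex vector bundles given by $v\mapsto v$, $iw\mapsto -Jw$ for $v,w\in T_pN$, $p\in N$, and put $P:=l^{-1}(V|_N)$. Then: (a) $P=\mathbb{C}TN\cap\left(T^{1,0}X|_N\oplus V^{0,1}|_N\right)$. (b) $P\to N$ is a complex, involutive subbundle of $\mathbb{C}TN$ and $\operatorname{rank}P=\operatorname{rank}E$. (c) $P$ defines a CR structure on the open subset $G=\{p\in N\mid T_pN\cap V_p=\{0\}\}\subset N$ ($G$ could be empty). When $\dim_{\mathbb{C}}X=2\operatorname{rank}E$, $P$ yields a complex manifold structure on $G$.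
   Context: $\mathbb{C}TN=TN\otimes\mathbb{C}$ denotes the complexified tangent bundle. A submanifold $N\subset X$ is maximally totally real if $T_pN\cap JT_pN=\{0\}$ for all $p\in N$ and $\dim_{\mathbb{R}}N=\dim_{\mathbb{C}}X$. For $\xi\in TX$ write $\xi^{1,0}=\frac12(\xi-iJ\xi)$, $\xi^{0,1}=\frac12(\xi+iJ\xi)$; $V^{1,0}=\{\xi^{1,0}:\xi\in V\}$ and $V^{0,1}=\{\xi^{0,1}:\xi\in V\}$. Ranks of $P$ and $E$ are complex ranks. A complex subbundle of a complexified tangent bundle is involutive if the Lie bracket of any two of its local smooth sections is again a section of it. A CR structure on a manifold $G$ is a smooth involutive complex subbundle $P$ of $\mathbb{C}TG$ with $P\cap\overline P=0$; when its rank is half the dimension of $G$, it is the bundle of $(1,0)$ vectors of a complex manifold structure. *)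

theory Defs
  imports "HOL-Analysis.Analysis"
begin

section \<open>Smooth and holomorphic maps between open subsets of Euclidean spaces\<close>

primrec Ck_on :: "nat \<Rightarrow> 'e::euclidean_space set \<Rightarrow> ('e \<Rightarrow> 'f::euclidean_space) \<Rightarrow> bool" where
  "Ck_on 0 S f = continuous_on S f"
| "Ck_on (Suc k) S f =
     ((\<forall>x\<in>S. f differentiable (at x)) \<and>
      (\<forall>v. Ck_on k S (\<lambda>x. frechet_derivative f (at x) v)))"

text \<open>Only used on open sets \<open>S\<close>.\<close>

definition smooth_on :: "'e::euclidean_space set \<Rightarrow> ('e \<Rightarrow> 'f::euclidean_space) \<Rightarrow> bool" where
  "smooth_on S f \<longleftrightarrow> (\<forall>k. Ck_on k S f)"

definition holomorphic_map_on ::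
    "(complex^'n) set \<Rightarrow> (complex^'n \<Rightarrow> complex^'m) \<Rightarrow> bool" where
  "holomorphic_map_on S f \<longleftrightarrow> smooth_on S f \<and>
     (\<forall>x\<in>S. \<forall>v. frechet_derivative f (at x) (\<i> *s v) = \<i> *s frechet_derivative f (at x) v)"


section \<open>Manifolds\<close>

text \<open>A manifold is a subset \<open>M\<close> of a second countable Hausdorff type, with the subspace
  topology, together with an atlas.  A chart is a pair of its domain and its coordinate map; the
  values of the coordinate map outside the domain are irrelevant.\<close>

type_synonym ('a, 'e) chart = "'a set \<times> ('a \<Rightarrow> 'e)"

abbreviation chart_inv :: "('a, 'e) chart \<Rightarrow> 'e \<Rightarrow> 'a" where
  "chart_inv c \<equiv> inv_into (fst c) (snd c)"

definition chart_on ::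
    "'a::topological_space set \<Rightarrow> ('a, 'e::euclidean_space) chart \<Rightarrow> bool" where
  "chart_on M c \<longleftrightarrow> openin (top_of_set M) (fst c) \<and> open (snd c ` fst c) \<and>
     homeomorphism (fst c) (snd c ` fst c) (snd c) (chart_inv c)"

definition smooth_atlas ::
    "'a::{t2_space, second_countable_topology} set \<Rightarrow> ('a, 'e::euclidean_space) chart set \<Rightarrow> bool" where
  "smooth_atlas M A \<longleftrightarrow> (\<forall>c\<in>A. chart_on M c) \<and> \<Union>(fst ` A) = M \<and>
     (\<forall>c\<in>A. \<forall>d\<in>A. smooth_on (snd c ` (fst c \<inter> fst d)) (snd d \<circ> chart_inv c))"

text \<open>The underlying smooth manifold of a complex manifold is given by the same atlas, with
  \<open>complex^'n\<close> regarded as a real Euclidean space.\<close>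

definition complex_atlas ::
    "'a::{t2_space, second_countable_topology} set \<Rightarrow> ('a, complex^'n) chart set \<Rightarrow> bool" where
  "complex_atlas M A \<longleftrightarrow> (\<forall>c\<in>A. chart_on M c) \<and> \<Union>(fst ` A) = M \<and>
     (\<forall>c\<in>A. \<forall>d\<in>A. holomorphic_map_on (snd c ` (fst c \<inter> fst d)) (snd d \<circ> chart_inv c))"


section \<open>Tangent vectors and differentials\<close>

text \<open>As usual in formal libraries, one chart \<open>chart_at A p\<close> around each point \<open>p\<close> is
  selected, and the tangent space at \<open>p\<close> is the model space \<open>'e\<close> of the manifold: the vector
  \<open>v :: 'e\<close> stands for the tangent vector at \<open>p\<close> whose coordinates in \<open>chart_at A p\<close> are \<open>v\<close>.
  Vector fields are thus functions \<open>'a \<Rightarrow> 'e\<close>, but their regularity is not that of the function;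
  it is tested on the coordinate representations \<open>coord_rep\<close> below.  The tangent bundle of an open
  submanifold \<open>G\<close> of \<open>N\<close> is the restriction to \<open>G\<close> of the tangent bundle of \<open>N\<close>, with the same
  atlas; hence the notions below that take a set besides an atlas may be used on open subsets of
  the manifold the atlas belongs to.\<close>

definition chart_at :: "('a, 'e) chart set \<Rightarrow> 'a \<Rightarrow> ('a, 'e) chart" where
  "chart_at A p = (SOME c. c \<in> A \<and> p \<in> fst c)"

definition diff_at ::
    "('a, 'e::euclidean_space) chart set \<Rightarrow> ('a \<Rightarrow> 'f::euclidean_space) \<Rightarrow> 'a \<Rightarrow> 'e \<Rightarrow> 'f" where
  "diff_at A g p =
     frechet_derivative (g \<circ> chart_inv (chart_at A p)) (at (snd (chart_at A p) p))"

definition tangent_map ::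
    "('a, 'e::euclidean_space) chart set \<Rightarrow> ('b, 'f::euclidean_space) chart set \<Rightarrow>
     ('a \<Rightarrow> 'b) \<Rightarrow> 'a \<Rightarrow> 'e \<Rightarrow> 'f" where
  "tangent_map A B f p = diff_at A (snd (chart_at B (f p)) \<circ> f) p"

definition smooth_map ::
    "('a::topological_space, 'e::euclidean_space) chart set \<Rightarrow>
     ('b::topological_space, 'f::euclidean_space) chart set \<Rightarrow> 'a set \<Rightarrow> ('a \<Rightarrow> 'b) \<Rightarrow> bool" where
  "smooth_map A B S f \<longleftrightarrow> continuous_on S f \<and>
     (\<forall>c\<in>A. \<forall>d\<in>B. smooth_on (snd c ` (S \<inter> fst c \<inter> f -` fst d)) (snd d \<circ> f \<circ> chart_inv c))"

definition coord_rep ::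
    "('a, 'e::euclidean_space) chart set \<Rightarrow> ('a, 'e) chart \<Rightarrow> ('a \<Rightarrow> 'e) \<Rightarrow> 'e \<Rightarrow> 'e" where
  "coord_rep A c \<xi> x = diff_at A (snd c) (chart_inv c x) (\<xi> (chart_inv c x))"

definition smooth_vector_field ::
    "('a, 'e::euclidean_space) chart set \<Rightarrow> 'a set \<Rightarrow> ('a \<Rightarrow> 'e) \<Rightarrow> bool" where
  "smooth_vector_field A U \<xi> \<longleftrightarrow> (\<forall>c\<in>A. smooth_on (snd c ` (U \<inter> fst c)) (coord_rep A c \<xi>))"

text \<open>The coordinate formula \<open>[\<xi>,\<eta>] = D\<eta>(\<xi>) - D\<xi>(\<eta>)\<close>, evaluated at \<open>p\<close> in the chart selected
  at \<open>p\<close>, in which \<open>\<xi> p\<close> and \<open>\<eta> p\<close> are their own coordinates.\<close>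

definition lie_bracket ::
    "('a, 'e::euclidean_space) chart set \<Rightarrow> ('a \<Rightarrow> 'e) \<Rightarrow> ('a \<Rightarrow> 'e) \<Rightarrow> 'a \<Rightarrow> 'e" where
  "lie_bracket A \<xi> \<eta> p =
     (let c = chart_at A p in
        frechet_derivative (coord_rep A c \<eta>) (at (snd c p)) (\<xi> p)
      - frechet_derivative (coord_rep A c \<xi>) (at (snd c p)) (\<eta> p))"


section \<open>Complexified tangent vectors\<close>

text \<open>A pair \<open>(u, w)\<close> stands for \<open>u + i w\<close> in the complexification of a real vector space.\<close>

definition cscale :: "complex \<Rightarrow> 'e::real_vector \<times> 'e \<Rightarrow> 'e \<times> 'e" where
  "cscale z \<zeta> = (Re z *\<^sub>R fst \<zeta> - Im z *\<^sub>R snd \<zeta>, Re z *\<^sub>R snd \<zeta> + Im z *\<^sub>R fst \<zeta>)"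

definition of_tangent :: "'e::real_vector \<Rightarrow> 'e \<times> 'e" where
  "of_tangent u = (u, 0)"

definition conj_vec :: "'e::real_vector \<times> 'e \<Rightarrow> 'e \<times> 'e" where
  "conj_vec \<zeta> = (fst \<zeta>, - snd \<zeta>)"

definition complexify :: "('e \<Rightarrow> 'f) \<Rightarrow> 'e \<times> 'e \<Rightarrow> 'f \<times> 'f" where
  "complexify f \<zeta> = (f (fst \<zeta>), f (snd \<zeta>))"

definition smooth_complex_field ::
    "('a, 'e::euclidean_space) chart set \<Rightarrow> 'a set \<Rightarrow> ('a \<Rightarrow> 'e \<times> 'e) \<Rightarrow> bool" where
  "smooth_complex_field A U Z \<longleftrightarrow>
     smooth_vector_field A U (fst \<circ> Z) \<and> smooth_vector_field A U (snd \<circ> Z)"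

definition complex_lie_bracket ::
    "('a, 'e::euclidean_space) chart set \<Rightarrow> ('a \<Rightarrow> 'e \<times> 'e) \<Rightarrow> ('a \<Rightarrow> 'e \<times> 'e) \<Rightarrow> 'a \<Rightarrow> 'e \<times> 'e" where
  "complex_lie_bracket A Z W p =
     (lie_bracket A (fst \<circ> Z) (fst \<circ> W) p - lie_bracket A (snd \<circ> Z) (snd \<circ> W) p,
      lie_bracket A (fst \<circ> Z) (snd \<circ> W) p + lie_bracket A (snd \<circ> Z) (fst \<circ> W) p)"

text \<open>On a complex manifold the almost complex tensor is multiplication by \<open>\<i>\<close> in the selected
  chart at each point, hence in every chart, since coordinate changes are holomorphic.\<close>

definition J :: "complex^'n \<Rightarrow> complex^'n" where
  "J \<xi> = \<i> *s \<xi>"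

definition part10 :: "complex^'n \<Rightarrow> (complex^'n) \<times> (complex^'n)" where
  "part10 \<xi> = cscale (1/2) (of_tangent \<xi> - cscale \<i> (of_tangent (J \<xi>)))"

definition T10 :: "((complex^'n) \<times> (complex^'n)) set" where
  "T10 = range part10"

text \<open>In a chart, a holomorphic section of \<open>T\<^sup>1\<^sup>,\<^sup>0X\<close> is \<open>\<Sum>j. f\<^sub>j \<partial>/\<partial>z\<^sub>j\<close> with holomorphic \<open>f\<^sub>j\<close>;
  this is the \<open>(1,0)\<close>-part of the real vector field with coordinates \<open>(f\<^sub>1, \<dots>, f\<^sub>n)\<close>.\<close>

definition holomorphic_section ::
    "('a, complex^'n) chart set \<Rightarrow> 'a set \<Rightarrow> ('a \<Rightarrow> (complex^'n) \<times> (complex^'n)) \<Rightarrow> bool" where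
  "holomorphic_section A U Z \<longleftrightarrow>
     (\<exists>\<xi>. (\<forall>c\<in>A. holomorphic_map_on (snd c ` (U \<inter> fst c)) (coord_rep A c \<xi>)) \<and>
          (\<forall>p\<in>U. Z p = part10 (\<xi> p)))"


section \<open>Subbundles and involutivity\<close>

definition is_frame ::
    "('k::field \<Rightarrow> 'v::ab_group_add \<Rightarrow> 'v) \<Rightarrow> nat \<Rightarrow> (nat \<Rightarrow> 'v) \<Rightarrow> 'v set \<Rightarrow> bool" where
  "is_frame scl r b F \<longleftrightarrow>
     F = {\<Sum>i<r. scl (a i) (b i) | a. True} \<and>
     (\<forall>a. (\<Sum>i<r. scl (a i) (b i)) = 0 \<longrightarrow> (\<forall>i<r. a i = 0))"

definition locally_framed ::
    "('k::field \<Rightarrow> 'v::ab_group_add \<Rightarrow> 'v) \<Rightarrow> ('a::topological_space set \<Rightarrow> ('a \<Rightarrow> 'v) \<Rightarrow> bool) \<Rightarrow>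
     'a set \<Rightarrow> nat \<Rightarrow> ('a \<Rightarrow> 'v set) \<Rightarrow> bool" where
  "locally_framed scl is_section M r F \<longleftrightarrow>
     (\<forall>p\<in>M. \<exists>U s. openin (top_of_set M) U \<and> p \<in> U \<and> (\<forall>i<r. is_section U (s i)) \<and>
        (\<forall>q\<in>U. is_frame scl r (\<lambda>i. s i q) (F q)))"

definition real_subbundle ::
    "('a::topological_space, 'e::euclidean_space) chart set \<Rightarrow> 'a set \<Rightarrow> nat \<Rightarrow> ('a \<Rightarrow> 'e set) \<Rightarrow> bool" where
  "real_subbundle A M r F \<longleftrightarrow> locally_framed scaleR (smooth_vector_field A) M r F"

definition complex_subbundle ::
    "('a::topological_space, 'e::euclidean_space) chart set \<Rightarrow> 'a set \<Rightarrow> nat \<Rightarrow>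
     ('a \<Rightarrow> ('e \<times> 'e) set) \<Rightarrow> bool" where
  "complex_subbundle A M r F \<longleftrightarrow> locally_framed cscale (smooth_complex_field A) M r F"

definition holomorphic_subbundle_T10 ::
    "('a::topological_space, complex^'n) chart set \<Rightarrow> 'a set \<Rightarrow> nat \<Rightarrow>
     ('a \<Rightarrow> ((complex^'n) \<times> (complex^'n)) set) \<Rightarrow> bool" where
  "holomorphic_subbundle_T10 A M r F \<longleftrightarrow> locally_framed cscale (holomorphic_section A) M r F"

definition real_involutive ::
    "('a::topological_space, 'e::euclidean_space) chart set \<Rightarrow> 'a set \<Rightarrow> ('a \<Rightarrow> 'e set) \<Rightarrow> bool" where
  "real_involutive A M F \<longleftrightarrow>
     (\<forall>U \<xi> \<eta>. openin (top_of_set M) U \<longrightarrow>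
        smooth_vector_field A U \<xi> \<longrightarrow> smooth_vector_field A U \<eta> \<longrightarrow>
        (\<forall>p\<in>U. \<xi> p \<in> F p \<and> \<eta> p \<in> F p) \<longrightarrow>
        (\<forall>p\<in>U. lie_bracket A \<xi> \<eta> p \<in> F p))"

definition complex_involutive ::
    "('a::topological_space, 'e::euclidean_space) chart set \<Rightarrow> 'a set \<Rightarrow> ('a \<Rightarrow> ('e \<times> 'e) set) \<Rightarrow> bool" where
  "complex_involutive A M F \<longleftrightarrow>
     (\<forall>U Z W. openin (top_of_set M) U \<longrightarrow>
        smooth_complex_field A U Z \<longrightarrow> smooth_complex_field A U W \<longrightarrow>
        (\<forall>p\<in>U. Z p \<in> F p \<and> W p \<in> F p) \<longrightarrow>
        (\<forall>p\<in>U. complex_lie_bracket A Z W p \<in> F p))"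

definition CR_structure ::
    "('a::topological_space, 'e::euclidean_space) chart set \<Rightarrow> 'a set \<Rightarrow> nat \<Rightarrow>
     ('a \<Rightarrow> ('e \<times> 'e) set) \<Rightarrow> bool" where
  "CR_structure A M r F \<longleftrightarrow> complex_subbundle A M r F \<and> complex_involutive A M F \<and>
     (\<forall>p\<in>M. F p \<inter> conj_vec ` F p = {0})"

text \<open>\<open>C\<close> is a complex atlas on \<open>M\<close>, inducing the same smooth structure as \<open>A\<close>, and \<open>F\<close> is its
  bundle of \<open>(1,0)\<close> vectors.\<close>

definition complex_structure_with_T10 ::
    "('a::{t2_space, second_countable_topology}, 'e::euclidean_space) chart set \<Rightarrow> 'a set \<Rightarrow>
     ('a \<Rightarrow> ('e \<times> 'e) set) \<Rightarrow> ('a, complex^'k) chart set \<Rightarrow> bool" where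
  "complex_structure_with_T10 A M F C \<longleftrightarrow> complex_atlas M C \<and>
     smooth_map A C M (\<lambda>p. p) \<and> smooth_map C A M (\<lambda>p. p) \<and>
     (\<forall>p\<in>M. F p = {\<zeta>. complexify (tangent_map A C (\<lambda>q. q) p) \<zeta> \<in> T10})"


section \<open>Totally real submanifolds\<close>

text \<open>The manifold \<open>N\<close> with atlas \<open>B\<close> is an (embedded) submanifold of \<open>X\<close> with atlas \<open>A\<close>; recall
  that the charts in \<open>B\<close> are homeomorphisms for the subspace topology.  The tangent space of \<open>N\<close>
  at \<open>p\<close>, as a subspace of that of \<open>X\<close>, is the range of \<open>incl_diff A B p\<close>.\<close>

definition incl_diff ::
    "('a, 'e::euclidean_space) chart set \<Rightarrow> ('a, 'f::euclidean_space) chart set \<Rightarrow> 'a \<Rightarrow> 'f \<Rightarrow> 'e" where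
  "incl_diff A B p = tangent_map B A (\<lambda>q. q) p"

definition submanifold ::
    "('a::{t2_space, second_countable_topology}, 'e::euclidean_space) chart set \<Rightarrow> 'a set \<Rightarrow>
     ('a, 'f::euclidean_space) chart set \<Rightarrow> 'a set \<Rightarrow> bool" where
  "submanifold A X B N \<longleftrightarrow> N \<subseteq> X \<and> smooth_atlas N B \<and> smooth_map B A N (\<lambda>q. q) \<and>
     (\<forall>p\<in>N. inj (incl_diff A B p))"

definition maximally_totally_real ::
    "('a, complex^'n) chart set \<Rightarrow> ('a, real^'m) chart set \<Rightarrow> 'a set \<Rightarrow> bool" where
  "maximally_totally_real A B N \<longleftrightarrow>
     (\<forall>p\<in>N. range (incl_diff A B p) \<inter> J ` range (incl_diff A B p) = {0}) \<and>
     CARD('m) = CARD('n)"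

text \<open>The map \<open>l\<close> sends \<open>v + i w\<close> to \<open>v - J w\<close>.\<close>

definition l_map ::
    "('a, complex^'n) chart set \<Rightarrow> ('a, real^'m) chart set \<Rightarrow> 'a \<Rightarrow> (real^'m) \<times> (real^'m) \<Rightarrow> complex^'n" where
  "l_map A B p \<zeta> = incl_diff A B p (fst \<zeta>) - J (incl_diff A B p (snd \<zeta>))"

definition P_bundle ::
    "('a, complex^'n) chart set \<Rightarrow> ('a, real^'m) chart set \<Rightarrow> ('a \<Rightarrow> (complex^'n) set) \<Rightarrow>
     'a \<Rightarrow> ((real^'m) \<times> (real^'m)) set" where
  "P_bundle A B V p = l_map A B p -` V p"

definition G_set ::
    "('a, complex^'n) chart set \<Rightarrow> ('a, real^'m) chart set \<Rightarrow> 'a set \<Rightarrow> ('a \<Rightarrow> (complex^'n) set) \<Rightarrow> 'a set" where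
  "G_set A B N V = {p \<in> N. range (incl_diff A B p) \<inter> V p = {0}}"

definition V01 :: "('a \<Rightarrow> (complex^'n) set) \<Rightarrow> 'a \<Rightarrow> ((complex^'n) \<times> (complex^'n)) set" where
  "V01 V p = conj_vec ` part10 ` V p"

end

theory Submission
  imports Defs "HOL-Complex_Analysis.Complex_Analysis"
begin

text \<open>The leaves of a holomorphic foliation are, locally, the fibres of a holomorphic map: near every
point of \<open>X\<close> there is a holomorphic \<open>g\<close> with values in some \<open>\<complex>\<^sup>k\<close> whose differential has kernel \<open>V\<close>
(\<open>local_first_integral\<close>).  The involutivity of \<open>P\<close>, the openness of \<open>G\<close> and the complex structure
on \<open>G\<close> are read off from such a \<open>g\<close>.  Since \<open>dg\<close> is complex linear, \<open>l (u + i w) = u - J w\<close> lies in \<open>V\<close> exactly when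
\<open>dg u = i dg w\<close>, where now \<open>dg\<close> is the differential of the restriction \<open>g|N\<close>.  So \<open>P\<close> consists of the
complex tangent vectors \<open>u + i w\<close> of \<open>N\<close> that annihilate the complex conjugate of \<open>g|N\<close>, and a
bracket of two vector fields that annihilate a function annihilates it too
(\<open>bracket_antiholomorphic_kernel\<close>).  Moreover \<open>T\<^sub>pN \<inter> V\<^sub>p = 0\<close> means that \<open>d(g|N)\<close> is injective at
\<open>p\<close>, an open condition.

When \<open>dim\<^sub>\<complex> X = 2 rank E\<close>, the map \<open>g\<close> can be chosen with values in \<open>\<complex>\<^sup>r\<close>, where
\<open>2 r = dim\<^sub>\<real> N\<close>.  Then \<open>g|G\<close> is a local diffeomorphism, and its local restrictions are the charts of
the complex structure: by the description of \<open>P\<close> above, \<open>P\<close> is the set of vectors that \<open>dg\<close> sends to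
type \<open>(1,0)\<close>.  Two such charts thus have the same \<open>(1,0)\<close> vectors, so the transition between them
has a complex linear differential (\<open>adapted_transition_holomorphic\<close>).  On the other hand the rank of
\<open>P\<close> and its smoothness come from the bijectivity of \<open>l\<close>, which transports a frame of \<open>V\<close> to a
frame of \<open>P\<close> (\<open>complex_subbundle_P_bundle\<close>), and (a) is linear algebra
(\<open>P_bundle_decomposition\<close>).

The existence of \<open>g\<close> is the holomorphic Frobenius theorem.  In a chart, write \<open>V\<^sub>x\<close> as the range of
the projection \<open>A(x)\<close> along a fixed complement of \<open>V\<^sub>p\<close>; it depends holomorphically on \<open>x\<close>.  Because
all \<open>A(x)\<close> have the same kernel, involutivity of \<open>V\<close> forces the fields \<open>A(\<cdot>)h\<close> to commute.  Starting
at \<open>z\<close>, follow the solution of \<open>y' = -A(y)(z - p)\<close> for unit time; it moves inside the leaf of \<open>z\<close> and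
stops at the complementary slice through \<open>p\<close>.  The end point, as a function of \<open>z\<close>, is the required
map (\<open>first_integral_of_commuting_projections\<close>): the derivative of the end point in a direction
\<open>A(z)k\<close> is computed by the variational equation, which has the explicit solution
\<open>(1 - t) A(y(t))k\<close>, and this vanishes at \<open>t = 1\<close>.  The variational equation is complex linear in
its data, hence so is the derivative of the end point, and a map with complex linear derivatives is
smooth by the theorems of Goursat and Osgood
(\<open>complex_differentiable_imp_holomorphic_map_on\<close>).\<close>

section \<open>Smooth maps between Euclidean spaces\<close>

lemma Ck_on_cong:
  assumes "open S" "\<And>x. x \<in> S \<Longrightarrow> f x = g x" "Ck_on k S f"
  shows "Ck_on k S g"
  using assms(2,3)
proof (induction k arbitrary: f g)
  case 0
  then show ?case by (simp cong: continuous_on_cong)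
next
  case (Suc k)
  have d: "f differentiable (at x)" if "x \<in> S" for x using Suc.prems that by simp
  have eq: "frechet_derivative f (at x) = frechet_derivative g (at x)" if "x \<in> S" for x
    by (rule frechet_derivative_transform_within_open[OF d assms(1)]) (use that Suc.prems in auto)
  have "g differentiable (at x)" if "x \<in> S" for x
    using d[OF that] has_derivative_transform_within_open[OF _ assms(1) that] Suc.prems(1)
    unfolding differentiable_def by blast
  moreover have "Ck_on k S (\<lambda>x. frechet_derivative g (at x) v)" for v
    by (rule Suc.IH[where f = "\<lambda>x. frechet_derivative f (at x) v"]) (use eq Suc.prems in auto)
  ultimately show ?case by simp
qed

lemma Ck_on_SucI:
  assumes "open S" "\<And>x. x \<in> S \<Longrightarrow> (f has_derivative f' x) (at x)" "\<And>v. Ck_on k S (\<lambda>x. f' x v)"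
  shows "Ck_on (Suc k) S f"
proof -
  have "Ck_on k S (\<lambda>x. frechet_derivative f (at x) v)" for v
    by (rule Ck_on_cong[OF assms(1) _ assms(3)[of v]]) (metis assms(2) frechet_derivative_at)
  then show ?thesis using assms(2) by (auto simp: differentiable_def)
qed

lemma Ck_on_subset: "Ck_on k S f \<Longrightarrow> T \<subseteq> S \<Longrightarrow> Ck_on k T f"
  by (induction k arbitrary: f) (auto intro: continuous_on_subset)

lemma Ck_on_Suc_imp_Ck_on: "Ck_on (Suc k) S f \<Longrightarrow> Ck_on k S f"
proof (induction k arbitrary: f)
  case 0
  then show ?case
    by (auto intro!: continuous_at_imp_continuous_on differentiable_imp_continuous_within)
next
  case (Suc k)
  then show ?case by (auto simp del: Ck_on.simps(1))
qed

lemma Ck_on_local: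
  assumes "\<And>x. x \<in> S \<Longrightarrow> \<exists>U. open U \<and> x \<in> U \<and> Ck_on k U f"
  shows "Ck_on k S f"
  using assms
proof (induction k arbitrary: f)
  case 0
  show ?case unfolding Ck_on.simps
  proof (rule continuous_at_imp_continuous_on, safe)
    fix x assume "x \<in> S"
    then obtain U where "open U" "x \<in> U" "continuous_on U f" using 0 by auto
    then show "isCont f x" by (simp add: continuous_on_eq_continuous_at)
  qed
next
  case (Suc k)
  have "f differentiable (at x)" if "x \<in> S" for x using Suc.prems[OF that] by auto
  moreover have "Ck_on k S (\<lambda>x. frechet_derivative f (at x) v)" for v
    by (rule Suc.IH) (use Suc.prems in fastforce)
  ultimately show ?case by simp
qed

lemma Ck_on_const: "open S \<Longrightarrow> Ck_on k S (\<lambda>x. c)"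
proof (induction k arbitrary: c)
  case (Suc k)
  then show ?case by (auto intro!: Ck_on_SucI[where f' = "\<lambda>x h. 0"])
qed simp

lemma has_derivative_frechet:
  "f differentiable (at x) \<Longrightarrow> (f has_derivative frechet_derivative f (at x)) (at x)"
  using frechet_derivative_works by blast

lemma Ck_on_linear:
  assumes "bounded_linear L" "open S" "Ck_on k S f"
  shows "Ck_on k S (\<lambda>x. L (f x))"
  using assms(3)
proof (induction k arbitrary: f)
  case 0
  then show ?case
    using linear_continuous_on_compose assms(1) bounded_linear.linear by fastforce
next
  case (Suc k)
  show ?case
  proof (rule Ck_on_SucI[OF assms(2)])
    show "((\<lambda>x. L (f x)) has_derivative (\<lambda>v. L (frechet_derivative f (at x) v))) (at x)" if "x \<in> S" for x
      by (rule bounded_linear.has_derivative[OF assms(1) has_derivative_frechet]) (use Suc that in auto)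
  qed (use Suc in auto)
qed

lemma Ck_on_add:
  assumes "open S" "Ck_on k S f" "Ck_on k S g"
  shows "Ck_on k S (\<lambda>x. f x + g x)"
  using assms(2,3)
proof (induction k arbitrary: f g)
  case 0
  then show ?case by (auto intro: continuous_intros)
next
  case (Suc k)
  show ?case
    by (rule Ck_on_SucI[OF assms(1) has_derivative_add[OF has_derivative_frechet has_derivative_frechet]])
       (use Suc in auto)
qed

lemma Ck_on_sum:
  assumes "open S" "finite I" "\<And>i. i \<in> I \<Longrightarrow> Ck_on k S (f i)"
  shows "Ck_on k S (\<lambda>x. \<Sum>i\<in>I. f i x)"
  using assms(2,3) by (induction I rule: finite_induct) (auto intro: Ck_on_add Ck_on_const assms(1))

lemma Ck_on_bilinear:
  assumes "bounded_bilinear pr" "open S" "Ck_on k S f" "Ck_on k S g"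
  shows "Ck_on k S (\<lambda>x. pr (f x) (g x))"
  using assms(3,4)
proof (induction k arbitrary: f g)
  case 0
  then show ?case using bounded_bilinear.continuous_on[OF assms(1)] by auto
next
  case (Suc k)
  show ?case
  proof (rule Ck_on_SucI[OF assms(2)])
    show "((\<lambda>x. pr (f x) (g x)) has_derivative
       (\<lambda>h. pr (f x) (frechet_derivative g (at x) h) + pr (frechet_derivative f (at x) h) (g x))) (at x)"
      if "x \<in> S" for x
      by (rule bounded_bilinear.FDERIV[OF assms(1) has_derivative_frechet has_derivative_frechet])
         (use Suc that in auto)
    show "Ck_on k S (\<lambda>x. pr (f x) (frechet_derivative g (at x) v) + pr (frechet_derivative f (at x) v) (g x))" for v
      using Suc.prems Ck_on_Suc_imp_Ck_on[OF Suc.prems(1)] Ck_on_Suc_imp_Ck_on[OF Suc.prems(2)]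
      by (intro Ck_on_add[OF assms(2)] Suc.IH) simp_all
  qed
qed

lemma linear_eq_sum_Basis:
  fixes x :: "'a::euclidean_space" and f :: "'a \<Rightarrow> 'b::real_vector"
  assumes "linear f"
  shows "f x = (\<Sum>b\<in>Basis. (x \<bullet> b) *\<^sub>R f b)"
proof -
  have "f x = f (\<Sum>b\<in>Basis. (x \<bullet> b) *\<^sub>R b)" by (simp add: euclidean_representation)
  also have "\<dots> = (\<Sum>b\<in>Basis. (x \<bullet> b) *\<^sub>R f b)"
    using assms by (simp add: linear_sum linear_scale)
  finally show ?thesis .
qed

text \<open>Coordinates of \<open>v\<close> reduce a linear map that depends on \<open>x\<close>, applied to a vector that depends on \<open>x\<close>, to
finitely many products of functions.  This is the form in which the chain rule produces derivatives.\<close>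

lemma Ck_on_linear_family:
  fixes L :: "'x::euclidean_space \<Rightarrow> 'e::euclidean_space \<Rightarrow> 'f::euclidean_space"
  assumes "open S" "\<And>x. x \<in> S \<Longrightarrow> linear (L x)" "\<And>b. Ck_on k S (\<lambda>x. L x b)" "Ck_on k S v"
  shows "Ck_on k S (\<lambda>x. L x (v x))"
proof (rule Ck_on_cong[OF assms(1)])
  show "(\<Sum>b\<in>Basis. (v x \<bullet> b) *\<^sub>R L x b) = L x (v x)" if "x \<in> S" for x
    by (rule linear_eq_sum_Basis[OF assms(2)[OF that], symmetric])
  show "Ck_on k S (\<lambda>x. \<Sum>b\<in>Basis. (v x \<bullet> b) *\<^sub>R L x b)"
    by (intro Ck_on_sum Ck_on_bilinear[OF bounded_bilinear_scaleR] assms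
        Ck_on_linear[OF bounded_linear_inner_left]) auto
qed

lemma linear_frechet: "f differentiable (at x) \<Longrightarrow> linear (frechet_derivative f (at x))"
  using has_derivative_frechet has_derivative_linear by blast

lemma Ck_on_compose:
  assumes "open S" "open T" "Ck_on k S f" "Ck_on k T g" "f ` S \<subseteq> T"
  shows "Ck_on k S (\<lambda>x. g (f x))"
  using assms(3-5)
proof (induction k arbitrary: f g)
  case 0
  then show ?case by (auto intro: continuous_on_compose2)
next
  case (Suc k)
  show ?case
  proof (rule Ck_on_SucI[OF assms(1)])
    show "((\<lambda>x. g (f x)) has_derivative
        (\<lambda>h. frechet_derivative g (at (f x)) (frechet_derivative f (at x) h))) (at x)" if "x \<in> S" for x
      by (rule has_derivative_compose[OF has_derivative_frechet has_derivative_frechet])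
         (use Suc.prems that in auto)
    show "Ck_on k S (\<lambda>x. frechet_derivative g (at (f x)) (frechet_derivative f (at x) v))" for v
    proof (rule Ck_on_linear_family[OF assms(1), where L = "\<lambda>x. frechet_derivative g (at (f x))"])
      show "linear (frechet_derivative g (at (f x)))" if "x \<in> S" for x
        by (rule linear_frechet) (use that Suc.prems in auto)
      show "Ck_on k S (\<lambda>x. frechet_derivative g (at (f x)) b)" for b
        using Suc.prems Ck_on_Suc_imp_Ck_on[OF Suc.prems(1)] by (intro Suc.IH) simp_all
      show "Ck_on k S (\<lambda>x. frechet_derivative f (at x) v)" using Suc.prems(1) by simp
    qed
  qed
qed

text \<open>At a zero of the first factor the product rule asks only for continuity of the second.  This is what
makes the inverse of a family of linear maps differentiable once it is known to be continuous.\<close>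

lemma has_derivative_scaleR_zero:
  fixes f :: "'a::real_normed_vector \<Rightarrow> real"
  assumes f: "(f has_derivative f') (at x)" "f x = 0" and k: "isCont k x"
  shows "((\<lambda>y. f y *\<^sub>R k y) has_derivative (\<lambda>h. f' h *\<^sub>R k x)) (at x)"
proof -
  have bl: "bounded_linear f'" using f(1) by (rule has_derivative_bounded_linear)
  have 1: "((\<lambda>y. f y *\<^sub>R k x) has_derivative (\<lambda>h. f' h *\<^sub>R k x)) (at x)"
    by (auto intro!: derivative_eq_intros f)
  have "((\<lambda>y. f y *\<^sub>R (k y - k x)) has_derivative (\<lambda>h. 0)) (at x)"
    unfolding has_derivative_at_alt
  proof (intro conjI allI impI)
    fix e :: real assume e: "e > 0"
    define C where "C = 1 + onorm f'"
    have C: "C > 0" unfolding C_def using onorm_pos_le[OF bl] by simp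
    obtain d1 where d1: "d1 > 0" "\<And>y. norm (y - x) < d1 \<Longrightarrow> norm (f y - f x - f' (y - x)) \<le> 1 * norm (y - x)"
      using f(1) unfolding has_derivative_at_alt by (meson zero_less_one)
    obtain d2 where d2: "d2 > 0" "\<And>y. norm (y - x) < d2 \<Longrightarrow> norm (k y - k x) < e / C"
      using k e C unfolding continuous_at_eps_delta dist_norm by (metis divide_pos_pos)
    show "\<exists>d>0. \<forall>y. norm (y - x) < d \<longrightarrow>
      norm (f y *\<^sub>R (k y - k x) - f x *\<^sub>R (k x - k x) - 0) \<le> e * norm (y - x)"
    proof (intro exI[of _ "min d1 d2"] conjI allI impI)
      fix y assume y: "norm (y - x) < min d1 d2"
      have "\<bar>f' (y - x)\<bar> \<le> onorm f' * norm (y - x)" using onorm[OF bl, of "y - x"] by simp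
      moreover have "\<bar>f y - f' (y - x)\<bar> \<le> norm (y - x)" using d1(2)[of y] y f(2) by simp
      ultimately have "\<bar>f y\<bar> \<le> C * norm (y - x)" unfolding C_def by (simp add: algebra_simps)
      then have "\<bar>f y\<bar> * norm (k y - k x) \<le> (C * norm (y - x)) * (e / C)"
        using d2(2)[of y] y by (intro mult_mono) auto
      then show "norm (f y *\<^sub>R (k y - k x) - f x *\<^sub>R (k x - k x) - 0) \<le> e * norm (y - x)"
        using C f(2) by (simp add: mult.commute)
    qed (use d1 d2 in auto)
  qed simp
  from has_derivative_add[OF 1 this] show ?thesis by (simp add: algebra_simps)
qed

lemma linear_norm_le_sum_Basis:
  fixes v :: "'e::euclidean_space" and f :: "'e \<Rightarrow> 'f::real_normed_vector"
  assumes "linear f"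
  shows "norm (f v) \<le> norm v * (\<Sum>b\<in>Basis. norm (f b))"
proof -
  have "norm (f v) \<le> (\<Sum>b\<in>Basis. norm ((v \<bullet> b) *\<^sub>R f b))"
    by (subst linear_eq_sum_Basis[OF assms]) (rule norm_sum)
  also have "\<dots> \<le> (\<Sum>b\<in>Basis. norm v * norm (f b))"
    by (intro sum_mono) (simp add: mult_right_mono Basis_le_norm)
  finally show ?thesis by (simp add: sum_distrib_left)
qed

lemma linear_inverse_of_linear:
  assumes "linear L" "\<And>v. K (L v) = v" "\<And>w. L (K w) = w"
  shows "linear K"
proof
  have "K (L (K a + K b)) = K (a + b)" for a b
    by (simp only: linear_add[OF assms(1)] assms(3))
  then show "K (a + b) = K a + K b" for a b by (simp add: assms(2))
  have "K (L (r *\<^sub>R K a)) = K (r *\<^sub>R a)" for r a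
    by (simp only: linear_scale[OF assms(1)] assms(3))
  then show "K (r *\<^sub>R a) = r *\<^sub>R K a" for r a by (simp add: assms(2))
qed

text \<open>With \<open>K\<close> inverse to \<open>L\<close> one has \<open>K\<^sub>y - K\<^sub>x = -K\<^sub>y (L\<^sub>y - L\<^sub>x) K\<^sub>x\<close>; the middle factor vanishes at
\<open>y = x\<close>, so continuity of \<open>K\<close> suffices to differentiate the right hand side.  Continuity comes from
the same identity and a bound for \<open>K\<^sub>y\<close> that is uniform for \<open>y\<close> near \<open>x\<close>.\<close>

lemma has_derivative_inverse_family:
  fixes L :: "'x::real_normed_vector \<Rightarrow> 'e::euclidean_space \<Rightarrow> 'f::euclidean_space"
  assumes S: "open S" "x \<in> S" and lin: "\<And>y. y \<in> S \<Longrightarrow> linear (L y)"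
    and KL: "\<And>y v. y \<in> S \<Longrightarrow> K y (L y v) = v" and LK: "\<And>y w. y \<in> S \<Longrightarrow> L y (K y w) = w"
    and D: "\<And>v. ((\<lambda>y. L y v) has_derivative (\<lambda>h. L' h v)) (at x)"
  shows "((\<lambda>y. K y w) has_derivative (\<lambda>h. - K x (L' h (K x w)))) (at x)"
proof -
  have linK: "linear (K y)" if "y \<in> S" for y
    using linear_inverse_of_linear[of "L y" "K y"] lin KL LK that by blast
  have eq: "K y w - K x w = - K y (L y (K x w) - L x (K x w))" if "y \<in> S" for y w
    using KL[OF that] LK[OF S(2)] linK[OF that] by (simp add: linear_diff)
  have inS: "\<forall>\<^sub>F y in at x. y \<in> S" using S eventually_at_topological by blast
  have cont: "((\<lambda>y. L y v - L x v) \<longlongrightarrow> 0) (at x)" for v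
    using has_derivative_continuous[OF D[of v]] by (simp add: continuous_at LIM_zero)
  define C where "C = 1 + onorm (K x)"
  have C: "C > 0" unfolding C_def using onorm_pos_le[of "K x"] linK[OF S(2)] linear_conv_bounded_linear by fastforce
  (* L y differs from L x by less than half the lower bound 1 / C of L x. *)
  have bnd: "\<forall>\<^sub>F y in at x. \<forall>v. norm (K y v) \<le> 2 * C * norm v"
  proof -
    have "((\<lambda>y. \<Sum>b\<in>Basis. norm (L y b - L x b)) \<longlongrightarrow> 0) (at x)"
      using tendsto_sum[of Basis "\<lambda>b y. norm (L y b - L x b)" "\<lambda>b. 0" "at x"] cont tendsto_norm_zero by fastforce
    then have "\<forall>\<^sub>F y in at x. (\<Sum>b\<in>Basis. norm (L y b - L x b)) < 1 / (2 * C)"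
      using C by (intro order_tendstoD) auto
    with inS show ?thesis
    proof eventually_elim
      case (elim y)
      show ?case
      proof
        fix w
        define v where "v = K y w"
        have "v = K x (L y v) - K x (L y v - L x v)"
          using KL[OF S(2)] linK[OF S(2)] by (simp add: linear_diff)
        then have "norm v \<le> norm (K x (L y v)) + norm (K x (L y v - L x v))"
          by (metis norm_triangle_ineq4)
        also have "\<dots> \<le> C * norm (L y v) + C * norm (L y v - L x v)"
        proof -
          have "norm (K x u) \<le> C * norm u" for u
            using onorm[of "K x" u] linK[OF S(2)] linear_conv_bounded_linear[of "K x"]
            unfolding C_def by (simp add: algebra_simps add_increasing)
          then show ?thesis by (simp add: add_mono)
        qed
        also have "norm (L y v - L x v) \<le> norm v * (\<Sum>b\<in>Basis. norm (L y b - L x b))"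
          using linear_norm_le_sum_Basis[of "\<lambda>v. L y v - L x v" v] lin elim(1) S(2)
          by (simp add: linear_compose_sub)
        also have "\<dots> \<le> norm v * (1 / (2 * C))" using elim(2) by (intro mult_left_mono) auto
        finally have "norm v \<le> C * norm (L y v) + norm v / 2" using C by (simp add: field_simps)
        then show "norm (K y w) \<le> 2 * C * norm w" unfolding v_def using LK[OF elim(1)] by simp
      qed
    qed
  qed
  have contK: "isCont (\<lambda>y. K y w) x" for w
  proof -
    have "((\<lambda>y. K y w - K x w) \<longlongrightarrow> 0) (at x)"
    proof (rule Lim_null_comparison)
      show "\<forall>\<^sub>F y in at x. norm (K y w - K x w) \<le> 2 * C * norm (L y (K x w) - L x (K x w))"
        using bnd inS by eventually_elim (simp add: eq)
      show "((\<lambda>y. 2 * C * norm (L y (K x w) - L x (K x w))) \<longlongrightarrow> 0) (at x)"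
        by (rule tendsto_mult_right_zero) (rule tendsto_norm_zero, rule cont)
    qed
    then show ?thesis by (simp add: isCont_def LIM_zero_iff)
  qed
  define u where "u = K x w"
  have "((\<lambda>y. K x w - (\<Sum>b\<in>Basis. ((L y u - L x u) \<bullet> b) *\<^sub>R K y b)) has_derivative
      (\<lambda>h. 0 - (\<Sum>b\<in>Basis. ((L' h u - 0) \<bullet> b) *\<^sub>R K x b))) (at x)"
    by (intro has_derivative_diff has_derivative_const has_derivative_sum has_derivative_scaleR_zero contK
        has_derivative_inner_left D) simp
  then have "((\<lambda>y. K y w) has_derivative
      (\<lambda>h. 0 - (\<Sum>b\<in>Basis. ((L' h u - 0) \<bullet> b) *\<^sub>R K x b))) (at x)"
  proof (rule has_derivative_transform_within_open[OF _ S])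
    show "K x w - (\<Sum>b\<in>Basis. ((L y u - L x u) \<bullet> b) *\<^sub>R K y b) = K y w" if "y \<in> S" for y
      using linear_eq_sum_Basis[OF linK[OF that], of "L y u - L x u"] eq[OF that, of w]
      unfolding u_def by (simp add: algebra_simps)
  qed
  moreover have "0 - (\<Sum>b\<in>Basis. ((L' h u - 0) \<bullet> b) *\<^sub>R K x b) = - K x (L' h (K x w))" for h
    using linear_eq_sum_Basis[OF linK[OF S(2)], of "L' h u"] by (simp add: u_def)
  ultimately show ?thesis by simp
qed

lemma linear_frechet_family:
  assumes S: "open S" "x \<in> S" and lin: "\<And>y. y \<in> S \<Longrightarrow> linear (L y)"
    and d: "\<And>v. (\<lambda>y. L y v) differentiable (at x)"
  shows "linear (\<lambda>v. frechet_derivative (\<lambda>y. L y v) (at x) h)"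
proof
  note D = has_derivative_frechet[OF d]
  fix a b
  have "((\<lambda>y. L y a + L y b) has_derivative
    (\<lambda>h. frechet_derivative (\<lambda>y. L y a) (at x) h + frechet_derivative (\<lambda>y. L y b) (at x) h)) (at x)"
    by (intro has_derivative_add D)
  then have "((\<lambda>y. L y (a + b)) has_derivative
    (\<lambda>h. frechet_derivative (\<lambda>y. L y a) (at x) h + frechet_derivative (\<lambda>y. L y b) (at x) h)) (at x)"
    by (rule has_derivative_transform_within_open[OF _ S]) (simp add: linear_add lin)
  from frechet_derivative_at[OF this]
  show "frechet_derivative (\<lambda>y. L y (a + b)) (at x) h =
    frechet_derivative (\<lambda>y. L y a) (at x) h + frechet_derivative (\<lambda>y. L y b) (at x) h"
    by metis
  fix r
  have "((\<lambda>y. r *\<^sub>R L y a) has_derivative (\<lambda>h. r *\<^sub>R frechet_derivative (\<lambda>y. L y a) (at x) h)) (at x)"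
    by (intro has_derivative_scaleR_right D)
  then have "((\<lambda>y. L y (r *\<^sub>R a)) has_derivative (\<lambda>h. r *\<^sub>R frechet_derivative (\<lambda>y. L y a) (at x) h)) (at x)"
    by (rule has_derivative_transform_within_open[OF _ S]) (simp add: linear_scale lin)
  from frechet_derivative_at[OF this]
  show "frechet_derivative (\<lambda>y. L y (r *\<^sub>R a)) (at x) h = r *\<^sub>R frechet_derivative (\<lambda>y. L y a) (at x) h"
    by metis
qed

lemma has_derivative_linear_family:
  fixes L :: "'x::real_normed_vector \<Rightarrow> 'e::euclidean_space \<Rightarrow> 'f::real_normed_vector"
  assumes S: "open S" "x \<in> S" and lin: "\<And>y. y \<in> S \<Longrightarrow> linear (L y)"
    and d: "\<And>b. (\<lambda>y. L y b) differentiable (at x)" and a: "(a has_derivative a') (at x)"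
  shows "((\<lambda>y. L y (a y)) has_derivative
    (\<lambda>h. frechet_derivative (\<lambda>y. L y (a x)) (at x) h + L x (a' h))) (at x)"
proof -
  note dd = has_derivative_frechet[OF d]
  have "((\<lambda>y. \<Sum>b\<in>Basis. (a y \<bullet> b) *\<^sub>R L y b) has_derivative
    (\<lambda>h. \<Sum>b\<in>Basis. (a x \<bullet> b) *\<^sub>R frechet_derivative (\<lambda>y. L y b) (at x) h + (a' h \<bullet> b) *\<^sub>R L x b)) (at x)"
    by (intro has_derivative_sum has_derivative_scaleR has_derivative_inner_left a dd)
  then have "((\<lambda>y. L y (a y)) has_derivative
    (\<lambda>h. \<Sum>b\<in>Basis. (a x \<bullet> b) *\<^sub>R frechet_derivative (\<lambda>y. L y b) (at x) h + (a' h \<bullet> b) *\<^sub>R L x b)) (at x)"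
    by (rule has_derivative_transform_within_open[OF _ S]) (simp add: linear_eq_sum_Basis[OF lin])
  moreover have "(\<lambda>h. \<Sum>b\<in>Basis. (a x \<bullet> b) *\<^sub>R frechet_derivative (\<lambda>y. L y b) (at x) h + (a' h \<bullet> b) *\<^sub>R L x b)
    = (\<lambda>h. frechet_derivative (\<lambda>y. L y (a x)) (at x) h + L x (a' h))"
  proof
    fix h
    have "linear (\<lambda>v. frechet_derivative (\<lambda>y. L y v) (at x) h)"
      by (rule linear_frechet_family[OF S lin d])
    from linear_eq_sum_Basis[OF this, of "a x"] linear_eq_sum_Basis[OF lin[OF S(2)], of "a' h"]
    show "(\<Sum>b\<in>Basis. (a x \<bullet> b) *\<^sub>R frechet_derivative (\<lambda>y. L y b) (at x) h + (a' h \<bullet> b) *\<^sub>R L x b)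
      = frechet_derivative (\<lambda>y. L y (a x)) (at x) h + L x (a' h)"
      by (simp add: sum.distrib)
  qed
  ultimately show ?thesis by simp
qed

lemma Ck_on_mono: "Ck_on k S f \<Longrightarrow> j \<le> k \<Longrightarrow> Ck_on j S f"
  by (induction k) (use Ck_on_Suc_imp_Ck_on le_Suc_eq in blast)+

text \<open>The derivative \<open>-K (DL) K w\<close> of \<open>K w\<close> is built from \<open>K\<close> and from first derivatives of \<open>L\<close>, so each
degree of smoothness of \<open>K\<close> gives the next one as long as \<open>L\<close> has it.\<close>

lemma Ck_on_inverse_family:
  fixes L :: "'x::euclidean_space \<Rightarrow> 'e::euclidean_space \<Rightarrow> 'f::euclidean_space"
  assumes S: "open S" and lin: "\<And>y. y \<in> S \<Longrightarrow> linear (L y)"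
    and KL: "\<And>y v. y \<in> S \<Longrightarrow> K y (L y v) = v" and LK: "\<And>y w. y \<in> S \<Longrightarrow> L y (K y w) = w"
    and C: "\<And>v. Ck_on (Suc k) S (\<lambda>y. L y v)"
  shows "Ck_on (Suc k) S (\<lambda>y. K y w)"
proof -
  have linK: "linear (K y)" if "y \<in> S" for y
    using linear_inverse_of_linear[of "L y" "K y"] lin KL LK that by blast
  have dL: "(\<lambda>y. L y v) differentiable (at x)" if "x \<in> S" for x v
    using C that by simp
  note d = has_derivative_inverse_family[OF S _ lin KL LK has_derivative_frechet[OF dL]]
  have "j \<le> Suc k \<Longrightarrow> Ck_on j S (\<lambda>y. K y w)" for j w
  proof (induction j arbitrary: w)
    case 0
    show ?case using d
      by (auto intro!: continuous_at_imp_continuous_on has_derivative_continuous)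
  next
    case (Suc j)
    show ?case
    proof (rule Ck_on_SucI[OF S d])
      fix v
      have "Ck_on j S (\<lambda>x. frechet_derivative (\<lambda>y. L y (K x w)) (at x) v)"
      proof (rule Ck_on_linear_family[OF S, where L = "\<lambda>x u. frechet_derivative (\<lambda>y. L y u) (at x) v"])
        show "linear (\<lambda>u. frechet_derivative (\<lambda>y. L y u) (at x) v)" if "x \<in> S" for x
          by (rule linear_frechet_family[OF S that lin dL[OF that]])
        show "Ck_on j S (\<lambda>x. frechet_derivative (\<lambda>y. L y b) (at x) v)" for b
          using C[of b] Suc.prems
          by (intro Ck_on_mono[of k S _ j]) auto
      qed (use Suc in simp)
      then have "Ck_on j S (\<lambda>x. K x (frechet_derivative (\<lambda>y. L y (K x w)) (at x) v))"
        using Suc.prems by (intro Ck_on_linear_family[OF S linK Suc.IH]) auto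
      then show "Ck_on j S (\<lambda>x. - K x (frechet_derivative (\<lambda>y. L y (K x w)) (at x) v))"
        by (intro Ck_on_linear[OF bounded_linear_minus[OF bounded_linear_ident] S])
    qed
  qed
  then show ?thesis by blast
qed

text \<open>The symmetric second difference in the directions \<open>u\<close>, \<open>v\<close> equals \<open>t\<^sup>2\<close> times the mixed second
derivative up to \<open>o(t\<^sup>2)\<close>, whichever of the two derivatives is taken first.  Only differentiability of
the derivative at \<open>x\<close> itself enters.\<close>

lemma second_difference_bound:
  fixes f :: "'a::real_normed_vector \<Rightarrow> 'b::real_normed_vector"
  assumes S: "open S" "x \<in> S" and d: "\<And>y. y \<in> S \<Longrightarrow> f differentiable (at y)"
    and D: "((\<lambda>y. frechet_derivative f (at y) u) has_derivative G) (at x)" and e: "e > 0"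
  shows "\<exists>d>0. \<forall>t. 0 < t \<and> t < d \<longrightarrow>
    norm (f (x + t *\<^sub>R u + t *\<^sub>R v) - f (x + t *\<^sub>R u) - f (x + t *\<^sub>R v) + f x - t\<^sup>2 *\<^sub>R G v) \<le> e * t\<^sup>2"
proof -
  define g where "g y = frechet_derivative f (at y) u" for y
  define M where "M = 1 + 2 * norm u + norm v"
  have M: "M > 0" unfolding M_def by (simp add: add_pos_nonneg)
  have blG: "bounded_linear G" using D by (rule has_derivative_bounded_linear)
  obtain d1 where d1: "d1 > 0" "\<And>y. norm (y - x) < d1 \<Longrightarrow> norm (g y - g x - G (y - x)) \<le> (e / M) * norm (y - x)"
    using D e M unfolding has_derivative_at_alt g_def by (metis divide_pos_pos)
  obtain d2 where d2: "d2 > 0" "ball x d2 \<subseteq> S" using S open_contains_ball by blast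
  have inS: "x + a \<in> S" if "norm a < d2" for a
    using that by (intro subsetD[OF d2(2)]) (simp add: dist_norm)
  define d where "d = min d1 d2 / M"
  show ?thesis
  proof (intro exI[of _ d] conjI allI impI)
    show "d > 0" unfolding d_def using d1 d2 M by simp
    fix t :: real assume t: "0 < t \<and> t < d"
    then have tM: "t * M < d1" "t * M < d2" unfolding d_def using M by (auto simp: field_simps)
    have b: "norm (s *\<^sub>R u + r *\<^sub>R v) \<le> t * (norm u + norm v)" "norm (s *\<^sub>R u) \<le> t * norm u"
      if "0 \<le> s" "s \<le> t" "0 \<le> r" "r \<le> t" for s r
    proof -
      show "norm (s *\<^sub>R u) \<le> t * norm u" using that by (simp add: mult_right_mono)
      moreover have "norm (r *\<^sub>R v) \<le> t * norm v" using that by (simp add: mult_right_mono)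
      ultimately show "norm (s *\<^sub>R u + r *\<^sub>R v) \<le> t * (norm u + norm v)"
        using norm_triangle_ineq[of "s *\<^sub>R u" "r *\<^sub>R v"] by (simp add: algebra_simps)
    qed
    have "t * (norm u + norm v) \<le> t * M" "t * norm u \<le> t * M"
      unfolding M_def using t by (auto intro!: mult_left_mono simp: add_nonneg_nonneg)
    then have tM': "t * (norm u + norm v) < d1" "t * norm u < d1" "t * (norm u + norm v) < d2" "t * norm u < d2"
      using tM by auto
    (* The second difference is phi t - phi 0 up to the quadratic term, and the derivative of phi
       is a difference of two values of the first derivative g. *)
    define \<phi> where "\<phi> s = f (x + s *\<^sub>R u + t *\<^sub>R v) - f (x + s *\<^sub>R u) - (s * t) *\<^sub>R G v" for s
    have \<phi>': "(\<phi> has_derivative (\<lambda>h. h *\<^sub>R (g (x + s *\<^sub>R u + t *\<^sub>R v) - g (x + s *\<^sub>R u) - t *\<^sub>R G v))) (at s within {0..t})"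
      if s: "s \<in> {0..t}" for s
    proof -
      have in1: "x + s *\<^sub>R u + t *\<^sub>R v \<in> S" "x + s *\<^sub>R u \<in> S"
        using inS[OF le_less_trans[OF b(1)[of s t] tM'(3)]] inS[OF le_less_trans[OF b(2)[of s t] tM'(4)]] s t
        by (auto simp: add.assoc)
      note f1 = has_derivative_frechet[OF d[OF in1(1)]] and f2 = has_derivative_frechet[OF d[OF in1(2)]]
      have "((\<lambda>s. f (x + s *\<^sub>R u + t *\<^sub>R v)) has_derivative (\<lambda>h. frechet_derivative f (at (x + s *\<^sub>R u + t *\<^sub>R v)) (h *\<^sub>R u))) (at s within {0..t})"
        by (rule has_derivative_compose[where g = f and f = "\<lambda>s. x + s *\<^sub>R u + t *\<^sub>R v", OF _ f1]) (auto intro!: derivative_eq_intros)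
      moreover have "((\<lambda>s. f (x + s *\<^sub>R u)) has_derivative (\<lambda>h. frechet_derivative f (at (x + s *\<^sub>R u)) (h *\<^sub>R u))) (at s within {0..t})"
        by (rule has_derivative_compose[where g = f and f = "\<lambda>s. x + s *\<^sub>R u", OF _ f2]) (auto intro!: derivative_eq_intros)
      ultimately have "(\<phi> has_derivative (\<lambda>h. frechet_derivative f (at (x + s *\<^sub>R u + t *\<^sub>R v)) (h *\<^sub>R u)
          - frechet_derivative f (at (x + s *\<^sub>R u)) (h *\<^sub>R u) - (h * t) *\<^sub>R G v)) (at s within {0..t})"
        unfolding \<phi>_def by (auto intro!: derivative_eq_intros)
      moreover have "(\<lambda>h. frechet_derivative f (at (x + s *\<^sub>R u + t *\<^sub>R v)) (h *\<^sub>R u)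
          - frechet_derivative f (at (x + s *\<^sub>R u)) (h *\<^sub>R u) - (h * t) *\<^sub>R G v) =
          (\<lambda>h. h *\<^sub>R (g (x + s *\<^sub>R u + t *\<^sub>R v) - g (x + s *\<^sub>R u) - t *\<^sub>R G v))"
        using linear_scale[OF has_derivative_linear[OF f1]] linear_scale[OF has_derivative_linear[OF f2]]
        unfolding g_def by (auto simp: algebra_simps)
      ultimately show ?thesis by simp
    qed
    have dd: "norm (g (x + a) - g x - G a) \<le> (e / M) * c" if "c < d1" "norm a \<le> c" for a c
      using d1(2)[of "x + a"] that e M mult_left_mono[of "norm a" c "e / M"] by auto
    have bd: "norm (g (x + s *\<^sub>R u + t *\<^sub>R v) - g (x + s *\<^sub>R u) - t *\<^sub>R G v) \<le> e * t" if s: "s \<in> {0..t}" for s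
    proof -
      have 1: "norm (g (x + s *\<^sub>R u + t *\<^sub>R v) - g x - G (s *\<^sub>R u + t *\<^sub>R v)) \<le> (e / M) * (t * (norm u + norm v))"
        using dd[OF tM'(1) b(1)[of s t]] s t by (simp add: add.assoc)
      have 2: "norm (g (x + s *\<^sub>R u) - g x - G (s *\<^sub>R u)) \<le> (e / M) * (t * norm u)"
        using dd[OF tM'(2) b(2)[of s t]] s t by simp
      have eq: "g (x + s *\<^sub>R u + t *\<^sub>R v) - g (x + s *\<^sub>R u) - t *\<^sub>R G v =
        (g (x + s *\<^sub>R u + t *\<^sub>R v) - g x - G (s *\<^sub>R u + t *\<^sub>R v)) - (g (x + s *\<^sub>R u) - g x - G (s *\<^sub>R u))"
        using bounded_linear.linear[OF blG] by (simp add: linear_add linear_scale)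
      have "norm (g (x + s *\<^sub>R u + t *\<^sub>R v) - g (x + s *\<^sub>R u) - t *\<^sub>R G v) \<le>
        (e / M) * (t * (norm u + norm v)) + (e / M) * (t * norm u)"
        using norm_triangle_ineq4[of "g (x + s *\<^sub>R u + t *\<^sub>R v) - g x - G (s *\<^sub>R u + t *\<^sub>R v)" "g (x + s *\<^sub>R u) - g x - G (s *\<^sub>R u)"] 1 2
        unfolding eq by linarith
      also have "\<dots> = (e / M) * t * (2 * norm u + norm v)" by (simp add: algebra_simps)
      also have "\<dots> \<le> (e / M) * t * M" unfolding M_def using e M[unfolded M_def] t by (intro mult_left_mono) auto
      finally show ?thesis using M by simp
    qed
    have "norm (\<phi> t - \<phi> 0) \<le> (e * t) * norm (t - 0)"
    proof (rule differentiable_bound[OF convex_closed_interval \<phi>'])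
      show "onorm (\<lambda>h. h *\<^sub>R (g (x + s *\<^sub>R u + t *\<^sub>R v) - g (x + s *\<^sub>R u) - t *\<^sub>R G v)) \<le> e * t" if "s \<in> {0..t}" for s
        using bd[OF that] by (intro onorm_bound) (use e t in \<open>auto simp: mult.commute intro!: mult_left_mono\<close>)
    qed (use t in auto)
    then show "norm (f (x + t *\<^sub>R u + t *\<^sub>R v) - f (x + t *\<^sub>R u) - f (x + t *\<^sub>R v) + f x - t\<^sup>2 *\<^sub>R G v) \<le> e * t\<^sup>2"
      using t by (simp add: \<phi>_def power2_eq_square algebra_simps)
  qed
qed

text \<open>Schwarz's theorem: the second difference does not change when \<open>u\<close> and \<open>v\<close> are exchanged.\<close>

lemma second_derivative_symmetric:
  fixes f :: "'a::real_normed_vector \<Rightarrow> 'b::real_normed_vector"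
  assumes S: "open S" "x \<in> S" and d: "\<And>y. y \<in> S \<Longrightarrow> f differentiable (at y)"
    and Du: "((\<lambda>y. frechet_derivative f (at y) u) has_derivative G) (at x)"
    and Dv: "((\<lambda>y. frechet_derivative f (at y) v) has_derivative H) (at x)"
  shows "G v = H u"
proof (rule ccontr)
  assume "G v \<noteq> H u"
  define e where "e = norm (G v - H u) / 4"
  have e: "e > 0" unfolding e_def using \<open>G v \<noteq> H u\<close> by simp
  obtain d1 where d1: "d1 > 0" "\<And>t. 0 < t \<and> t < d1 \<Longrightarrow>
    norm (f (x + t *\<^sub>R u + t *\<^sub>R v) - f (x + t *\<^sub>R u) - f (x + t *\<^sub>R v) + f x - t\<^sup>2 *\<^sub>R G v) \<le> e * t\<^sup>2"
    using second_difference_bound[OF S d Du e, of v] by blast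
  obtain d2 where d2: "d2 > 0" "\<And>t. 0 < t \<and> t < d2 \<Longrightarrow>
    norm (f (x + t *\<^sub>R v + t *\<^sub>R u) - f (x + t *\<^sub>R v) - f (x + t *\<^sub>R u) + f x - t\<^sup>2 *\<^sub>R H u) \<le> e * t\<^sup>2"
    using second_difference_bound[OF S d Dv e, of u] by blast
  define t where "t = min d1 d2 / 2"
  have t: "0 < t" "t < d1" "t < d2" unfolding t_def using d1 d2 by auto
  define \<Delta> where "\<Delta> = f (x + t *\<^sub>R u + t *\<^sub>R v) - f (x + t *\<^sub>R u) - f (x + t *\<^sub>R v) + f x"
  have 1: "norm (\<Delta> - t\<^sup>2 *\<^sub>R G v) \<le> e * t\<^sup>2" using d1(2) t unfolding \<Delta>_def by blast
  have "\<Delta> = f (x + t *\<^sub>R v + t *\<^sub>R u) - f (x + t *\<^sub>R v) - f (x + t *\<^sub>R u) + f x"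
    unfolding \<Delta>_def by (simp add: algebra_simps)
  then have 2: "norm (\<Delta> - t\<^sup>2 *\<^sub>R H u) \<le> e * t\<^sup>2" using d2(2) t by simp
  have "t\<^sup>2 * norm (G v - H u) = norm ((\<Delta> - t\<^sup>2 *\<^sub>R H u) - (\<Delta> - t\<^sup>2 *\<^sub>R G v))"
    by (simp flip: scaleR_diff_right)
  also have "\<dots> \<le> 2 * (e * t\<^sup>2)" using 1 2 norm_triangle_ineq4[of "\<Delta> - t\<^sup>2 *\<^sub>R H u" "\<Delta> - t\<^sup>2 *\<^sub>R G v"] by linarith
  finally have "norm (G v - H u) \<le> 2 * e" using t by simp
  then show False using e unfolding e_def by simp
qed

lemma smooth_on_imp_differentiable: "smooth_on S f \<Longrightarrow> x \<in> S \<Longrightarrow> f differentiable (at x)"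
  unfolding smooth_on_def by (metis Ck_on.simps(2))

lemma smooth_on_has_derivative:
  "smooth_on S f \<Longrightarrow> x \<in> S \<Longrightarrow> (f has_derivative frechet_derivative f (at x)) (at x)"
  by (rule has_derivative_frechet[OF smooth_on_imp_differentiable])

lemma smooth_on_linear_frechet: "smooth_on S f \<Longrightarrow> x \<in> S \<Longrightarrow> linear (frechet_derivative f (at x))"
  by (rule linear_frechet[OF smooth_on_imp_differentiable])

lemma smooth_on_directional:
  "smooth_on S f \<Longrightarrow> smooth_on S (\<lambda>x. frechet_derivative f (at x) v)"
  unfolding smooth_on_def by (metis Ck_on.simps(2))

lemma smooth_on_continuous: "smooth_on S f \<Longrightarrow> continuous_on S f"
  unfolding smooth_on_def by (metis Ck_on.simps(1))

lemma smooth_on_cong: "open S \<Longrightarrow> (\<And>x. x \<in> S \<Longrightarrow> f x = g x) \<Longrightarrow> smooth_on S f \<Longrightarrow> smooth_on S g"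
  unfolding smooth_on_def using Ck_on_cong by blast

lemma smooth_on_subset: "smooth_on S f \<Longrightarrow> T \<subseteq> S \<Longrightarrow> smooth_on T f"
  unfolding smooth_on_def using Ck_on_subset by blast

lemma smooth_on_local: "(\<And>x. x \<in> S \<Longrightarrow> \<exists>U. open U \<and> x \<in> U \<and> smooth_on U f) \<Longrightarrow> smooth_on S f"
  unfolding smooth_on_def by (intro allI Ck_on_local) blast

lemma smooth_on_const: "open S \<Longrightarrow> smooth_on S (\<lambda>x. c)"
  unfolding smooth_on_def using Ck_on_const by blast

lemma smooth_on_ident:
  assumes "open S" shows "smooth_on S (\<lambda>x. x)"
proof -
  have "Ck_on k S (\<lambda>x. x)" for k
  proof (cases k)
    case (Suc j)
    show ?thesis unfolding Suc
      by (rule Ck_on_SucI[OF assms has_derivative_ident Ck_on_const[OF assms]])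
  qed simp
  then show ?thesis unfolding smooth_on_def by blast
qed

lemma smooth_on_linear: "bounded_linear L \<Longrightarrow> open S \<Longrightarrow> smooth_on S f \<Longrightarrow> smooth_on S (\<lambda>x. L (f x))"
  unfolding smooth_on_def using Ck_on_linear by blast

lemma smooth_on_add: "open S \<Longrightarrow> smooth_on S f \<Longrightarrow> smooth_on S g \<Longrightarrow> smooth_on S (\<lambda>x. f x + g x)"
  unfolding smooth_on_def using Ck_on_add by blast

lemma smooth_on_sum:
  "open S \<Longrightarrow> finite I \<Longrightarrow> (\<And>i. i \<in> I \<Longrightarrow> smooth_on S (f i)) \<Longrightarrow> smooth_on S (\<lambda>x. \<Sum>i\<in>I. f i x)"
  unfolding smooth_on_def by (simp add: Ck_on_sum)

lemma smooth_on_linear_family: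
  fixes L :: "'x::euclidean_space \<Rightarrow> 'e::euclidean_space \<Rightarrow> 'f::euclidean_space"
  assumes "open S" "\<And>x. x \<in> S \<Longrightarrow> linear (L x)" "\<And>b. smooth_on S (\<lambda>x. L x b)" "smooth_on S v"
  shows "smooth_on S (\<lambda>x. L x (v x))"
  using assms Ck_on_linear_family[of S L _ v] unfolding smooth_on_def by blast

lemma smooth_on_compose:
  "open S \<Longrightarrow> open T \<Longrightarrow> smooth_on S f \<Longrightarrow> smooth_on T g \<Longrightarrow> f ` S \<subseteq> T \<Longrightarrow> smooth_on S (\<lambda>x. g (f x))"
  unfolding smooth_on_def using Ck_on_compose by blast

lemma smooth_on_derivative_field:
  assumes "open S" "smooth_on S f" "smooth_on S v"
  shows "smooth_on S (\<lambda>x. frechet_derivative f (at x) (v x))"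
  by (rule smooth_on_linear_family[OF assms(1) smooth_on_linear_frechet[OF assms(2)]
        smooth_on_directional[OF assms(2)] assms(3)])

lemma smooth_on_inverse_family:
  fixes L :: "'x::euclidean_space \<Rightarrow> 'e::euclidean_space \<Rightarrow> 'f::euclidean_space"
  assumes S: "open S" and lin: "\<And>y. y \<in> S \<Longrightarrow> linear (L y)"
    and KL: "\<And>y v. y \<in> S \<Longrightarrow> K y (L y v) = v" and LK: "\<And>y w. y \<in> S \<Longrightarrow> L y (K y w) = w"
    and C: "\<And>v. smooth_on S (\<lambda>y. L y v)" and w: "smooth_on S w"
  shows "smooth_on S (\<lambda>y. K y (w y))"
proof (rule smooth_on_linear_family[OF S _ _ w])
  show "linear (K y)" if "y \<in> S" for y
    using linear_inverse_of_linear[of "L y" "K y"] lin KL LK that by blast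
  have "Ck_on (Suc k) S (\<lambda>y. K y b)" for k b
    by (rule Ck_on_inverse_family[OF S lin KL LK]) (use C in \<open>auto simp: smooth_on_def\<close>)
  then show "smooth_on S (\<lambda>y. K y b)" for b unfolding smooth_on_def using Ck_on_Suc_imp_Ck_on by blast
qed

lemma smooth_on_second_derivative_symmetric:
  assumes "open S" "x \<in> S" "smooth_on S f"
  shows "frechet_derivative (\<lambda>y. frechet_derivative f (at y) u) (at x) v =
    frechet_derivative (\<lambda>y. frechet_derivative f (at y) v) (at x) u"
  by (rule second_derivative_symmetric[OF assms(1,2) smooth_on_imp_differentiable[OF assms(3)]
        smooth_on_has_derivative[OF smooth_on_directional[OF assms(3)] assms(2)]
        smooth_on_has_derivative[OF smooth_on_directional[OF assms(3)] assms(2)]])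

lemma has_derivative_derivative_field:
  fixes f :: "'a::euclidean_space \<Rightarrow> 'b::euclidean_space"
  assumes S: "open S" "x \<in> S" and f: "smooth_on S f" and a: "(a has_derivative a') (at x)"
  shows "((\<lambda>y. frechet_derivative f (at y) (a y)) has_derivative
    (\<lambda>h. frechet_derivative (\<lambda>y. frechet_derivative f (at y) (a x)) (at x) h + frechet_derivative f (at x) (a' h))) (at x)"
  by (rule has_derivative_linear_family[OF S smooth_on_linear_frechet[OF f]
        smooth_on_imp_differentiable[OF smooth_on_directional[OF f] S(2)] a])

lemma smooth_on_imp_blinfun_derivative:
  fixes f :: "'a::euclidean_space \<Rightarrow> 'b::euclidean_space"
  assumes S: "open S" and f: "smooth_on S f"
  obtains f' :: "'a \<Rightarrow> 'a \<Rightarrow>\<^sub>L 'b" where "\<And>x. x \<in> S \<Longrightarrow> blinfun_apply (f' x) = frechet_derivative f (at x)"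
    "\<And>x. x \<in> S \<Longrightarrow> (f has_derivative blinfun_apply (f' x)) (at x)" "continuous_on S f'"
proof
  let ?f' = "\<lambda>x. Blinfun (frechet_derivative f (at x))"
  show 1: "blinfun_apply (?f' x) = frechet_derivative f (at x)" if "x \<in> S" for x
    using smooth_on_has_derivative[OF f that] has_derivative_bounded_linear bounded_linear_Blinfun_apply by blast
  then show "(f has_derivative blinfun_apply (?f' x)) (at x)" if "x \<in> S" for x
    using smooth_on_has_derivative[OF f that] that by simp
  show "continuous_on S ?f'"
  proof (rule continuous_on_blinfun_componentwise)
    fix i :: 'a
    have "continuous_on S (\<lambda>x. frechet_derivative f (at x) i)"
      by (rule smooth_on_continuous[OF smooth_on_directional[OF f]])
    then show "continuous_on S (\<lambda>x. blinfun_apply (?f' x) i)"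
      by (rule continuous_on_eq) (use 1 in simp)
  qed
qed

lemma linear_inj_imp_bij:
  fixes f :: "'e::euclidean_space \<Rightarrow> 'f::euclidean_space"
  assumes "linear f" "inj f" "DIM('e) = DIM('f)"
  shows "bij f"
proof -
  have "dim (range f) = DIM('f)"
    using dim_image_eq[OF assms(1), of UNIV] assms(2,3) by simp
  then have "span (range f) = UNIV" by (simp add: dim_eq_full)
  moreover have "subspace (range f)" using assms(1) linear_subspace_image subspace_UNIV by blast
  ultimately show ?thesis using assms(2) by (simp add: bij_def span_eq_iff[THEN iffD2])
qed

text \<open>The derivative of the inverse \<open>g\<close> at \<open>w\<close> is the inverse of \<open>Df(g w)\<close>; inverses of smooth
families are smooth, so smoothness of \<open>g\<close> of order \<open>k\<close> implies order \<open>k + 1\<close>.\<close>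

lemma smooth_inverse_function:
  fixes f :: "'e::euclidean_space \<Rightarrow> 'f::euclidean_space"
  assumes S: "open S" "x0 \<in> S" and f: "smooth_on S f"
    and inj: "inj (frechet_derivative f (at x0))" and dim: "DIM('e) = DIM('f)"
    and injS: "\<And>x. x \<in> S \<Longrightarrow> inj (frechet_derivative f (at x))"
  obtains U V g where "open U" "U \<subseteq> S" "x0 \<in> U" "open V" "homeomorphism U V f g" "smooth_on V g"
    "\<And>x v. x \<in> U \<Longrightarrow> frechet_derivative g (at (f x)) (frechet_derivative f (at x) v) = v"
    "\<And>x w. x \<in> U \<Longrightarrow> frechet_derivative f (at x) (frechet_derivative g (at (f x)) w) = w"
proof -
  let ?D = "\<lambda>x. frechet_derivative f (at x)"
  define K where "K x = inv (?D x)" for x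
  have linD: "linear (?D x)" if "x \<in> S" for x by (rule smooth_on_linear_frechet[OF f that])
  have bij: "bij (?D x)" if "x \<in> S" for x
    by (rule linear_inj_imp_bij[OF linD[OF that] injS[OF that] dim])
  have KD: "K x (?D x v) = v" and DK: "?D x (K x w) = w" if "x \<in> S" for x v w
    using bij[OF that] unfolding K_def by (auto simp: bij_is_inj surj_f_inv_f bij_is_surj)
  have linK: "linear (K x)" if "x \<in> S" for x
    by (rule linear_inverse_of_linear[OF linD[OF that]]) (use KD DK that in auto)
  obtain f' where f': "\<And>x. x \<in> S \<Longrightarrow> blinfun_apply (f' x) = ?D x"
    "\<And>x. x \<in> S \<Longrightarrow> (f has_derivative blinfun_apply (f' x)) (at x)" "continuous_on S f'"
    using smooth_on_imp_blinfun_derivative[OF S(1) f] by blast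
  (* Composition with the inverse of Df(x0) gives a map from the space 'e to itself, as
     inverse_function_theorem requires. *)
  define L where "L = Blinfun (K x0)"
  have blK: "bounded_linear (K x0)" using linK S(2) linear_conv_bounded_linear by blast
  have L: "blinfun_apply L = K x0" unfolding L_def by (rule bounded_linear_Blinfun_apply[OF blK])
  have derLf: "((\<lambda>x. K x0 (f x)) has_derivative blinfun_apply (L o\<^sub>L f' x)) (at x)" if "x \<in> S" for x
    using bounded_linear.has_derivative[OF blK f'(2)[OF that]] by (simp add: L blinfun_compose.rep_eq o_def)
  have contL: "continuous_on S (\<lambda>x. L o\<^sub>L f' x)" by (intro continuous_intros f')
  have "id_blinfun o\<^sub>L (L o\<^sub>L f' x0) = id_blinfun"
    by (rule blinfun_eqI) (simp add: L f'(1)[OF S(2)] KD S(2))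
  from inverse_function_theorem[OF S(1) derLf contL S(2) this]
  obtain U V g g' where U: "open U" "U \<subseteq> S" "x0 \<in> U" and V: "open V" "homeomorphism U V (\<lambda>x. K x0 (f x)) g"
    and g: "\<And>y. y \<in> V \<Longrightarrow> (g has_derivative g' y) (at y)" by metis
  define W where "W = K x0 -` V"
  define h where "h w = g (K x0 w)" for w
  have W: "open W" unfolding W_def by (rule open_vimage[OF V(1)]) (simp add: blK linear_continuous_on)
  have injK: "K x0 a = K x0 b \<Longrightarrow> a = b" for a b by (metis DK S(2))
  have hom: "homeomorphism U W f h"
  proof (rule homeomorphismI)
    show "continuous_on U f" using smooth_on_continuous[OF f] U(2) continuous_on_subset by blast
    show "continuous_on W h" unfolding h_def
      by (rule continuous_on_compose2[OF homeomorphism_cont2[OF V(2)]])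
         (auto simp: W_def blK linear_continuous_on)
    show "f ` U \<subseteq> W" "h ` W \<subseteq> U" using V(2) unfolding W_def h_def homeomorphism_def by auto
    show "h (f x) = x" if "x \<in> U" for x using V(2) that unfolding h_def homeomorphism_def by auto
    show "f (h y) = y" if "y \<in> W" for y
      using V(2) that unfolding h_def W_def homeomorphism_def by (intro injK) auto
  qed
  have hU: "h w \<in> U" "f (h w) = w" if "w \<in> W" for w
    using hom that unfolding homeomorphism_def by auto
  have hder: "(h has_derivative K (h w)) (at w)" if w: "w \<in> W" for w
  proof -
    have "(h has_derivative (\<lambda>v. g' (K x0 w) (K x0 v))) (at w)"
      unfolding h_def
      by (rule has_derivative_compose[OF bounded_linear.has_derivative[OF blK has_derivative_ident]])
         (use g w W_def in auto)
    then obtain h' where h': "(h has_derivative h') (at w)" by blast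
    have fd: "(f has_derivative ?D (h w)) (at (h w))" using hU[OF w] U(2) smooth_on_has_derivative[OF f] by blast
    have "((\<lambda>w. f (h w)) has_derivative (\<lambda>v. ?D (h w) (h' v))) (at w)"
      by (rule has_derivative_compose[OF h' fd])
    moreover have "((\<lambda>w. f (h w)) has_derivative (\<lambda>v. v)) (at w)"
      by (rule has_derivative_transform_within_open[OF has_derivative_ident W w]) (simp add: hU)
    ultimately have "(\<lambda>v. ?D (h w) (h' v)) = (\<lambda>v. v)" by (rule has_derivative_unique)
    then have "?D (h w) (h' v) = v" for v by metis
    then have "h' v = K (h w) v" for v by (metis KD hU(1)[OF w] U(2) subsetD)
    then have "h' = K (h w)" by blast
    with h' show ?thesis by simp
  qed
  have "Ck_on k W h" for k
  proof (induction k)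
    case 0
    then show ?case using homeomorphism_cont2[OF hom] by simp
  next
    case (Suc k)
    have "smooth_on S (\<lambda>x. K x v)" for v
      by (rule smooth_on_inverse_family[OF S(1) linD KD DK smooth_on_directional[OF f] smooth_on_const[OF S(1)]])
    then have "Ck_on k S (\<lambda>x. K x v)" for v unfolding smooth_on_def by blast
    then have "Ck_on k W (\<lambda>w. K (h w) v)" for v
      using hU U(2) by (intro Ck_on_compose[OF W S(1) Suc]) auto
    with Ck_on_SucI[OF W hder] show ?case by blast
  qed
  then have "smooth_on W h" unfolding smooth_on_def by blast
  moreover have "frechet_derivative h (at (f x)) = K x" if "x \<in> U" for x
  proof -
    have "f x \<in> W" "h (f x) = x" using hom that unfolding homeomorphism_def by auto
    then show ?thesis using frechet_derivative_at[OF hder[of "f x"]] by simp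
  qed
  ultimately show thesis
    using that[OF U W hom] KD DK U(2) by (metis subsetD)
qed

section \<open>Complex differentiable maps of several variables\<close>

lemma directional_increment_bound:
  fixes f :: "'e::real_normed_vector \<Rightarrow> 'f::real_normed_vector"
  assumes S: "open S" "x \<in> S"
    and D: "\<And>y. y \<in> S \<Longrightarrow> ((\<lambda>s. f (y + s *\<^sub>R b)) has_vector_derivative g y) (at 0)"
    and g: "continuous_on S g" and e: "e > 0"
  shows "\<exists>d>0. \<forall>y c. norm (y - x) < d \<and> \<bar>c\<bar> < d \<longrightarrow> norm (f (y + c *\<^sub>R b) - f y - c *\<^sub>R g x) \<le> e * \<bar>c\<bar>"
proof -
  obtain d1 where d1: "d1 > 0" "ball x d1 \<subseteq> S" using S open_contains_ball by blast
  obtain d2 where d2: "d2 > 0" "\<And>y. y \<in> S \<Longrightarrow> dist y x < d2 \<Longrightarrow> dist (g y) (g x) < e"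
    using g S(2) e unfolding continuous_on_iff by blast
  define m where "m = min d1 d2"
  define d where "d = m / (1 + norm b)"
  have nb: "1 + norm b > 0" by (simp add: add_pos_nonneg)
  have m: "m > 0" unfolding m_def using d1 d2 by auto
  have near: "y + s *\<^sub>R b \<in> S" "norm (g (y + s *\<^sub>R b) - g x) \<le> e" if "norm (y - x) < d" "\<bar>s\<bar> < d" for y s
  proof -
    have "norm (y + s *\<^sub>R b - x) \<le> norm (y - x) + \<bar>s\<bar> * norm b"
      using norm_triangle_ineq[of "y - x" "s *\<^sub>R b"] by (simp add: algebra_simps)
    also have "\<dots> < d + d * norm b" using that by (intro add_less_le_mono mult_right_mono) auto
    also have "\<dots> = d * (1 + norm b)" by (simp add: algebra_simps)
    also have "\<dots> = m" unfolding d_def using nb by simp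
    finally have *: "dist (y + s *\<^sub>R b) x < m" by (simp add: dist_norm)
    then show "y + s *\<^sub>R b \<in> S" using d1(2) unfolding m_def by (auto simp: dist_commute)
    with d2(2)[of "y + s *\<^sub>R b"] * show "norm (g (y + s *\<^sub>R b) - g x) \<le> e" unfolding m_def dist_norm by auto
  qed
  show ?thesis
  proof (intro exI[of _ d] conjI allI impI)
    show "d > 0" unfolding d_def using m nb by simp
    fix y c assume yc: "norm (y - x) < d \<and> \<bar>c\<bar> < d"
    let ?I = "closed_segment 0 c"
    have I: "\<bar>s\<bar> < d" if "s \<in> ?I" for s
      using that yc by (auto simp: closed_segment_eq_real_ivl split: if_splits)
    have der: "((\<lambda>s. f (y + s *\<^sub>R b) - s *\<^sub>R g x) has_vector_derivative g (y + s *\<^sub>R b) - g x) (at s within ?I)"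
      if s: "s \<in> ?I" for s
    proof -
      have "((\<lambda>r. f ((y + s *\<^sub>R b) + r *\<^sub>R b)) has_vector_derivative g (y + s *\<^sub>R b)) (at (s - s))"
        using D[OF near(1)] I[OF s] yc by simp
      moreover have "((\<lambda>r. r - s) has_vector_derivative 1) (at s)"
        by (auto simp: has_vector_derivative_def intro!: derivative_eq_intros)
      ultimately have "(((\<lambda>r. f ((y + s *\<^sub>R b) + r *\<^sub>R b)) \<circ> (\<lambda>r. r - s)) has_vector_derivative 1 *\<^sub>R g (y + s *\<^sub>R b)) (at s)"
        by (intro vector_diff_chain_at)
      moreover have "((\<lambda>r. f ((y + s *\<^sub>R b) + r *\<^sub>R b)) \<circ> (\<lambda>r. r - s)) = (\<lambda>s. f (y + s *\<^sub>R b))"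
        by (simp add: fun_eq_iff scaleR_left_diff_distrib)
      ultimately have "((\<lambda>s. f (y + s *\<^sub>R b)) has_vector_derivative g (y + s *\<^sub>R b)) (at s)" by simp
      moreover have "((\<lambda>s. s *\<^sub>R g x) has_vector_derivative g x) (at s)"
        unfolding has_vector_derivative_def by (intro has_derivative_scaleR_left has_derivative_ident)
      ultimately show ?thesis
        by (rule has_vector_derivative_at_within[OF has_vector_derivative_diff])
    qed
    have "norm ((f (y + c *\<^sub>R b) - c *\<^sub>R g x) - (f (y + 0 *\<^sub>R b) - 0 *\<^sub>R g x)) \<le> e * norm (c - 0)"
    proof (rule differentiable_bound[OF convex_closed_segment der[unfolded has_vector_derivative_def]])
      show "onorm (\<lambda>h. h *\<^sub>R (g (y + s *\<^sub>R b) - g x)) \<le> e" if "s \<in> ?I" for s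
        using near(2)[of y s] I[OF that] yc e
        by (intro onorm_bound) (auto simp: mult.commute[of e] intro!: mult_left_mono)
    qed auto
    then show "norm (f (y + c *\<^sub>R b) - f y - c *\<^sub>R g x) \<le> e * \<bar>c\<bar>" by (simp add: algebra_simps)
  qed
qed

text \<open>The increment of \<open>f\<close> is split into steps along the basis vectors.  Each step is controlled by the
continuity of one directional derivative, uniformly in its starting point, which lets the steps be
added one after the other.\<close>

lemma has_derivative_continuous_directional:
  fixes f :: "'e::euclidean_space \<Rightarrow> 'f::real_normed_vector"
  assumes S: "open S" "x \<in> S"
    and D: "\<And>y b. y \<in> S \<Longrightarrow> ((\<lambda>s. f (y + s *\<^sub>R b)) has_vector_derivative g b y) (at 0)"
    and g: "\<And>b. continuous_on S (g b)"
  shows "(f has_derivative (\<lambda>v. g v x)) (at x)"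
proof -
  define T where "T v = (\<Sum>b\<in>Basis. (v \<bullet> b) *\<^sub>R g b x)" for v
  have step: "\<exists>d>0. \<forall>y c. norm (y - x) < d \<and> (\<forall>b\<in>I. \<bar>c b\<bar> < d) \<longrightarrow>
      norm (f (y + (\<Sum>b\<in>I. c b *\<^sub>R b)) - f y - (\<Sum>b\<in>I. c b *\<^sub>R g b x)) \<le> e * (\<Sum>b\<in>I. \<bar>c b\<bar>)"
    if I: "finite I" "I \<subseteq> Basis" and e: "e > 0" for I e
    using I
  proof (induction I rule: finite_induct)
    case empty
    then show ?case by (auto intro: exI[of _ 1])
  next
    case (insert b I)
    then obtain d1 where d1: "d1 > 0" "\<And>y c. norm (y - x) < d1 \<Longrightarrow> (\<forall>b\<in>I. \<bar>c b\<bar> < d1) \<Longrightarrow>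
      norm (f (y + (\<Sum>b\<in>I. c b *\<^sub>R b)) - f y - (\<Sum>b\<in>I. c b *\<^sub>R g b x)) \<le> e * (\<Sum>b\<in>I. \<bar>c b\<bar>)" by auto
    obtain d2 where d2: "d2 > 0" "\<And>y c. norm (y - x) < d2 \<and> \<bar>c\<bar> < d2 \<Longrightarrow>
        norm (f (y + c *\<^sub>R b) - f y - c *\<^sub>R g b x) \<le> e * \<bar>c\<bar>"
      using directional_increment_bound[OF S D g e, of b] by blast
    define d where "d = min d1 d2 / 2"
    show ?case
    proof (intro exI[of _ d] conjI allI impI)
      show "d > 0" unfolding d_def using d1 d2 by simp
      fix y and c :: "'e \<Rightarrow> real" assume yc: "norm (y - x) < d \<and> (\<forall>b\<in>insert b I. \<bar>c b\<bar> < d)"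
      have n: "norm (c b *\<^sub>R b) = \<bar>c b\<bar>" using insert.prems by simp
      have "norm (y + c b *\<^sub>R b - x) \<le> norm (y - x) + \<bar>c b\<bar>"
        using norm_triangle_ineq[of "y - x" "c b *\<^sub>R b"] unfolding n by (simp add: algebra_simps)
      then have 1: "norm (f (y + c b *\<^sub>R b + (\<Sum>b\<in>I. c b *\<^sub>R b)) - f (y + c b *\<^sub>R b) - (\<Sum>b\<in>I. c b *\<^sub>R g b x))
          \<le> e * (\<Sum>b\<in>I. \<bar>c b\<bar>)"
        using yc unfolding d_def by (intro d1) auto
      have 2: "norm (f (y + c b *\<^sub>R b) - f y - c b *\<^sub>R g b x) \<le> e * \<bar>c b\<bar>"
        using yc d1 d2(1) unfolding d_def by (intro d2(2)) auto
      from norm_add_rule_thm[OF 1 2]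
      show "norm (f (y + (\<Sum>b\<in>insert b I. c b *\<^sub>R b)) - f y - (\<Sum>b\<in>insert b I. c b *\<^sub>R g b x))
          \<le> e * (\<Sum>b\<in>insert b I. \<bar>c b\<bar>)"
        using insert.hyps by (simp add: algebra_simps)
    qed
  qed
  have blT: "bounded_linear T"
    unfolding T_def by (intro bounded_linear_intros)
  have fT: "(f has_derivative T) (at x)"
    unfolding has_derivative_at_alt
  proof (intro conjI allI impI blT)
    fix e :: real assume e: "e > 0"
    then have "e / DIM('e) > 0" by simp
    from step[OF finite_Basis order_refl this] obtain d where d: "d > 0"
      "\<And>y c. norm (y - x) < d \<Longrightarrow> (\<forall>b\<in>Basis. \<bar>c b\<bar> < d) \<Longrightarrow>
      norm (f (y + (\<Sum>b\<in>Basis. c b *\<^sub>R b)) - f y - (\<Sum>b\<in>Basis. c b *\<^sub>R g b x)) \<le> e / DIM('e) * (\<Sum>b\<in>Basis. \<bar>c b\<bar>)"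
      by blast
    show "\<exists>d>0. \<forall>y. norm (y - x) < d \<longrightarrow> norm (f y - f x - T (y - x)) \<le> e * norm (y - x)"
    proof (intro exI[of _ d] conjI allI impI d(1))
      fix y assume y: "norm (y - x) < d"
      have "\<bar>(y - x) \<bullet> b\<bar> < d" if "b \<in> Basis" for b
        using Basis_le_norm[OF that, of "y - x"] y by linarith
      then have "norm (f (x + (\<Sum>b\<in>Basis. ((y - x) \<bullet> b) *\<^sub>R b)) - f x - T (y - x))
        \<le> e / DIM('e) * (\<Sum>b\<in>Basis. \<bar>(y - x) \<bullet> b\<bar>)"
        unfolding T_def using d by (intro d(2)) auto
      also have "\<dots> \<le> e / DIM('e) * (\<Sum>b\<in>(Basis::'e set). norm (y - x))"
        using e by (intro mult_left_mono sum_mono Basis_le_norm) auto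
      finally show "norm (f y - f x - T (y - x)) \<le> e * norm (y - x)"
        by (simp add: euclidean_representation)
    qed
  qed
  have "T v = g v x" for v
  proof -
    have "((\<lambda>s. f (x + s *\<^sub>R v)) has_derivative (\<lambda>s. T (s *\<^sub>R v))) (at 0)"
      by (rule has_derivative_compose[where g = f and f = "\<lambda>s. x + s *\<^sub>R v"])
         (auto intro!: derivative_eq_intros fT)
    from has_derivative_unique[OF this D[OF S(2), unfolded has_vector_derivative_def]]
    have "T (1 *\<^sub>R v) = 1 *\<^sub>R g v x" by metis
    then show ?thesis by simp
  qed
  then have "T = (\<lambda>v. g v x)" by blast
  with fT show ?thesis by simp
qed

text \<open>Holomorphic along every complex line and continuous.  Unlike complex differentiability, this is
evidently stable under locally uniform limits, which is how it passes to directional derivatives.\<close>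

definition gateaux_holomorphic :: "(complex^'n) set \<Rightarrow> (complex^'n \<Rightarrow> complex) \<Rightarrow> bool" where
  "gateaux_holomorphic S f \<longleftrightarrow> continuous_on S f \<and>
     (\<forall>z\<in>S. \<forall>v. (\<lambda>w. f (z + w *s v)) field_differentiable (at 0))"

definition complex_directional :: "(complex^'n \<Rightarrow> complex) \<Rightarrow> complex^'n \<Rightarrow> complex^'n \<Rightarrow> complex" where
  "complex_directional f v z = deriv (\<lambda>w. f (z + w *s v)) 0"

lemma norm_vector_scalar_mult: "norm (c *s (v::complex^'n)) = cmod c * norm v"
  unfolding norm_vec_def L2_set_def
  by (simp add: norm_mult power_mult_distrib flip: sum_distrib_left) (simp add: real_sqrt_mult)

lemma scaleR_eq_scalar_mult: "r *\<^sub>R (v::complex^'n) = complex_of_real r *s v"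
  unfolding vec_eq_iff vector_scaleR_component vector_smult_component by (simp add: scaleR_conv_of_real)

lemma complex_linear_scale:
  fixes f :: "complex^'n \<Rightarrow> complex^'m"
  assumes "linear f" "\<And>v. f (\<i> *s v) = \<i> *s f v"
  shows "f (c *s v) = c *s f v"
proof -
  have d: "c *s u = Re c *\<^sub>R u + Im c *\<^sub>R (\<i> *s u)" for u :: "complex^'k"
  proof -
    have c: "c = complex_of_real (Re c) + complex_of_real (Im c) * \<i>" by (simp add: complex_eq_iff)
    have "c * y = complex_of_real (Re c) * y + complex_of_real (Im c) * (\<i> * y)" for y
      by (subst (1) c) (simp only: distrib_right mult.assoc)
    then show ?thesis by (simp add: scaleR_eq_scalar_mult vec_eq_iff)
  qed
  have "f (c *s v) = f (Re c *\<^sub>R v + Im c *\<^sub>R (\<i> *s v))" using d[of v] by simp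
  also have "\<dots> = Re c *\<^sub>R f v + Im c *\<^sub>R (\<i> *s f v)"
    by (simp add: linear_add[OF assms(1)] linear_scale[OF assms(1)] assms(2))
  finally show ?thesis using d[of "f v"] by simp
qed

lemma bounded_linear_scalar_mult_left: "bounded_linear (\<lambda>c. c *s (v::complex^'n))"
  by (rule bounded_linear_intro[of _ "norm v"])
     (auto simp: norm_vector_scalar_mult scaleR_eq_scalar_mult scaleR_conv_of_real vec.scale_left_distrib)

lemma bounded_linear_scalar_mult_right: "bounded_linear (\<lambda>v::complex^'n. c *s v)"
  by (rule bounded_linear_intro[of _ "cmod c"])
     (auto simp: norm_vector_scalar_mult scaleR_eq_scalar_mult vec.scale_right_distrib mult.commute)

lemma gateaux_holomorphic_on_line:
  assumes "gateaux_holomorphic S f"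
  shows "(\<lambda>w. f (z + w *s v)) holomorphic_on {w. z + w *s v \<in> S}"
proof (rule holomorphic_onI)
  fix w0 assume w0: "w0 \<in> {w. z + w *s v \<in> S}"
  have "(\<lambda>w. f ((z + w0 *s v) + w *s v)) field_differentiable (at (w0 - w0))"
    using assms w0 unfolding gateaux_holomorphic_def by simp
  then obtain D where "((\<lambda>w. f ((z + w0 *s v) + w *s v)) has_field_derivative D) (at (w0 - w0))"
    unfolding field_differentiable_def by blast
  moreover have "((\<lambda>w. w - w0) has_field_derivative 1) (at w0)" by (auto intro!: derivative_eq_intros)
  ultimately have "((\<lambda>w. f (z + w0 *s v + (w - w0) *s v)) has_field_derivative D * 1) (at w0)"
    by (rule DERIV_chain2)
  moreover have "z + w0 *s v + (w - w0) *s v = z + w *s v" for w by (vector algebra_simps)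
  ultimately show "(\<lambda>w. f (z + w *s v)) field_differentiable at w0 within {w. z + w *s v \<in> S}"
    by (auto simp: field_differentiable_def intro: has_field_derivative_at_within)
qed

text \<open>Taylor's formula of first order, with the Cauchy estimate \<open>8 M / r\<^sup>2\<close> for the second derivative on the
disc of radius \<open>r / 2\<close>.\<close>

lemma difference_quotient_estimate:
  assumes r: "r > 0" and h: "\<phi> holomorphic_on ball 0 r" and c: "continuous_on (cball 0 r) \<phi>"
    and M: "\<And>w. cmod w \<le> r \<Longrightarrow> cmod (\<phi> w) \<le> M" and t: "t \<noteq> 0" "cmod t \<le> r / 2"
  shows "cmod ((\<phi> t - \<phi> 0) / t - deriv \<phi> 0) \<le> 8 * M / r\<^sup>2 * cmod t"
proof -
  have nle: "cmod y \<le> cmod x + dist x y" for x y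
    using norm_triangle_sub[of y x] by (simp add: dist_norm norm_minus_commute)
  have sub: "cball x (r/2) \<subseteq> cball 0 r" "ball x (r/2) \<subseteq> ball 0 r" if "x \<in> cball 0 (r/2)" for x :: complex
    using that nle[of _ x] by (auto simp: subset_iff) (smt (verit) nle field_sum_of_halves)+
  have hd: "(deriv ^^ i) \<phi> holomorphic_on ball 0 r" for i
    by (rule holomorphic_higher_deriv[OF h]) simp
  have "cmod ((deriv ^^ 0) \<phi> t - (\<Sum>i\<le>1. (deriv ^^ i) \<phi> 0 * (t - 0) ^ i / fact i))
      \<le> (8 * M / r\<^sup>2) * cmod (t - 0) ^ Suc 1 / fact 1"
  proof (rule complex_Taylor[of "cball 0 (r/2)"])
    show "((deriv ^^ i) \<phi> has_field_derivative (deriv ^^ Suc i) \<phi> x) (at x within cball 0 (r / 2))"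
      if "x \<in> cball 0 (r/2)" for i x
      using holomorphic_derivI[OF hd[of i] open_ball, of x] that r by auto
    show "cmod ((deriv ^^ Suc 1) \<phi> x) \<le> 8 * M / r\<^sup>2" if x: "x \<in> cball 0 (r/2)" for x
    proof -
      have "cmod ((deriv ^^ 2) \<phi> x) \<le> fact 2 * M / (r/2)^2"
        using sub[OF x] r
        by (intro Cauchy_inequality holomorphic_on_subset[OF h] continuous_on_subset[OF c] M) (auto simp: dist_norm)
      also have "\<dots> = 8 * M / r\<^sup>2" by (simp add: power_divide)
      finally show ?thesis by (simp add: numeral_2_eq_2)
    qed
  qed (use r t in auto)
  then have "cmod (\<phi> t - \<phi> 0 - deriv \<phi> 0 * t) \<le> (8 * M / r\<^sup>2) * (cmod t * cmod t)"
    by (simp add: algebra_simps power2_eq_square)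
  moreover have "(\<phi> t - \<phi> 0) / t - deriv \<phi> 0 = (\<phi> t - \<phi> 0 - deriv \<phi> 0 * t) / t"
    using t by (simp add: field_simps)
  ultimately show ?thesis using t by (simp add: norm_divide divide_le_eq mult_ac)
qed

text \<open>Along lines in direction \<open>v\<close> through points near \<open>z\<^sub>0\<close> one radius and one bound for \<open>f\<close> serve in the
estimate above, so the difference quotients converge uniformly.\<close>

lemma complex_directional_uniform_limit:
  assumes S: "open S" "z0 \<in> S" and f: "gateaux_holomorphic S f"
  obtains \<delta> t where "\<delta> > 0" "\<And>n::nat. t n \<noteq> 0" "\<And>n z. z \<in> cball z0 \<delta> \<Longrightarrow> z \<in> S \<and> z + t n *s v \<in> S"
    "uniform_limit (cball z0 \<delta>) (\<lambda>n z. (f (z + t n *s v) - f z) / t n) (complex_directional f v) sequentially"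
proof -
  obtain \<epsilon> where \<epsilon>: "\<epsilon> > 0" "cball z0 \<epsilon> \<subseteq> S" using S open_contains_cball by blast
  define \<delta> where "\<delta> = \<epsilon> / 2"
  define r where "r = \<epsilon> / (2 * (1 + norm v))"
  have nv: "1 + norm v > 0" by (simp add: add_pos_nonneg)
  have r: "r > 0" unfolding r_def using \<epsilon> nv by simp
  have "continuous_on S f" using f unfolding gateaux_holomorphic_def by blast
  then have "continuous_on (cball z0 \<epsilon>) f" using \<epsilon>(2) continuous_on_subset by blast
  then have "compact (f ` cball z0 \<epsilon>)" by (intro compact_continuous_image compact_cball)
  then obtain M where M: "\<And>z. z \<in> cball z0 \<epsilon> \<Longrightarrow> cmod (f z) \<le> M"
    using compact_imp_bounded bounded_iff by (metis imageI)
  have near: "z + w *s v \<in> cball z0 \<epsilon>" if "z \<in> cball z0 \<delta>" "cmod w \<le> r" for z w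
  proof -
    have "norm (w *s v) \<le> r * norm v" using that by (simp add: norm_vector_scalar_mult mult_right_mono)
    also have "\<dots> \<le> r * (1 + norm v)" using r by simp
    also have "\<dots> = \<epsilon> / 2" unfolding r_def using nv by (simp add: field_simps)
    finally have "norm (w *s v) \<le> \<epsilon> / 2" .
    moreover have "norm (z - z0) \<le> \<epsilon> / 2" using that unfolding \<delta>_def by (simp add: dist_norm norm_minus_commute)
    ultimately have "norm ((z - z0) + w *s v) \<le> \<epsilon>" using norm_triangle_ineq[of "z - z0" "w *s v"] by linarith
    then show ?thesis by (simp add: dist_norm norm_minus_commute algebra_simps)
  qed
  define t where "t n = complex_of_real (r / 2 * inverse (real (Suc n)))" for n
  have t0: "t n \<noteq> 0" for n unfolding t_def using r by (simp del: of_nat_Suc)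
  have tr: "cmod (t n) \<le> r / 2" for n
    unfolding t_def norm_of_real using r mult_left_le[of "inverse (real (Suc n))" "r / 2"]
    by (simp add: abs_mult inverse_le_1_iff)
  have "t \<longlonglongrightarrow> complex_of_real (r / 2 * 0)" unfolding t_def
    by (intro tendsto_intros LIMSEQ_inverse_real_of_nat)
  then have tlim: "(\<lambda>n. 8 * M / r\<^sup>2 * cmod (t n)) \<longlonglongrightarrow> 0"
    by (intro tendsto_mult_right_zero tendsto_norm_zero) simp
  have est: "cmod ((f (z + t n *s v) - f z) / t n - complex_directional f v z) \<le> 8 * M / r\<^sup>2 * cmod (t n)"
    if z: "z \<in> cball z0 \<delta>" for z n
  proof -
    have hol: "(\<lambda>w. f (z + w *s v)) holomorphic_on cball 0 r"
      by (rule holomorphic_on_subset[OF gateaux_holomorphic_on_line[OF f]]) (use near[OF z] \<epsilon> in auto)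
    have "cmod ((f (z + t n *s v) - f (z + 0 *s v)) / t n - deriv (\<lambda>w. f (z + w *s v)) 0) \<le> 8 * M / r\<^sup>2 * cmod (t n)"
      by (rule difference_quotient_estimate[OF r holomorphic_on_subset[OF hol ball_subset_cball]
            holomorphic_on_imp_continuous_on[OF hol] M[OF near[OF z]] t0 tr])
    then show ?thesis unfolding complex_directional_def by simp
  qed
  have ul: "uniform_limit (cball z0 \<delta>) (\<lambda>n z. (f (z + t n *s v) - f z) / t n) (complex_directional f v) sequentially"
  proof (rule uniform_limitI)
    fix e :: real assume "e > 0"
    with tlim have "\<forall>\<^sub>F n in sequentially. 8 * M / r\<^sup>2 * cmod (t n) < e" by (rule order_tendstoD)
    then show "\<forall>\<^sub>F n in sequentially. \<forall>x\<in>cball z0 \<delta>. dist ((f (x + t n *s v) - f x) / t n) (complex_directional f v x) < e"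
      by eventually_elim (use le_less_trans[OF est] in \<open>auto simp: dist_norm\<close>)
  qed
  show thesis
  proof (rule that[OF _ t0 _ ul])
    show "\<delta> > 0" unfolding \<delta>_def using \<epsilon> by simp
    show "z \<in> S \<and> z + t n *s v \<in> S" if "z \<in> cball z0 \<delta>" for z n
      using near[OF that, of 0] near[OF that, of "t n"] \<epsilon>(2) r tr[of n] by auto
  qed
qed

text \<open>Difference quotients of \<open>f\<close> are continuous and holomorphic along lines, and both properties survive a
uniform limit.\<close>

lemma gateaux_holomorphic_directional:
  assumes S: "open S" and f: "gateaux_holomorphic S f"
  shows "gateaux_holomorphic S (complex_directional f v)"
proof -
  have cf: "continuous_on S f" using f unfolding gateaux_holomorphic_def by blast
  have *: "isCont (complex_directional f v) z0 \<and> (\<forall>u. (\<lambda>w. complex_directional f v (z0 + w *s u)) field_differentiable (at 0))"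
    if z0: "z0 \<in> S" for z0
  proof -
    obtain \<delta> t where \<delta>: "\<delta> > 0" and t: "\<And>n::nat. t n \<noteq> 0" "\<And>n z. z \<in> cball z0 \<delta> \<Longrightarrow> z \<in> S \<and> z + t n *s v \<in> S"
      and ul: "uniform_limit (cball z0 \<delta>) (\<lambda>n z. (f (z + t n *s v) - f z) / t n) (complex_directional f v) sequentially"
      using complex_directional_uniform_limit[OF S z0 f] by blast
    have cq: "continuous_on (cball z0 \<delta>) (\<lambda>z. (f (z + t n *s v) - f z) / t n)" for n
      using t by (intro continuous_intros continuous_on_compose2[OF cf]) auto
    have cd: "continuous_on (cball z0 \<delta>) (complex_directional f v)"
      by (rule uniform_limit_theorem[OF _ ul]) (use cq in auto)
    then have "continuous_on (ball z0 \<delta>) (complex_directional f v)"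
      by (rule continuous_on_subset) auto
    then have 1: "isCont (complex_directional f v) z0"
      using \<delta> by (simp add: continuous_on_eq_continuous_at)
    have "(\<lambda>w. complex_directional f v (z0 + w *s u)) field_differentiable (at 0)" for u
    proof -
      define \<eta> where "\<eta> = \<delta> / (1 + norm u)"
      have nu: "1 + norm u > 0" by (simp add: add_pos_nonneg)
      have \<eta>: "\<eta> > 0" unfolding \<eta>_def using nu \<delta> by simp
      have near: "z0 + w *s u \<in> cball z0 \<delta>" if "w \<in> cball 0 \<eta>" for w
      proof -
        have "norm (w *s u) \<le> \<eta> * norm u" using that by (simp add: norm_vector_scalar_mult mult_right_mono)
        also have "\<dots> \<le> \<eta> * (1 + norm u)" using \<eta> by simp
        also have "\<dots> = \<delta>" unfolding \<eta>_def using nu by (simp add: field_simps)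
        finally show ?thesis by (simp add: dist_norm)
      qed
      have near_t: "z0 + t n *s v + w *s u \<in> S" if "w \<in> cball 0 \<eta>" for w n
        using t(2)[OF near[OF that], of n] by (simp add: add_ac)
      have hq: "(\<lambda>w. (f (z0 + w *s u + t n *s v) - f (z0 + w *s u)) / t n) holomorphic_on cball 0 \<eta>" for n
      proof -
        have "(\<lambda>w. f ((z0 + t n *s v) + w *s u)) holomorphic_on cball 0 \<eta>"
          by (rule holomorphic_on_subset[OF gateaux_holomorphic_on_line[OF f]])
             (use near_t in auto)
        moreover have "(\<lambda>w. f (z0 + w *s u)) holomorphic_on cball 0 \<eta>"
          by (rule holomorphic_on_subset[OF gateaux_holomorphic_on_line[OF f]])
             (use near t in auto)
        ultimately show ?thesis using t(1) by (intro holomorphic_intros) (auto simp: add_ac)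
      qed
      have "uniform_limit (cball 0 \<eta>) (\<lambda>n w. (f (z0 + w *s u + t n *s v) - f (z0 + w *s u)) / t n)
        (\<lambda>w. complex_directional f v (z0 + w *s u)) sequentially"
        by (rule uniform_limit_compose'[OF ul]) (use near in auto)
      then have "(\<lambda>w. complex_directional f v (z0 + w *s u)) holomorphic_on ball 0 \<eta>"
        by (rule holomorphic_uniform_limit[rotated])
           (use hq in \<open>auto intro!: always_eventually holomorphic_on_imp_continuous_on intro: holomorphic_on_subset[OF _ ball_subset_cball]\<close>)
      then show ?thesis using \<eta> by (simp add: holomorphic_on_imp_differentiable_at)
    qed
    with 1 show ?thesis by blast
  qed
  then show ?thesis unfolding gateaux_holomorphic_def by (auto intro: continuous_at_imp_continuous_on)
qed

lemma gateaux_holomorphic_has_derivative: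
  assumes S: "open S" "x \<in> S" and f: "gateaux_holomorphic S f"
  shows "(f has_derivative (\<lambda>v. complex_directional f v x)) (at x)"
proof (rule has_derivative_continuous_directional[OF S])
  show "continuous_on S (complex_directional f b)" for b
    using gateaux_holomorphic_directional[OF S(1) f] unfolding gateaux_holomorphic_def by blast
  fix y b assume "y \<in> S"
  then have "((\<lambda>w. f (y + w *s b)) has_field_derivative complex_directional f b y) (at 0)"
    using f unfolding gateaux_holomorphic_def complex_directional_def
    by (simp add: field_differentiable_derivI)
  then have "((\<lambda>w. f (y + w *s b)) has_field_derivative complex_directional f b y) (at (complex_of_real 0))" by simp
  from has_vector_derivative_real_field[OF this, of UNIV]
  have "((\<lambda>s. f (y + complex_of_real s *s b)) has_vector_derivative complex_directional f b y) (at 0)" by simp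
  then show "((\<lambda>s. f (y + s *\<^sub>R b)) has_vector_derivative complex_directional f b y) (at 0)" by (simp add: scaleR_eq_scalar_mult)
qed

lemma gateaux_holomorphic_smooth:
  assumes S: "open S" and f: "gateaux_holomorphic S f"
  shows "smooth_on S f"
proof -
  have "Ck_on k S f" for k
    using f
  proof (induction k arbitrary: f)
    case 0
    then show ?case unfolding gateaux_holomorphic_def by simp
  next
    case (Suc k)
    show ?case
      by (rule Ck_on_SucI[OF S gateaux_holomorphic_has_derivative[OF S _ Suc.prems]
            Suc.IH[OF gateaux_holomorphic_directional[OF S Suc.prems]]])
  qed
  then show ?thesis unfolding smooth_on_def by blast
qed

text \<open>Goursat's theorem in several variables: directional derivatives can be taken again and again, and
continuous directional derivatives are Frechet derivatives (Osgood).  As a consequence, the maps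
constructed below are shown to be holomorphic by exhibiting a complex linear derivative.\<close>

lemma complex_differentiable_imp_holomorphic_map_on:
  fixes f :: "complex^'n \<Rightarrow> complex^'m"
  assumes S: "open S" and f: "\<And>x. x \<in> S \<Longrightarrow> (f has_derivative f' x) (at x)"
    and lin: "\<And>x v. x \<in> S \<Longrightarrow> f' x (\<i> *s v) = \<i> *s f' x v"
  shows "holomorphic_map_on S f"
proof -
  have clin: "f' x (c *s v) = c *s f' x v" if x: "x \<in> S" for x c v
    by (rule complex_linear_scale[OF has_derivative_linear[OF f[OF x]] lin[OF x]])
  have gh: "gateaux_holomorphic S (\<lambda>x. f x $ j)" for j
    unfolding gateaux_holomorphic_def
  proof (intro conjI ballI allI)
    show "continuous_on S (\<lambda>x. f x $ j)"
      by (intro continuous_on_component continuous_at_imp_continuous_on ballI has_derivative_continuous[OF f])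
    fix z v assume z: "z \<in> S"
    have "((\<lambda>w. f (z + w *s v)) has_derivative (\<lambda>w. f' z (w *s v))) (at 0)"
      by (rule has_derivative_compose[where g = f and f = "\<lambda>w. z + w *s v"])
         (use f[OF z] in \<open>auto intro!: derivative_eq_intros bounded_linear_imp_has_derivative bounded_linear_scalar_mult_left\<close>)
    then have "((\<lambda>w. f (z + w *s v) $ j) has_derivative (\<lambda>w. f' z (w *s v) $ j)) (at 0)"
      by (rule bounded_linear.has_derivative[OF bounded_linear_vec_nth])
    then have "((\<lambda>w. f (z + w *s v) $ j) has_field_derivative f' z v $ j) (at 0)"
      unfolding has_field_derivative_def by (simp add: clin[OF z] mult.commute[of _ "f' z v $ j"])
    then show "(\<lambda>w. f (z + w *s v) $ j) field_differentiable at 0" unfolding field_differentiable_def by blast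
  qed
  have ax: "bounded_linear (\<lambda>c::complex. axis j c :: complex^'m)" for j
  proof -
    have "c *s (axis j 1 :: complex^'m) = axis j c" for c :: complex
      unfolding vec_eq_iff vector_smult_component by (simp add: axis_def)
    then have "(\<lambda>c. c *s (axis j 1 :: complex^'m)) = (\<lambda>c. axis j c)"
      by (simp only: fun_eq_iff simp_thms)
    with bounded_linear_scalar_mult_left[of "axis j 1 :: complex^'m"] show ?thesis by simp
  qed
  have "smooth_on S (\<lambda>x. \<Sum>j\<in>UNIV. axis j (f x $ j))"
    by (intro smooth_on_sum S smooth_on_linear[OF ax] gateaux_holomorphic_smooth gh) auto
  moreover have "(\<Sum>j\<in>UNIV. axis j (f x $ j)) = f x" for x
    unfolding vec_eq_iff by (simp add: axis_def)
  ultimately have "smooth_on S f" by simp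
  moreover have "f' x = frechet_derivative f (at x)" if "x \<in> S" for x
    by (rule frechet_derivative_at[OF f[OF that]])
  ultimately show ?thesis unfolding holomorphic_map_on_def using lin by auto
qed

section \<open>Dependence of solutions of differential equations on parameters\<close>

text \<open>The bounds on \<open>F\<close> make the integral operator a contraction by \<open>1/2\<close> of the continuous paths in
\<open>cball y0 R\<close> over the whole unit interval.\<close>

lemma small_rate_ode_exists:
  fixes F :: "real \<Rightarrow> 'e::euclidean_space \<Rightarrow> 'e"
  assumes R: "R \<ge> 0" and cont: "continuous_on ({0..1} \<times> cball y0 R) (\<lambda>(t, y). F t y)"
    and bnd: "\<And>t y. t \<in> {0..1} \<Longrightarrow> y \<in> cball y0 R \<Longrightarrow> norm (F t y) \<le> R"
    and lip: "\<And>t y y'. t \<in> {0..1} \<Longrightarrow> y \<in> cball y0 R \<Longrightarrow> y' \<in> cball y0 R \<Longrightarrow>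
      norm (F t y - F t y') \<le> 1/2 * norm (y - y')"
  obtains y where "y 0 = y0" "\<And>t. t \<in> {0..1} \<Longrightarrow> y t \<in> cball y0 R"
    "\<And>t. t \<in> {0..1} \<Longrightarrow> (y has_vector_derivative F t (y t)) (at t within {0..1})"
proof -
  (* Bounded continuous functions are defined on the whole real line, so paths are extended
     constantly beyond the unit interval. *)
  define clip :: "real \<Rightarrow> real" where "clip t = max 0 (min 1 t)" for t
  have clip: "clip t \<in> {0..1}" "t \<in> {0..1} \<Longrightarrow> clip t = t" for t unfolding clip_def by auto
  define P where "P = PiC UNIV (\<lambda>_::real. cball y0 R)"
  have P: "\<phi> \<in> P \<longleftrightarrow> (\<forall>t. apply_bcontfun \<phi> t \<in> cball y0 R)" for \<phi>
    unfolding P_def mem_PiC_iff by auto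
  have cF: "continuous_on {0..1} (\<lambda>s. F s (apply_bcontfun \<phi> s))" if "\<phi> \<in> P" for \<phi>
  proof -
    have "continuous_on {0..1} (\<lambda>s. (\<lambda>(t, y). F t y) (s, apply_bcontfun \<phi> s))"
      using that unfolding P by (intro continuous_on_compose2[OF cont] continuous_intros) auto
    then show ?thesis by simp
  qed
  define I where "I \<phi> t = y0 + integral {0..clip t} (\<lambda>s. F s (apply_bcontfun \<phi> s))" for \<phi> t
  have I_in: "I \<phi> t \<in> cball y0 R" if "\<phi> \<in> P" for \<phi> t
  proof -
    have "norm (integral {0..clip t} (\<lambda>s. F s (apply_bcontfun \<phi> s))) \<le> R * (clip t - 0)"
      using clip(1)[of t] that P
      by (intro integral_bound continuous_on_subset[OF cF[OF that]] bnd) auto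
    also have "\<dots> \<le> R" using clip(1)[of t] R by (simp add: mult_left_le)
    finally show ?thesis unfolding I_def by (simp add: dist_norm)
  qed
  have I_bcont: "I \<phi> \<in> bcontfun" if "\<phi> \<in> P" for \<phi>
  proof -
    have "continuous_on {0..1} (\<lambda>x. integral {0..x} (\<lambda>s. F s (apply_bcontfun \<phi> s)))"
      by (intro indefinite_integral_continuous_1 integrable_continuous_real cF that)
    then have "continuous_on UNIV (\<lambda>t. integral {0..clip t} (\<lambda>s. F s (apply_bcontfun \<phi> s)))"
      by (rule continuous_on_compose2) (auto simp: clip_def intro!: continuous_intros)
    then have "continuous_on UNIV (I \<phi>)" unfolding I_def by (intro continuous_intros)
    moreover have "bounded (range (I \<phi>))"
      by (rule bounded_subset[OF bounded_cball, of _ y0 R]) (use I_in[OF that] in auto)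
    ultimately show ?thesis unfolding bcontfun_def by simp
  qed
  define T where "T \<phi> = Bcontfun (I \<phi>)" for \<phi>
  have T: "apply_bcontfun (T \<phi>) = I \<phi>" if "\<phi> \<in> P" for \<phi>
    unfolding T_def by (rule Bcontfun_inverse[OF I_bcont[OF that]])
  have "\<exists>!\<phi>. \<phi> \<in> P \<and> T \<phi> = \<phi>"
  proof (rule Banach_fix[of P "1/2"])
    show "complete P" unfolding P_def by (intro complete_eq_closed[THEN iffD2] closed_PiC closed_cball)
    have "const_bcontfun y0 \<in> P" unfolding P using R by (simp add: const_bcontfun.rep_eq)
    then show "P \<noteq> {}" by blast
    show "T ` P \<subseteq> P"
      using I_in T by (auto simp: P)
    show "dist (T \<phi>) (T \<psi>) \<le> 1/2 * dist \<phi> \<psi>" if "\<phi> \<in> P" "\<psi> \<in> P" for \<phi> \<psi>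
    proof (rule dist_bound)
      fix t
      note c = continuous_on_subset[OF cF[OF that(1)], of "{0..clip t}"] continuous_on_subset[OF cF[OF that(2)], of "{0..clip t}"]
      have sub: "{0..clip t} \<subseteq> {0..1}" using clip(1)[of t] by auto
      have "dist (I \<phi> t) (I \<psi> t) = norm (integral {0..clip t} (\<lambda>s. F s (apply_bcontfun \<phi> s) - F s (apply_bcontfun \<psi> s)))"
        unfolding I_def dist_norm using c sub
        by (subst integral_diff) (auto intro!: integrable_continuous_real)
      also have "\<dots> \<le> (1/2 * dist \<phi> \<psi>) * (clip t - 0)"
      proof (rule integral_bound)
        show "continuous_on {0..clip t} (\<lambda>s. F s (apply_bcontfun \<phi> s) - F s (apply_bcontfun \<psi> s))"
          using c sub by (intro continuous_on_diff) auto
        fix s assume s: "s \<in> {0..clip t}"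
        have "norm (F s (apply_bcontfun \<phi> s) - F s (apply_bcontfun \<psi> s)) \<le> 1/2 * norm (apply_bcontfun \<phi> s - apply_bcontfun \<psi> s)"
          using s sub that P by (intro lip) auto
        also have "\<dots> \<le> 1/2 * dist \<phi> \<psi>" using dist_bounded[of \<phi> s \<psi>] by (simp add: dist_norm)
        finally show "norm (F s (apply_bcontfun \<phi> s) - F s (apply_bcontfun \<psi> s)) \<le> 1/2 * dist \<phi> \<psi>" .
      qed (use clip(1)[of t] in auto)
      also have "\<dots> \<le> 1/2 * dist \<phi> \<psi>" using clip(1)[of t] by (simp add: mult_left_le)
      finally show "dist (apply_bcontfun (T \<phi>) t) (apply_bcontfun (T \<psi>) t) \<le> 1/2 * dist \<phi> \<psi>"
        using T that by simp
    qed
  qed auto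
  then obtain \<phi> where \<phi>: "\<phi> \<in> P" "T \<phi> = \<phi>" by blast
  have eq: "apply_bcontfun \<phi> t = I \<phi> t" for t using T[OF \<phi>(1)] \<phi>(2) by simp
  show thesis
  proof (rule that)
    show "apply_bcontfun \<phi> 0 = y0" using eq[of 0] unfolding I_def clip_def by simp
    show "apply_bcontfun \<phi> t \<in> cball y0 R" for t using \<phi>(1) P by blast
    fix t :: real assume t: "t \<in> {0..1}"
    have "((\<lambda>u. y0 + integral {0..u} (\<lambda>s. F s (apply_bcontfun \<phi> s))) has_vector_derivative 0 + F t (apply_bcontfun \<phi> t)) (at t within {0..1})"
      by (intro has_vector_derivative_add has_vector_derivative_const integral_has_vector_derivative cF \<phi> t)
    then have "((\<lambda>u. y0 + integral {0..u} (\<lambda>s. F s (apply_bcontfun \<phi> s))) has_vector_derivative F t (apply_bcontfun \<phi> t)) (at t within {0..1})"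
      by simp
    then show "(apply_bcontfun \<phi> has_vector_derivative F t (apply_bcontfun \<phi> t)) (at t within {0..1})"
    proof (rule has_vector_derivative_transform[OF t, rotated])
      show "apply_bcontfun \<phi> u = y0 + integral {0..u} (\<lambda>s. F s (apply_bcontfun \<phi> s))" if "u \<in> {0..1}" for u
        using eq[of u] unfolding I_def clip(2)[OF that] .
    qed
  qed
qed

text \<open>With the rate \<open>1/2\<close> on an interval of length \<open>1\<close>, Gronwall's inequality is the mean value inequality
at a point where the norm is maximal.\<close>

lemma small_rate_gronwall:
  fixes d :: "real \<Rightarrow> 'e::euclidean_space"
  assumes D: "\<And>t. t \<in> {0..1} \<Longrightarrow> (d has_vector_derivative d' t) (at t within {0..1})"
    and bnd: "\<And>t. t \<in> {0..1} \<Longrightarrow> norm (d' t) \<le> 1/2 * norm (d t) + e" and t: "t \<in> {0..1}"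
  shows "norm (d t) \<le> 2 * (norm (d 0) + e)"
proof -
  have "continuous_on {0..1} (\<lambda>t. norm (d t))"
    by (intro continuous_on_norm continuous_on_vector_derivative[OF D])
  then obtain s where s: "s \<in> {0..1}" "\<And>t. t \<in> {0..1} \<Longrightarrow> norm (d t) \<le> norm (d s)"
    using continuous_attains_sup[of "{0..1::real}" "\<lambda>t. norm (d t)"] by auto
  define B where "B = 1/2 * norm (d s) + e"
  have B: "norm (d' t) \<le> B" if "t \<in> {0..1}" for t
    using bnd[OF that] s(2)[OF that] unfolding B_def by simp
  have B0: "B \<ge> 0" using order_trans[OF norm_ge_zero B[OF s(1)]] .
  have "norm (d s - d 0) \<le> B * norm (s - 0)"
  proof (rule differentiable_bound[OF _ D[unfolded has_vector_derivative_def]])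
    show "onorm (\<lambda>h. h *\<^sub>R d' t) \<le> B" if "t \<in> {0..1}" for t
      using B[OF that] B0 by (intro onorm_bound) (auto simp: mult.commute[of B] intro!: mult_left_mono)
  qed (use s in auto)
  also have "\<dots> \<le> B" using s(1) B0 by (simp add: mult_left_le)
  finally have "norm (d s) \<le> norm (d 0) + B" using norm_triangle_sub[of "d s" "d 0"] by linarith
  then have "norm (d s) \<le> 2 * (norm (d 0) + e)" unfolding B_def by simp
  with s(2)[OF t] show ?thesis by linarith
qed

text \<open>The equation is \<open>y' = F(y, z)\<close>, \<open>y(0) = z\<close>, where \<open>z\<close> is both parameter and initial value.  The hypotheses on
\<open>F\<close> at \<open>(p, p)\<close> make its Lipschitz constant in the first argument at most \<open>1/2\<close> near that point, so
solutions exist for unit time.  The derivative of \<open>z \<mapsto> y\<^sub>z(1)\<close> in direction \<open>h\<close> is \<open>\<xi>(1)\<close>, where \<open>\<xi>\<close>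
solves the linear equation obtained by differentiating formally in \<open>z\<close>: the error
\<open>y\<^bsub>z+h\<^esub> - y\<^sub>z - \<xi>\<close> satisfies this equation up to a term \<open>o(h)\<close>.  Since solutions of the linear equation are
unique, the last conclusion evaluates the derivative on any explicitly known solution.\<close>

lemma ode_differentiable_dependence:
  fixes F :: "'e::euclidean_space \<times> 'e \<Rightarrow> 'e" and F' :: "'e \<times> 'e \<Rightarrow> ('e \<times> 'e) \<Rightarrow>\<^sub>L 'e"
  assumes S: "open S" "(p, p) \<in> S" and F: "\<And>x. x \<in> S \<Longrightarrow> (F has_derivative blinfun_apply (F' x)) (at x)"
    and F': "continuous_on S F'" and F0: "F (p, p) = 0" and F0': "\<And>\<eta>. blinfun_apply (F' (p, p)) (\<eta>, 0) = 0"
  obtains \<rho> y D where "\<rho> > 0"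
    "\<And>z. z \<in> ball p \<rho> \<Longrightarrow> y z 0 = z"
    "\<And>z t. z \<in> ball p \<rho> \<Longrightarrow> t \<in> {0..1} \<Longrightarrow> (y z t, z) \<in> S"
    "\<And>z t. z \<in> ball p \<rho> \<Longrightarrow> t \<in> {0..1} \<Longrightarrow> (y z has_vector_derivative F (y z t, z)) (at t within {0..1})"
    "\<And>z. z \<in> ball p \<rho> \<Longrightarrow> ((\<lambda>z. y z 1) has_derivative D z) (at z)"
    "\<And>z h. z \<in> ball p \<rho> \<Longrightarrow> \<exists>\<xi>. \<xi> 0 = h \<and> \<xi> 1 = D z h \<and> (\<forall>t\<in>{0..1}.
        (\<xi> has_vector_derivative blinfun_apply (F' (y z t, z)) (\<xi> t, h)) (at t within {0..1::real}))"
    "\<And>z h \<xi>. z \<in> ball p \<rho> \<Longrightarrow> \<xi> 0 = h \<Longrightarrow> (\<And>t. t \<in> {0..1} \<Longrightarrow>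
        (\<xi> has_vector_derivative blinfun_apply (F' (y z t, z)) (\<xi> t, h)) (at t within {0..1::real})) \<Longrightarrow> D z h = \<xi> 1"
proof -
  obtain d1 where d1: "d1 > 0" "ball (p, p) d1 \<subseteq> S" using S open_contains_ball by blast
  obtain d2 where d2: "d2 > 0" "\<And>x. x \<in> S \<Longrightarrow> dist x (p, p) < d2 \<Longrightarrow> dist (F' x) (F' (p, p)) < 1/2"
    using F' S(2) unfolding continuous_on_iff by (metis half_gt_zero zero_less_one)
  (* On the square of side R around (p, p) the partial derivative of F in the first argument
     has norm at most 1/2. *)
  define R where "R = min d1 d2 / 4"
  have R: "R > 0" unfolding R_def using d1 d2 by simp
  define K where "K = cball p R \<times> cball p R"
  have Knear: "dist x (p, p) < min d1 d2" if "x \<in> K" for x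
  proof -
    obtain a b where x: "x = (a, b)" by (cases x)
    have "dist x (p, p) \<le> dist a p + dist b p"
      unfolding x dist_Pair_Pair by (rule sqrt_sum_squares_le_sum) auto
    also have "\<dots> \<le> 2 * R" using that unfolding x K_def by (simp add: dist_commute)
    also have "\<dots> < min d1 d2" unfolding R_def using d1(1) d2(1) by (auto simp: min_def)
    finally show ?thesis .
  qed
  have KS: "K \<subseteq> S" using Knear d1(2) by (fastforce simp: dist_commute)
  have Kc: "convex K" "compact K" unfolding K_def by (auto intro: convex_Times compact_Times)
  have small: "norm (blinfun_apply (F' x) (\<eta>, 0)) \<le> 1/2 * norm \<eta>" if "x \<in> K" for x \<eta>
  proof -
    have "norm (blinfun_apply (F' x) (\<eta>, 0)) = norm (blinfun_apply (F' x - F' (p, p)) (\<eta>, 0))"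
      by (simp add: blinfun.diff_left F0')
    also have "\<dots> \<le> norm (F' x - F' (p, p)) * norm (\<eta>, 0::'e)" by (rule norm_blinfun)
    also have "\<dots> \<le> 1/2 * norm \<eta>"
    proof -
      have "norm (F' x - F' (p, p)) \<le> 1/2" using d2(2)[of x] Knear[OF that] KS that by (auto simp: dist_norm)
      from mult_right_mono[OF this norm_ge_zero] show ?thesis by (simp add: norm_Pair)
    qed
    finally show ?thesis .
  qed
  have "compact (F' ` K)" using F' KS Kc(2) by (intro compact_continuous_image) (auto intro: continuous_on_subset)
  then obtain M0 where M0: "\<And>x. x \<in> K \<Longrightarrow> norm (F' x) \<le> M0"
    using compact_imp_bounded bounded_iff by (metis imageI)
  define M where "M = max M0 0"
  have M: "norm (F' x) \<le> M" if "x \<in> K" for x using M0[OF that] unfolding M_def by simp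
  have M_ge: "M \<ge> 0" unfolding M_def by simp
  have FM: "norm (F x - F x') \<le> M * norm (x - x')" if "x \<in> K" "x' \<in> K" for x x'
    by (rule differentiable_bound[OF Kc(1), of F "\<lambda>x. blinfun_apply (F' x)"])
       (use that KS F M in \<open>auto intro: has_derivative_at_withinI simp flip: norm_blinfun.rep_eq\<close>)
  have F1: "norm (F (a, b) - F (a', b)) \<le> 1/2 * norm (a - a')"
    if "a \<in> cball p R" "a' \<in> cball p R" "b \<in> cball p R" for a a' b
  proof (rule differentiable_bound[OF convex_cball])
    show "((\<lambda>a. F (a, b)) has_derivative (\<lambda>\<eta>. blinfun_apply (F' (x, b)) (\<eta>, 0))) (at x within cball p R)"
      if "x \<in> cball p R" for x
    proof (rule has_derivative_compose[where g = F and f = "\<lambda>a. (a, b)"])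
      show "(F has_derivative blinfun_apply (F' (x, b))) (at (x, b))"
        using F KS that \<open>b \<in> cball p R\<close> unfolding K_def by blast
    qed (auto intro!: derivative_eq_intros)
    show "onorm (\<lambda>\<eta>. blinfun_apply (F' (x, b)) (\<eta>, 0)) \<le> 1/2" if "x \<in> cball p R" for x
      using small[of "(x, b)"] that \<open>b \<in> cball p R\<close> by (intro onorm_bound) (auto simp: K_def)
  qed (use that in auto)
  define \<rho> where "\<rho> = R / (4 * (1 + M))"
  have \<rho>: "\<rho> > 0" "\<rho> \<le> R / 4" "M * \<rho> \<le> R / 4"
    unfolding \<rho>_def using R M_ge by (auto simp: field_simps)
  have pK: "(p, p) \<in> K" unfolding K_def using R by simp
  have FR: "norm (F (a, z)) \<le> 3 * R / 4" if "a \<in> cball p R" "z \<in> ball p \<rho>" for a z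
  proof -
    have z: "dist p z \<le> \<rho>" "z \<in> cball p R" using that(2) \<rho> R by auto
    have "norm (F (p, z) - F (p, p)) \<le> M * norm ((p, z) - (p, p))"
      using z pK R by (intro FM) (auto simp: K_def)
    also have "\<dots> = M * dist p z" by (simp add: norm_Pair dist_norm norm_minus_commute)
    also have "\<dots> \<le> M * \<rho>" using z M_ge by (intro mult_left_mono)
    finally have 1: "norm (F (p, z)) \<le> R / 4" using \<rho> F0 by simp
    have "norm (F (a, z) - F (p, z)) \<le> 1/2 * norm (a - p)" using that z R by (intro F1) auto
    also have "\<dots> \<le> R / 2" using that by (simp add: dist_norm norm_minus_commute)
    finally show ?thesis using 1 norm_triangle_sub[of "F (a, z)" "F (p, z)"] by linarith
  qed
  have contF: "continuous_on S F"
    using F by (intro continuous_at_imp_continuous_on ballI has_derivative_continuous)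
  have "\<exists>y. y 0 = z \<and> (\<forall>t\<in>{0..1}. y t \<in> cball p R \<and> (y has_vector_derivative F (y t, z)) (at t within {0..1}))"
    if z: "z \<in> ball p \<rho>" for z
  proof -
    have sub: "cball z (3 * R / 4) \<subseteq> cball p R" using z \<rho> by (intro cball_subset_cball_iff[THEN iffD2]) (simp add: dist_commute)
    have zR: "z \<in> cball p R" using z \<rho> R by simp
    have inS: "(a, z) \<in> S" if "a \<in> cball z (3 * R / 4)" for a
      using that sub zR KS unfolding K_def by blast
    obtain y where y: "y 0 = z" "\<And>t. t \<in> {0..1} \<Longrightarrow> y t \<in> cball z (3 * R / 4)"
      "\<And>t. t \<in> {0..1} \<Longrightarrow> (y has_vector_derivative F (y t, z)) (at t within {0..1})"
    proof (rule small_rate_ode_exists[of "3 * R / 4" z "\<lambda>t a. F (a, z)"])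
      show "continuous_on ({0..1} \<times> cball z (3 * R / 4)) (\<lambda>(t, y). F (y, z))"
        unfolding case_prod_unfold
        by (rule continuous_on_compose2[OF contF])
           (use inS in \<open>auto intro!: continuous_intros\<close>)
      show "norm (F (a, z)) \<le> 3 * R / 4" if "a \<in> cball z (3 * R / 4)" for a
        using FR sub that z by blast
      show "norm (F (a, z) - F (a', z)) \<le> 1/2 * norm (a - a')"
        if "a \<in> cball z (3 * R / 4)" "a' \<in> cball z (3 * R / 4)" for a a'
        using F1 sub that zR by blast
    qed (use R in auto)
    then show ?thesis using sub by blast
  qed
  then obtain y where y0: "\<And>z. z \<in> ball p \<rho> \<Longrightarrow> y z 0 = z"
    and yR: "\<And>z t. z \<in> ball p \<rho> \<Longrightarrow> t \<in> {0..1} \<Longrightarrow> y z t \<in> cball p R"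
    and y': "\<And>z t. z \<in> ball p \<rho> \<Longrightarrow> t \<in> {0..1} \<Longrightarrow> (y z has_vector_derivative F (y z t, z)) (at t within {0..1})"
    by metis
  have zR: "z \<in> cball p R" if "z \<in> ball p \<rho>" for z using that \<rho> R by simp
  have yK: "(y z t, z) \<in> K" if "z \<in> ball p \<rho>" "t \<in> {0..1}" for z t
    using yR[OF that] zR[OF that(1)] unfolding K_def by blast
  define V where "V z h \<xi> \<longleftrightarrow> \<xi> 0 = h \<and> (\<forall>t\<in>{0..1}.
        (\<xi> has_vector_derivative blinfun_apply (F' (y z t, z)) (\<xi> t, h)) (at t within {0..1::real}))" for z h \<xi>
  have V_ex: "\<exists>\<xi>. V z h \<xi>" if z: "z \<in> ball p \<rho>" for z h
  proof -
    (* For |xi| <= |h| + R' the right hand side of the variational equation is at most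
       (|h| + R') / 2 + M |h| = R'. *)
    define R' where "R' = norm h + 2 * M * norm h"
    have conty: "continuous_on {0..1} (y z)" by (rule continuous_on_vector_derivative[OF y'[OF z]])
    have contF'y: "continuous_on {0..1} (\<lambda>t. F' (y z t, z))"
      by (rule continuous_on_compose2[OF F']) (use yK[OF z] KS in \<open>auto intro!: continuous_intros conty\<close>)
    obtain \<xi> where "\<xi> 0 = h" "\<And>t. t \<in> {0..1} \<Longrightarrow> \<xi> t \<in> cball h R'"
      "\<And>t. t \<in> {0..1} \<Longrightarrow> (\<xi> has_vector_derivative blinfun_apply (F' (y z t, z)) (\<xi> t, h)) (at t within {0..1})"
    proof (rule small_rate_ode_exists[of R' h "\<lambda>t \<xi>. blinfun_apply (F' (y z t, z)) (\<xi>, h)"])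
      show "R' \<ge> 0" unfolding R'_def using M_ge by simp
      have "continuous_on ({0..1} \<times> cball h R') (\<lambda>x. F' (y z (fst x), z))"
        by (rule continuous_on_compose2[OF contF'y]) (auto intro!: continuous_intros)
      then show "continuous_on ({0..1} \<times> cball h R') (\<lambda>(t, \<xi>). blinfun_apply (F' (y z t, z)) (\<xi>, h))"
        unfolding case_prod_unfold by (intro continuous_intros)
      fix t :: real assume t: "t \<in> {0..1}"
      have split: "blinfun_apply (F' (y z t, z)) (\<xi>, h) = blinfun_apply (F' (y z t, z)) (\<xi>, 0) + blinfun_apply (F' (y z t, z)) (0, h)" for \<xi>
        by (simp flip: blinfun.add_right)
      fix \<xi> assume \<xi>: "\<xi> \<in> cball h R'"
      have "norm (blinfun_apply (F' (y z t, z)) (0, h)) \<le> norm (F' (y z t, z)) * norm (0::'e, h)" by (rule norm_blinfun)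
      also have "\<dots> \<le> M * norm h" using M[OF yK[OF z t]] by (simp add: norm_Pair mult_right_mono)
      finally have 1: "norm (blinfun_apply (F' (y z t, z)) (0, h)) \<le> M * norm h" .
      have "norm \<xi> \<le> norm h + R'" using \<xi> norm_triangle_sub[of \<xi> h] by (simp add: dist_norm norm_minus_commute)
      then show "norm (blinfun_apply (F' (y z t, z)) (\<xi>, h)) \<le> R'"
        using 1 small[OF yK[OF z t], of \<xi>] norm_triangle_ineq[of "blinfun_apply (F' (y z t, z)) (\<xi>, 0)" "blinfun_apply (F' (y z t, z)) (0, h)"]
        unfolding split[of \<xi>] R'_def by (simp add: field_simps)
      fix \<xi>' :: 'e
      have "blinfun_apply (F' (y z t, z)) (\<xi>, h) - blinfun_apply (F' (y z t, z)) (\<xi>', h) = blinfun_apply (F' (y z t, z)) (\<xi> - \<xi>', 0)"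
        by (simp flip: blinfun.diff_right)
      then show "norm (blinfun_apply (F' (y z t, z)) (\<xi>, h) - blinfun_apply (F' (y z t, z)) (\<xi>', h)) \<le> 1/2 * norm (\<xi> - \<xi>')"
        using small[OF yK[OF z t]] by simp
    qed blast
    then show ?thesis unfolding V_def by blast
  qed
  have V_unique: "\<xi> t = \<xi>' t" if z: "z \<in> ball p \<rho>" and V: "V z h \<xi>" "V z h \<xi>'" and t: "t \<in> {0..1}" for z h \<xi> \<xi>' t
  proof -
    have "norm (\<xi> t - \<xi>' t) \<le> 2 * (norm (\<xi> 0 - \<xi>' 0) + 0)"
    proof (rule small_rate_gronwall[OF _ _ t])
      show "((\<lambda>t. \<xi> t - \<xi>' t) has_vector_derivative blinfun_apply (F' (y z t, z)) (\<xi> t - \<xi>' t, 0)) (at t within {0..1})"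
        if t: "t \<in> {0..1}" for t
      proof -
        have "((\<lambda>t. \<xi> t - \<xi>' t) has_vector_derivative blinfun_apply (F' (y z t, z)) (\<xi> t, h) - blinfun_apply (F' (y z t, z)) (\<xi>' t, h)) (at t within {0..1})"
          using V t unfolding V_def by (intro has_vector_derivative_diff) auto
        then show ?thesis by (simp flip: blinfun.diff_right)
      qed
      show "norm (blinfun_apply (F' (y z t, z)) (\<xi> t - \<xi>' t, 0)) \<le> 1/2 * norm (\<xi> t - \<xi>' t) + 0" if "t \<in> {0..1}" for t
        using small[OF yK[OF z that]] by simp
    qed
    then show ?thesis using V unfolding V_def by simp
  qed
  obtain X where X: "\<And>z h. z \<in> ball p \<rho> \<Longrightarrow> V z h (X z h)" using V_ex by metis
  define D where "D z h = X z h 1" for z h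
  have DV: "D z h = \<xi> 1" if "z \<in> ball p \<rho>" "V z h \<xi>" for z h \<xi>
    unfolding D_def by (rule V_unique[OF that(1) X[OF that(1)] that(2)]) simp
  have linD: "linear (D z)" if z: "z \<in> ball p \<rho>" for z
  proof
    fix h k
    have "V z (h + k) (\<lambda>t. X z h t + X z k t)"
      unfolding V_def
    proof (intro conjI ballI)
      show "X z h 0 + X z k 0 = h + k" using X[OF z] unfolding V_def by simp
      fix t :: real assume t: "t \<in> {0..1}"
      have "((\<lambda>t. X z h t + X z k t) has_vector_derivative
          blinfun_apply (F' (y z t, z)) (X z h t, h) + blinfun_apply (F' (y z t, z)) (X z k t, k)) (at t within {0..1})"
        using X[OF z] t unfolding V_def by (intro has_vector_derivative_add) auto
      then show "((\<lambda>t. X z h t + X z k t) has_vector_derivative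
          blinfun_apply (F' (y z t, z)) (X z h t + X z k t, h + k)) (at t within {0..1})"
        by (simp flip: blinfun.add_right)
    qed
    from DV[OF z this] show "D z (h + k) = D z h + D z k" unfolding D_def .
    fix r :: real
    have "V z (r *\<^sub>R h) (\<lambda>t. r *\<^sub>R X z h t)"
      unfolding V_def
    proof (intro conjI ballI)
      show "r *\<^sub>R X z h 0 = r *\<^sub>R h" using X[OF z] unfolding V_def by simp
      fix t :: real assume t: "t \<in> {0..1}"
      have "((\<lambda>t. r *\<^sub>R X z h t) has_vector_derivative r *\<^sub>R blinfun_apply (F' (y z t, z)) (X z h t, h)) (at t within {0..1})"
        using X[OF z, of h] t unfolding V_def has_vector_derivative_def
        by (auto intro!: derivative_eq_intros)
      then show "((\<lambda>t. r *\<^sub>R X z h t) has_vector_derivative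
          blinfun_apply (F' (y z t, z)) (r *\<^sub>R X z h t, r *\<^sub>R h)) (at t within {0..1})"
        by (simp flip: blinfun.scaleR_right)
    qed
    from DV[OF z this] show "D z (r *\<^sub>R h) = r *\<^sub>R D z h" unfolding D_def .
  qed
  define C where "C = 2 * (1 + M)"
  have C: "C > 0" unfolding C_def using M_ge by simp
  have ylip: "norm (y z' t - y z t) \<le> C * norm (z' - z)"
    if z: "z \<in> ball p \<rho>" and z': "z' \<in> ball p \<rho>" and t: "t \<in> {0..1}" for z z' t
  proof -
    have "norm (y z' t - y z t) \<le> 2 * (norm (y z' 0 - y z 0) + M * norm (z' - z))"
    proof (rule small_rate_gronwall[OF has_vector_derivative_diff[OF y'[OF z'] y'[OF z]] _ t])
      fix t :: real assume t: "t \<in> {0..1}"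
      have "norm (F (y z' t, z') - F (y z t, z')) \<le> 1/2 * norm (y z' t - y z t)"
        using F1 yR z z' t zR by blast
      moreover have "norm (F (y z t, z') - F (y z t, z)) \<le> M * norm ((y z t, z') - (y z t, z))"
        using yK z z' t zR yR by (intro FM) (auto simp: K_def)
      ultimately show "norm (F (y z' t, z') - F (y z t, z)) \<le> 1/2 * norm (y z' t - y z t) + M * norm (z' - z)"
        using norm_triangle_ineq[of "F (y z' t, z') - F (y z t, z')" "F (y z t, z') - F (y z t, z)"]
        by (simp add: norm_Pair)
    qed auto
    then show ?thesis using y0[OF z] y0[OF z'] unfolding C_def by (simp add: algebra_simps)
  qed
  have Dder: "((\<lambda>z. y z 1) has_derivative D z) (at z)" if z: "z \<in> ball p \<rho>" for z
    unfolding has_derivative_at_alt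
  proof (intro conjI allI impI)
    show "bounded_linear (D z)" using linD[OF z] linear_conv_bounded_linear by blast
    fix e :: real assume e: "e > 0"
    define e' where "e' = e / (2 * (C + 1))"
    have e': "e' > 0" unfolding e'_def using e C by simp
    have "uniformly_continuous_on K F'"
      by (rule compact_uniformly_continuous[OF continuous_on_subset[OF F' KS] Kc(2)])
    then obtain d3 where d3: "d3 > 0" "\<And>x x'. x \<in> K \<Longrightarrow> x' \<in> K \<Longrightarrow> dist x' x < d3 \<Longrightarrow> dist (F' x') (F' x) < e'"
      unfolding uniformly_continuous_on_def using e' by metis
    obtain d4 where d4: "d4 > 0" "ball z d4 \<subseteq> ball p \<rho>" using z open_ball open_contains_ball by blast
    have taylor: "norm (F x' - F x - blinfun_apply (F' x) (x' - x)) \<le> norm (x' - x) * e'"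
      if x: "x \<in> K" "x' \<in> K" "dist x' x < d3" for x x'
    proof (rule differentiable_bound_linearization[where S = "closed_segment x x'"])
      have seg: "u \<in> K" "dist u x < d3" if "u \<in> closed_segment x x'" for u
        using that x closed_segment_subset[OF _ _ Kc(1), of x x'] segment_bound1[OF that]
        by (auto simp: dist_norm)
      show "x + t *\<^sub>R (x' - x) \<in> closed_segment x x'" if "t \<in> {0..1}" for t
        unfolding in_segment using that by (intro exI[of _ t]) (auto simp: algebra_simps)
      show "(F has_derivative blinfun_apply (F' u)) (at u within closed_segment x x')" if "u \<in> closed_segment x x'" for u
        using F seg(1)[OF that] KS has_derivative_at_withinI by blast
      show "onorm (blinfun_apply (F' u) - blinfun_apply (F' x)) \<le> e'" if "u \<in> closed_segment x x'" for u
        using d3(2)[OF x(1) seg[OF that]]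
        unfolding dist_norm norm_blinfun.rep_eq minus_blinfun.rep_eq fun_diff_def by simp
    qed auto
    show "\<exists>d>0. \<forall>z'. norm (z' - z) < d \<longrightarrow> norm (y z' 1 - y z 1 - D z (z' - z)) \<le> e * norm (z' - z)"
    proof (intro exI[of _ "min d4 (d3 / (C + 1))"] conjI allI impI)
      show "min d4 (d3 / (C + 1)) > 0" using d3 d4 C by simp
      fix z' assume zz: "norm (z' - z) < min d4 (d3 / (C + 1))"
      define h where "h = z' - z"
      have z': "z' \<in> ball p \<rho>" using zz by (intro subsetD[OF d4(2)]) (simp add: dist_norm norm_minus_commute)
      note \<xi> = X[OF z, of h, unfolded V_def]
      define Y where "Y t = (y z t, z)" for t
      define Y' where "Y' t = (y z' t, z')" for t
      have YY: "norm (Y' t - Y t) \<le> (C + 1) * norm h" if t: "t \<in> {0..1}" for t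
        using norm_Pair_le[of "y z' t - y z t" "z' - z"] ylip[OF z z' t]
        unfolding Y_def Y'_def h_def by (simp add: algebra_simps)
      have "norm (y z' 1 - y z 1 - X z h 1) \<le> 2 * (norm (y z' 0 - y z 0 - X z h 0) + e' * (C + 1) * norm h)"
      proof (rule small_rate_gronwall)
        show "((\<lambda>t. y z' t - y z t - X z h t) has_vector_derivative
            F (Y' t) - F (Y t) - blinfun_apply (F' (Y t)) (X z h t, h)) (at t within {0..1})" if t: "t \<in> {0..1}" for t
          using \<xi> t y'[OF z t] y'[OF z' t] unfolding Y_def Y'_def by (intro has_vector_derivative_diff) auto
        fix t :: real assume t: "t \<in> {0..1}"
        have YK: "Y t \<in> K" "Y' t \<in> K" using yK z z' t unfolding Y_def Y'_def by auto
        have "dist (Y' t) (Y t) < d3"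
        proof -
          have "(C + 1) * norm h < d3" using zz C unfolding h_def by (simp add: field_simps)
          then show ?thesis using YY[OF t] by (simp add: dist_norm)
        qed
        from taylor[OF YK this] have "norm (F (Y' t) - F (Y t) - blinfun_apply (F' (Y t)) (Y' t - Y t)) \<le> norm (Y' t - Y t) * e'" .
        also have "\<dots> \<le> e' * (C + 1) * norm h" using mult_left_mono[OF YY[OF t], of e'] e' by (simp add: mult_ac)
        finally have 1: "norm (F (Y' t) - F (Y t) - blinfun_apply (F' (Y t)) (Y' t - Y t)) \<le> e' * (C + 1) * norm h" .
        have 2: "norm (blinfun_apply (F' (Y t)) (y z' t - y z t - X z h t, 0)) \<le> 1/2 * norm (y z' t - y z t - X z h t)"
          by (rule small[OF YK(1)])
        have "F (Y' t) - F (Y t) - blinfun_apply (F' (Y t)) (X z h t, h) =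
           (F (Y' t) - F (Y t) - blinfun_apply (F' (Y t)) (Y' t - Y t)) + blinfun_apply (F' (Y t)) (Y' t - Y t - (X z h t, h))"
          by (simp add: blinfun.diff_right)
        also have "Y' t - Y t - (X z h t, h) = (y z' t - y z t - X z h t, 0)"
          unfolding Y_def Y'_def h_def by simp
        finally have eq: "F (Y' t) - F (Y t) - blinfun_apply (F' (Y t)) (X z h t, h) =
           (F (Y' t) - F (Y t) - blinfun_apply (F' (Y t)) (Y' t - Y t)) + blinfun_apply (F' (Y t)) (y z' t - y z t - X z h t, 0)" .
        show "norm (F (Y' t) - F (Y t) - blinfun_apply (F' (Y t)) (X z h t, h)) \<le>
            1/2 * norm (y z' t - y z t - X z h t) + e' * (C + 1) * norm h"
          unfolding eq using 1 2 norm_triangle_ineq[of "F (Y' t) - F (Y t) - blinfun_apply (F' (Y t)) (Y' t - Y t)"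
              "blinfun_apply (F' (Y t)) (y z' t - y z t - X z h t, 0)"] by linarith
      qed auto
      also have "y z' 0 - y z 0 - X z h 0 = 0" using y0[OF z] y0[OF z'] \<xi> unfolding h_def by simp
      also have "2 * (norm (0::'e) + e' * (C + 1) * norm h) = e * norm h"
        unfolding e'_def using C by (simp add: field_simps)
      finally show "norm (y z' 1 - y z 1 - D z (z' - z)) \<le> e * norm (z' - z)" unfolding D_def h_def .
    qed
  qed
  show thesis
  proof (rule that[OF \<rho>(1) y0 _ y' Dder])
    show "(y z t, z) \<in> S" if "z \<in> ball p \<rho>" "t \<in> {0..1}" for z t using yK[OF that] KS by blast
    show "\<exists>\<xi>. \<xi> 0 = h \<and> \<xi> 1 = D z h \<and> (\<forall>t\<in>{0..1}.
        (\<xi> has_vector_derivative blinfun_apply (F' (y z t, z)) (\<xi> t, h)) (at t within {0..1::real}))"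
      if "z \<in> ball p \<rho>" for z h
      using X[OF that] DV[OF that] unfolding V_def by metis
    show "D z h = \<xi> 1" if "z \<in> ball p \<rho>" "\<xi> 0 = h" "\<And>t. t \<in> {0..1} \<Longrightarrow>
        (\<xi> has_vector_derivative blinfun_apply (F' (y z t, z)) (\<xi> t, h)) (at t within {0..1::real})" for z h \<xi>
      using DV[OF that(1), of h \<xi>] that(2,3) unfolding V_def by blast
  qed
qed

section \<open>The holomorphic Frobenius theorem\<close>

text \<open>An injective linear map between finite-dimensional spaces is bounded below.\<close>

lemma injective_linear_family_open:
  fixes L :: "'x::topological_space \<Rightarrow> 'e::euclidean_space \<Rightarrow> 'f::euclidean_space"
  assumes S: "open S" "x0 \<in> S" and lin: "\<And>x. x \<in> S \<Longrightarrow> linear (L x)"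
    and cont: "\<And>b. continuous_on S (\<lambda>x. L x b)" and inj: "inj (L x0)"
  obtains T where "open T" "x0 \<in> T" "T \<subseteq> S" "\<And>x. x \<in> T \<Longrightarrow> inj (L x)"
proof -
  obtain B where B: "B > 0" "\<And>v. B * norm v \<le> norm (L x0 v)"
    using linear_inj_bounded_below_pos[OF lin[OF S(2)] inj] by blast
  define g where "g x = (\<Sum>b\<in>Basis. norm (L x b - L x0 b))" for x
  have "continuous_on S g" unfolding g_def by (intro continuous_intros cont)
  then have "open (g -` {..<B} \<inter> S)" using S(1) continuous_on_open_vimage by (metis open_lessThan)
  moreover have "inj (L x)" if x: "x \<in> g -` {..<B} \<inter> S" for x
  proof -
    have "v = 0" if v: "L x v = 0" for v
    proof (rule ccontr)
      assume "v \<noteq> 0"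
      have "norm (L x v - L x0 v) \<le> norm v * g x"
        unfolding g_def by (rule linear_norm_le_sum_Basis) (use lin x S(2) in \<open>auto intro: linear_compose_sub\<close>)
      also have "\<dots> < norm v * B" using x \<open>v \<noteq> 0\<close> by simp
      finally show False using v B(2)[of v] by (simp add: mult.commute)
    qed
    then show ?thesis using lin x by (simp add: linear_injective_0)
  qed
  ultimately show thesis using that[of "g -` {..<B} \<inter> S"] S(2) B(1) by (auto simp: g_def)
qed

lemma has_vector_derivative_along:
  assumes "(f has_derivative f') (at (g t))" "(g has_vector_derivative g') (at t within S)"
  shows "((\<lambda>t. f (g t)) has_vector_derivative f' g') (at t within S)"
  using has_derivative_compose[OF assms(2)[unfolded has_vector_derivative_def] assms(1)]
    linear_scale[OF has_derivative_linear[OF assms(1)]] by (simp add: has_vector_derivative_def)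

lemma has_vector_derivative_linear_image:
  assumes "bounded_linear f" "(g has_vector_derivative g') (at t within S)"
  shows "((\<lambda>t. f (g t)) has_vector_derivative f g') (at t within S)"
  using has_vector_derivative_along[OF bounded_linear_imp_has_derivative[OF assms(1)] assms(2)] .

lemma holomorphic_map_onD:
  assumes "holomorphic_map_on S f"
  shows "smooth_on S f" "x \<in> S \<Longrightarrow> frechet_derivative f (at x) (\<i> *s v) = \<i> *s frechet_derivative f (at x) v"
  using assms unfolding holomorphic_map_on_def by auto

lemma holomorphic_map_on_subset: "holomorphic_map_on S f \<Longrightarrow> T \<subseteq> S \<Longrightarrow> holomorphic_map_on T f"
  unfolding holomorphic_map_on_def using smooth_on_subset by blast

text \<open>The maps \<open>A x\<close> are projections with the same kernel as \<open>Q\<close>.  The first integral is the time-one value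
of \<open>y' = -A(y)(z - p)\<close>, \<open>y(0) = z\<close>.  Applying \<open>Q\<close> to the equation shows that the path ends in
\<open>p + ker Q\<close>.  The range of \<open>A z\<close> is in the kernel of the derivative by the explicit solution of the
variational equation, where \<open>comm\<close> is used.  Conversely the derivative \<open>D\<^sub>z\<close> plus \<open>A z\<close> is the
identity at \<open>z = p\<close>, hence injective nearby, and a vector \<open>h\<close> in the kernel of \<open>D\<^sub>z\<close> gives
\<open>h - A z h\<close> in the kernel of this sum.\<close>

lemma first_integral_of_commuting_projections:
  fixes A :: "complex^'n \<Rightarrow> complex^'n \<Rightarrow> complex^'n"
  assumes U: "open U" "p \<in> U" and lin: "\<And>x. x \<in> U \<Longrightarrow> linear (A x)"
    and clin: "\<And>x h. x \<in> U \<Longrightarrow> A x (\<i> *s h) = \<i> *s A x h"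
    and hol: "\<And>h. holomorphic_map_on U (\<lambda>x. A x h)" and linQ: "linear Q"
    and QA: "\<And>x h. x \<in> U \<Longrightarrow> Q (A x h) = Q h" and AQ: "\<And>x h. x \<in> U \<Longrightarrow> A x (Q h) = A x h"
    and comm: "\<And>x h k. x \<in> U \<Longrightarrow> frechet_derivative (\<lambda>y. A y k) (at x) (A x h) =
        frechet_derivative (\<lambda>y. A y h) (at x) (A x k)"
  obtains U' \<pi> where "open U'" "p \<in> U'" "U' \<subseteq> U" "holomorphic_map_on U' \<pi>"
    "\<And>x h. x \<in> U' \<Longrightarrow> frechet_derivative \<pi> (at x) h = 0 \<longleftrightarrow> h \<in> range (A x)"
    "\<And>x. x \<in> U' \<Longrightarrow> Q (\<pi> x) = Q p"
proof -
  have AA: "A y (A x k) = A y k" if "y \<in> U" "x \<in> U" for x y k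
    using AQ[OF that(1), of "A x k"] QA[OF that(2), of k] AQ[OF that(1), of k] by simp
  have A0: "A x 0 = 0" if "x \<in> U" for x using lin[OF that] by (rule linear_0)
  define dA where "dA x k = frechet_derivative (\<lambda>y. A y k) (at x)" for x k
  have dA: "((\<lambda>y. A y k) has_derivative dA x k) (at x)" if "x \<in> U" for x k
    unfolding dA_def by (rule smooth_on_has_derivative[OF holomorphic_map_onD(1)[OF hol] that])
  have dA_i: "dA x k (\<i> *s h) = \<i> *s dA x k h" if "x \<in> U" for x k h
    unfolding dA_def using holomorphic_map_onD(2)[OF hol that] .
  have dA0: "dA x 0 h = 0" if "x \<in> U" for x h
  proof -
    have "((\<lambda>y. A y 0) has_derivative (\<lambda>h. 0)) (at x)"
      by (rule has_derivative_transform_within_open[OF has_derivative_const[of 0] U(1) that]) (simp add: A0)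
    from has_derivative_unique[OF dA[OF that] this] show ?thesis by metis
  qed
  define S where "S = U \<times> (UNIV :: (complex^'n) set)"
  have S: "open S" "(p, p) \<in> S" unfolding S_def using U by (auto intro: open_Times)
  have blf: "bounded_linear (fst :: (complex^'n) \<times> (complex^'n) \<Rightarrow> complex^'n)"
    and bls: "bounded_linear (snd :: (complex^'n) \<times> (complex^'n) \<Rightarrow> complex^'n)"
    by (rule bounded_linear_fst bounded_linear_snd)+
  (* The vector field, as a function of the pair of state and parameter. *)
  define F where "F x = - A (fst x) (snd x - p)" for x
  note idS = smooth_on_ident[OF S(1)]
  have smA: "smooth_on S (\<lambda>x. A (fst x) b)" for b
    by (rule smooth_on_compose[OF S(1) U(1) smooth_on_linear[OF blf S(1) idS] holomorphic_map_onD(1)[OF hol]])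
       (auto simp: S_def)
  have smF: "smooth_on S F"
  proof -
    have "smooth_on S (\<lambda>x. A (fst x) (snd x + (- p)))"
    proof (rule smooth_on_linear_family[OF S(1), where L = "\<lambda>x. A (fst x)"])
      show "linear (A (fst x))" if "x \<in> S" for x using that lin unfolding S_def by auto
      show "smooth_on S (\<lambda>x. snd x + (- p))"
        by (intro smooth_on_add smooth_on_const smooth_on_linear[OF bls] idS S(1))
    qed (rule smA)
    from smooth_on_linear[OF bounded_linear_minus[OF bounded_linear_ident] S(1) this]
    show ?thesis unfolding F_def by simp
  qed
  have derF: "(F has_derivative (\<lambda>h. - (dA (fst x) (snd x - p) (fst h) + A (fst x) (snd h)))) (at x)" if x: "x \<in> S" for x
  proof -
    have xU: "fst x \<in> U" using x unfolding S_def by auto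
    have c: "((\<lambda>y. A (fst y) b) has_derivative (\<lambda>h. dA (fst x) b (fst h))) (at x)" for b
      by (rule has_derivative_compose[OF has_derivative_fst[OF has_derivative_ident] dA[OF xU]])
    have a: "((\<lambda>x. snd x - p) has_derivative (\<lambda>h. snd h - 0)) (at x)"
      by (intro has_derivative_diff has_derivative_snd has_derivative_ident has_derivative_const)
    have "((\<lambda>y. A (fst y) (snd y - p)) has_derivative
        (\<lambda>h. frechet_derivative (\<lambda>y. A (fst y) (snd x - p)) (at x) h + A (fst x) (snd h - 0))) (at x)"
      by (rule has_derivative_linear_family[OF S(1) x _ _ a, where L = "\<lambda>x. A (fst x)"])
         (use c in \<open>auto simp: S_def lin differentiable_def\<close>)
    then have "((\<lambda>y. A (fst y) (snd y - p)) has_derivative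
        (\<lambda>h. dA (fst x) (snd x - p) (fst h) + A (fst x) (snd h))) (at x)"
      unfolding frechet_derivative_at[OF c, symmetric] by simp
    then show ?thesis unfolding F_def by (rule has_derivative_minus)
  qed
  obtain F' where F': "\<And>x. x \<in> S \<Longrightarrow> blinfun_apply (F' x) = frechet_derivative F (at x)"
    "\<And>x. x \<in> S \<Longrightarrow> (F has_derivative blinfun_apply (F' x)) (at x)" "continuous_on S F'"
    using smooth_on_imp_blinfun_derivative[OF S(1) smF] by blast
  have F'_eq: "blinfun_apply (F' (y, z)) (\<eta>, h) = - dA y (z - p) \<eta> - A y h" if "y \<in> U" for y z \<eta> h
    using has_derivative_unique[OF F'(2) derF, of "(y, z)"] that unfolding S_def by auto
  have F0: "F (p, p) = 0" unfolding F_def using A0[OF U(2)] by simp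
  have F'0: "blinfun_apply (F' (p, p)) (\<eta>, 0) = 0" for \<eta>
    using F'_eq[OF U(2)] dA0[OF U(2)] A0[OF U(2)] by simp
  obtain \<rho> y D where \<rho>: "\<rho> > 0" and y0: "\<And>z. z \<in> ball p \<rho> \<Longrightarrow> y z 0 = z"
    and yS: "\<And>z t. z \<in> ball p \<rho> \<Longrightarrow> t \<in> {0..1} \<Longrightarrow> (y z t, z) \<in> S"
    and y': "\<And>z t. z \<in> ball p \<rho> \<Longrightarrow> t \<in> {0..1} \<Longrightarrow> (y z has_vector_derivative F (y z t, z)) (at t within {0..1})"
    and D: "\<And>z. z \<in> ball p \<rho> \<Longrightarrow> ((\<lambda>z. y z 1) has_derivative D z) (at z)"
    and Dex: "\<And>z h. z \<in> ball p \<rho> \<Longrightarrow> \<exists>\<xi>. \<xi> 0 = h \<and> \<xi> 1 = D z h \<and> (\<forall>t\<in>{0..1}.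
        (\<xi> has_vector_derivative blinfun_apply (F' (y z t, z)) (\<xi> t, h)) (at t within {0..1::real}))"
    and Deq: "\<And>z h \<xi>. z \<in> ball p \<rho> \<Longrightarrow> \<xi> 0 = h \<Longrightarrow> (\<And>t. t \<in> {0..1} \<Longrightarrow>
        (\<xi> has_vector_derivative blinfun_apply (F' (y z t, z)) (\<xi> t, h)) (at t within {0..1::real})) \<Longrightarrow> D z h = \<xi> 1"
    using ode_differentiable_dependence[OF S F'(2,3) F0 F'0] by blast
  have yU: "y z t \<in> U" if "z \<in> ball p \<rho>" "t \<in> {0..1}" for z t using yS[OF that] unfolding S_def by simp
  define \<pi> where "\<pi> z = y z 1" for z
  have zU: "z \<in> U" if "z \<in> ball p \<rho>" for z using yU[OF that, of 0] y0[OF that] by simp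
  have D\<pi>: "(\<pi> has_derivative D z) (at z)" if "z \<in> ball p \<rho>" for z using D[OF that] unfolding \<pi>_def .
  have linD: "linear (D z)" if "z \<in> ball p \<rho>" for z using D\<pi>[OF that] by (rule has_derivative_linear)
  have D_i: "D z (\<i> *s h) = \<i> *s D z h" if z: "z \<in> ball p \<rho>" for z h
  proof -
    obtain \<xi> where \<xi>: "\<xi> 0 = h" "\<xi> 1 = D z h" "\<And>t. t \<in> {0..1} \<Longrightarrow>
        (\<xi> has_vector_derivative blinfun_apply (F' (y z t, z)) (\<xi> t, h)) (at t within {0..1::real})"
      using Dex[OF z, of h] by blast
    have "D z (\<i> *s h) = \<i> *s \<xi> 1"
    proof (rule Deq[OF z, of "\<lambda>t. \<i> *s \<xi> t"])
      fix t :: real assume t: "t \<in> {0..1}"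
      have "\<i> *s blinfun_apply (F' (y z t, z)) (\<xi> t, h) = blinfun_apply (F' (y z t, z)) (\<i> *s \<xi> t, \<i> *s h)"
        using yU[OF z t] by (simp add: F'_eq dA_i clin vec.scale_right_diff_distrib)
      with has_vector_derivative_linear_image[OF bounded_linear_scalar_mult_right \<xi>(3)[OF t], of \<i>]
      show "((\<lambda>t. \<i> *s \<xi> t) has_vector_derivative blinfun_apply (F' (y z t, z)) (\<i> *s \<xi> t, \<i> *s h)) (at t within {0..1})"
        by simp
    qed (simp add: \<xi>)
    then show ?thesis using \<xi> by simp
  qed
  have DA: "D z (A z k) = 0" if z: "z \<in> ball p \<rho>" for z k
  proof -
    (* An explicit solution of the variational equation with initial value A z k that vanishes
       at time 1. *)
    define \<eta> where "\<eta> t = (1 - t) *\<^sub>R A (y z t) k" for t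
    have "D z (A z k) = \<eta> 1"
    proof (rule Deq[OF z])
      show "\<eta> 0 = A z k" unfolding \<eta>_def using y0[OF z] by simp
      fix t :: real assume t: "t \<in> {0..1}"
      note yt = yU[OF z t]
      have "((\<lambda>t. A (y z t) k) has_vector_derivative dA (y z t) k (F (y z t, z))) (at t within {0..1})"
        by (rule has_vector_derivative_along[where f = "\<lambda>y. A y k", OF dA[OF yt] y'[OF z t]])
      moreover have "dA (y z t) k (F (y z t, z)) = - dA (y z t) (z - p) (A (y z t) k)"
        using comm[OF yt, of k "z - p"] linear_neg[OF has_derivative_linear[OF dA[OF yt]]]
        unfolding F_def dA_def by simp
      ultimately have "((\<lambda>t. A (y z t) k) has_vector_derivative - dA (y z t) (z - p) (A (y z t) k)) (at t within {0..1})"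
        by simp
      moreover have "((\<lambda>t. 1 - t) has_field_derivative (-1)) (at t within {0..1})" by (auto intro!: derivative_eq_intros)
      ultimately have "(\<eta> has_vector_derivative (1 - t) *\<^sub>R (- dA (y z t) (z - p) (A (y z t) k)) + (-1) *\<^sub>R A (y z t) k) (at t within {0..1})"
        unfolding \<eta>_def by (rule has_vector_derivative_scaleR[rotated])
      moreover have "(1 - t) *\<^sub>R (- dA (y z t) (z - p) (A (y z t) k)) + (-1) *\<^sub>R A (y z t) k
         = blinfun_apply (F' (y z t, z)) (\<eta> t, A z k)"
        using linear_scale[OF has_derivative_linear[OF dA[OF yt]]] AA[OF yt zU[OF z]]
        by (simp add: F'_eq[OF yt] \<eta>_def)
      ultimately show "(\<eta> has_vector_derivative blinfun_apply (F' (y z t, z)) (\<eta> t, A z k)) (at t within {0..1})" by simp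
    qed
    then show ?thesis unfolding \<eta>_def by simp
  qed
  have pb: "p \<in> ball p \<rho>" using \<rho> by simp
  have Dp: "D p h = h - A p h" for h
  proof -
    have yp: "y p t = p" if "t \<in> {0..1}" for t
    proof -
      have "\<exists>c. \<forall>t\<in>{0..1}. y p t = c"
      proof (rule has_vector_derivative_zero_constant)
        show "(y p has_vector_derivative 0) (at t within {0..1})" if "t \<in> {0..1}" for t
          using y'[OF pb that] A0[OF yU[OF pb that]] unfolding F_def by simp
      qed auto
      then obtain c where "\<And>t. t \<in> {0..1} \<Longrightarrow> y p t = c" by blast
      then show ?thesis using y0[OF pb] that by force
    qed
    have "D p h = h - 1 *\<^sub>R A p h"
    proof (rule Deq[OF pb, of "\<lambda>t. h - t *\<^sub>R A p h"])
      fix t :: real assume t: "t \<in> {0..1}"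
      have "((\<lambda>t. h - t *\<^sub>R A p h) has_vector_derivative - A p h) (at t within {0..1})"
        unfolding has_vector_derivative_def by (auto intro!: derivative_eq_intros)
      then show "((\<lambda>t. h - t *\<^sub>R A p h) has_vector_derivative
          blinfun_apply (F' (y p t, p)) (h - t *\<^sub>R A p h, h)) (at t within {0..1})"
        unfolding yp[OF t] F'_eq[OF U(2)] using dA0[OF U(2)] by simp
    qed simp
    then show ?thesis by simp
  qed
  have hol\<pi>: "holomorphic_map_on (ball p \<rho>) \<pi>"
    by (rule complex_differentiable_imp_holomorphic_map_on[OF open_ball D\<pi> D_i])
  have D_eq: "frechet_derivative \<pi> (at z) = D z" if "z \<in> ball p \<rho>" for z
    using frechet_derivative_at[OF D\<pi>[OF that]] by simp
  have Q\<pi>: "Q (\<pi> z) = Q p" if z: "z \<in> ball p \<rho>" for z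
  proof -
    have blQ: "bounded_linear Q" using linQ linear_conv_bounded_linear by blast
    have "\<exists>c. \<forall>t\<in>{0..1}. Q (y z t) + t *\<^sub>R Q (z - p) = c"
    proof (rule has_vector_derivative_zero_constant)
      fix t :: real assume t: "t \<in> {0..1}"
      have "((\<lambda>t. Q (y z t)) has_vector_derivative Q (F (y z t, z))) (at t within {0..1})"
        by (rule has_vector_derivative_linear_image[OF blQ y'[OF z t]])
      moreover have "((\<lambda>t. t *\<^sub>R Q (z - p)) has_vector_derivative Q (z - p)) (at t within {0..1})"
        unfolding has_vector_derivative_def by (auto intro!: derivative_eq_intros)
      ultimately have "((\<lambda>t. Q (y z t) + t *\<^sub>R Q (z - p)) has_vector_derivative Q (F (y z t, z)) + Q (z - p)) (at t within {0..1})"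
        by (rule has_vector_derivative_add)
      moreover have "Q (F (y z t, z)) + Q (z - p) = 0"
        using QA[OF yU[OF z t]] linear_neg[OF linQ] unfolding F_def by simp
      ultimately show "((\<lambda>t. Q (y z t) + t *\<^sub>R Q (z - p)) has_vector_derivative 0) (at t within {0..1})" by simp
    qed auto
    then obtain c where "\<And>t. t \<in> {0..1} \<Longrightarrow> Q (y z t) + t *\<^sub>R Q (z - p) = c" by blast
    from this[of 0] this[of 1] show ?thesis using y0[OF z] linear_diff[OF linQ] unfolding \<pi>_def by simp
  qed
  define L where "L z h = D z h + A z h" for z h
  have linL: "linear (L z)" if "z \<in> ball p \<rho>" for z
    unfolding L_def by (intro linear_compose_add linD that lin zU)
  have contL: "continuous_on (ball p \<rho>) (\<lambda>z. L z b)" for b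
  proof -
    have "continuous_on (ball p \<rho>) (\<lambda>z. frechet_derivative \<pi> (at z) b)"
      by (rule smooth_on_continuous[OF smooth_on_directional[OF holomorphic_map_onD(1)[OF hol\<pi>]]])
    then have "continuous_on (ball p \<rho>) (\<lambda>z. D z b)" by (rule continuous_on_eq) (simp add: D_eq)
    moreover have "continuous_on (ball p \<rho>) (\<lambda>z. A z b)"
      by (rule continuous_on_subset[OF smooth_on_continuous[OF holomorphic_map_onD(1)[OF hol]]]) (use zU in auto)
    ultimately show ?thesis unfolding L_def by (rule continuous_on_add)
  qed
  have "inj (L p)" unfolding L_def Dp by (simp add: inj_on_def)
  from injective_linear_family_open[OF open_ball pb linL contL this]
  obtain T where T: "open T" "p \<in> T" "T \<subseteq> ball p \<rho>" "\<And>z. z \<in> T \<Longrightarrow> inj (L z)" by blast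
  show thesis
  proof (rule that[of T \<pi>])
    show "T \<subseteq> U" using T(3) zU by blast
    show "holomorphic_map_on T \<pi>" using holomorphic_map_on_subset[OF hol\<pi> T(3)] .
    show "Q (\<pi> z) = Q p" if "z \<in> T" for z using Q\<pi> T(3) that by blast
    fix z h assume z: "z \<in> T"
    then have zb: "z \<in> ball p \<rho>" using T(3) by blast
    show "frechet_derivative \<pi> (at z) h = 0 \<longleftrightarrow> h \<in> range (A z)"
    proof
      assume "h \<in> range (A z)"
      then show "frechet_derivative \<pi> (at z) h = 0" using DA[OF zb] D_eq[OF zb] by auto
    next
      assume "frechet_derivative \<pi> (at z) h = 0"
      then have "D z h = 0" using D_eq[OF zb] by simp
      then have "D z (h - A z h) = 0" using linear_diff[OF linD[OF zb]] DA[OF zb] by simp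
      moreover have "A z (h - A z h) = 0"
        using linear_diff[OF lin[OF zU[OF zb]]] AA[OF zU[OF zb] zU[OF zb]] by simp
      ultimately have "L z (h - A z h) = 0" unfolding L_def by simp
      then have "h - A z h = 0" using T(4)[OF z] linL[OF zb] linear_injective_0 by blast
      then show "h \<in> range (A z)" by (metis eq_iff_diff_eq_0 rangeI)
    qed
  qed (use T in auto)
qed

text \<open>Extend \<open>b\<close> to a basis; \<open>co\<close> reads off the coordinates along \<open>b\<close>, and \<open>\<Theta>\<close> sends the additional basis
vectors to distinct coordinate vectors, for which the assumption on the dimensions leaves room.\<close>

lemma complex_dual_basis:
  fixes b :: "nat \<Rightarrow> complex^'n"
  assumes ind: "\<And>a. (\<Sum>i<r. a i *s b i) = 0 \<Longrightarrow> \<forall>i<r. a i = 0" and card: "CARD('n) \<le> CARD('k) + r"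
  obtains co :: "nat \<Rightarrow> complex^'n \<Rightarrow> complex" and \<Theta> :: "complex^'n \<Rightarrow> complex^'k"
  where "\<And>i u v. co i (u + v) = co i u + co i v" "\<And>i c v. co i (c *s v) = c * co i v"
    "\<And>i j. i < r \<Longrightarrow> j < r \<Longrightarrow> co i (b j) = (if i = j then 1 else 0)"
    "\<And>u v. \<Theta> (u + v) = \<Theta> u + \<Theta> v" "\<And>c v. \<Theta> (c *s v) = c *s \<Theta> v"
    "\<And>v. \<Theta> v = 0 \<Longrightarrow> (\<And>i. i < r \<Longrightarrow> co i v = 0) \<Longrightarrow> v = 0"
proof -
  have inj: "inj_on b {..<r}"
  proof (rule inj_onI, rule ccontr)
    fix i j assume ij: "i \<in> {..<r}" "j \<in> {..<r}" "b i = b j" "i \<noteq> j"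
    have "(\<Sum>k<r. ((if k = i then 1 else 0) - (if k = j then 1 else 0)) *s b k) = 
        (\<Sum>k<r. (if k = i then b k else 0)) - (\<Sum>k<r. (if k = j then b k else 0))"
      unfolding sum_subtractf[symmetric] by (intro sum.cong) auto
    also have "\<dots> = 0" using ij by simp
    finally show False using ind[of "\<lambda>k. (if k = i then 1 else 0) - (if k = j then 1 else 0)"] ij by auto
  qed
  define B0 where "B0 = b ` {..<r}"
  have cB0: "card B0 = r" unfolding B0_def using card_image[OF inj] by simp
  have "vec.independent B0"
  proof
    assume "vec.dependent B0"
    then obtain u where u: "\<exists>v\<in>B0. u v \<noteq> 0" "(\<Sum>v\<in>B0. u v *s v) = 0"
      using vec.dependent_finite[of B0] unfolding B0_def by auto
    have "(\<Sum>i<r. u (b i) *s b i) = 0" using u(2) unfolding B0_def by (simp add: sum.reindex[OF inj])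
    from ind[of "\<lambda>i. u (b i)", OF this] u(1) show False unfolding B0_def by auto
  qed
  then obtain BB where BB: "B0 \<subseteq> BB" "vec.independent BB" "UNIV \<subseteq> vec.span BB"
    using vec.maximal_independent_subset_extend[of B0 UNIV] by auto
  have finBB: "finite BB" using vec.finiteI_independent BB(2) by blast
  have spBB: "v \<in> vec.span BB" for v using BB(3) by blast
  have cBB: "card BB = CARD('n)"
    using vec.basis_card_eq_dim[OF subset_UNIV BB(3,2)] unfolding vec_dim_card .
  have "card (BB - B0) \<le> card (UNIV :: 'k set)"
    using cBB cB0 card BB(1) finBB by (simp add: card_Diff_subset finite_subset)
  then obtain e :: "complex^'n \<Rightarrow> 'k" where e: "inj_on e (BB - B0)"
    using card_le_inj[of "BB - B0" "UNIV :: 'k set"] finBB by auto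
  define rep where "rep = vec.representation BB"
  have rep_add: "rep (u + v) c = rep u c + rep v c" for u v c
    unfolding rep_def by (simp add: vec.representation_add[OF BB(2) spBB spBB])
  have rep_scale: "rep (z *s v) c = z * rep v c" for z v c
    unfolding rep_def by (simp add: vec.representation_scale[OF BB(2) spBB])
  have rep_sum: "(\<Sum>c\<in>BB. rep v c *s c) = v" for v
    unfolding rep_def by (rule vec.sum_representation_eq[OF BB(2) spBB finBB order_refl])
  define \<Theta> :: "complex^'n \<Rightarrow> complex^'k" where "\<Theta> v = (\<Sum>c\<in>BB - B0. rep v c *s axis (e c) 1)" for v
  show thesis
  proof (rule that[of "\<lambda>i v. rep v (b i)" \<Theta>])
    show "rep (u + v) (b i) = rep u (b i) + rep v (b i)" for u v i by (rule rep_add)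
    show "rep (c *s v) (b i) = c * rep v (b i)" for c v i by (rule rep_scale)
    show "rep (b j) (b i) = (if i = j then 1 else 0)" if "i < r" "j < r" for i j
    proof -
      have "b j \<in> BB" using BB(1) that unfolding B0_def by auto
      then have "rep (b j) (b i) = (if b i = b j then 1 else 0)"
        unfolding rep_def by (simp add: vec.representation_basis[OF BB(2)])
      then show ?thesis using inj that by (auto simp: inj_on_eq_iff)
    qed
    show "\<Theta> (u + v) = \<Theta> u + \<Theta> v" for u v
      unfolding \<Theta>_def by (simp add: rep_add vec.scale_left_distrib sum.distrib)
    show "\<Theta> (c *s v) = c *s \<Theta> v" for c v
      unfolding \<Theta>_def by (simp add: rep_scale vec.scale_sum_right)
    fix v assume v: "\<Theta> v = 0" "\<And>i. i < r \<Longrightarrow> rep v (b i) = 0"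
    have "rep v c = 0" if c: "c \<in> BB" for c
    proof (cases "c \<in> B0")
      case True
      then show ?thesis using v(2) unfolding B0_def by auto
    next
      case False
      have "\<Theta> v $ e c = (\<Sum>d\<in>BB - B0. if d = c then rep v d else 0)"
        unfolding \<Theta>_def sum_component vector_smult_component
        by (intro sum.cong refl) (use False c inj_on_eq_iff[OF e] in \<open>auto simp: axis_def\<close>)
      also have "\<dots> = rep v c" using False c finBB by (subst sum.delta) auto
      finally show ?thesis using v(1) by simp
    qed
    then show "v = 0" using rep_sum[of v] by simp
  qed
qed

lemma bounded_linear_complex_functional:
  fixes f :: "complex^'n \<Rightarrow> complex"
  assumes "\<And>u v. f (u + v) = f u + f v" "\<And>c v. f (c *s v) = c * f v"
  shows "bounded_linear f"
proof -
  have "linear f" by (rule linearI) (simp_all add: assms scaleR_eq_scalar_mult scaleR_conv_of_real)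
  then show ?thesis by (simp add: linear_conv_bounded_linear)
qed

lemma bounded_linear_complex_map:
  fixes f :: "complex^'n \<Rightarrow> complex^'k"
  assumes "\<And>u v. f (u + v) = f u + f v" "\<And>c v. f (c *s v) = c *s f v"
  shows "bounded_linear f"
proof -
  have "linear f" by (rule linearI) (simp_all add: assms scaleR_eq_scalar_mult)
  then show ?thesis by (simp add: linear_conv_bounded_linear)
qed

text \<open>Let \<open>Q\<close> be a projection onto \<open>W p\<close>.  For \<open>x\<close> near \<open>p\<close> let \<open>A x\<close> be the projection onto \<open>W x\<close> with the
kernel of \<open>Q\<close>.  As \<open>Q (A x h) = Q h\<close> does not depend on \<open>x\<close>, the bracket of two fields \<open>A(\<cdot>)h\<close> and
\<open>A(\<cdot>)k\<close> is annihilated by \<open>Q\<close>; being also in \<open>W x\<close>, on which \<open>Q\<close> is injective, it vanishes.\<close>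

lemma holomorphic_frobenius:
  fixes f :: "nat \<Rightarrow> complex^'n \<Rightarrow> complex^'n"
  assumes U: "open U" "p \<in> U" and f: "\<And>i. i < r \<Longrightarrow> holomorphic_map_on U (f i)"
    and W: "\<And>x. x \<in> U \<Longrightarrow> W x = {\<Sum>i<r. a i *s f i x | a. True}"
    and ind: "\<And>x a. x \<in> U \<Longrightarrow> (\<Sum>i<r. a i *s f i x) = 0 \<Longrightarrow> \<forall>i<r. a i = 0"
    and inv: "\<And>T a b x. open T \<Longrightarrow> T \<subseteq> U \<Longrightarrow> x \<in> T \<Longrightarrow> smooth_on T a \<Longrightarrow> smooth_on T b \<Longrightarrow>
      (\<And>y. y \<in> T \<Longrightarrow> a y \<in> W y \<and> b y \<in> W y) \<Longrightarrow>
      frechet_derivative b (at x) (a x) - frechet_derivative a (at x) (b x) \<in> W x"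
    and card: "CARD('n) \<le> CARD('k) + r"
  obtains U' and \<pi> :: "complex^'n \<Rightarrow> complex^'k" where "open U'" "p \<in> U'" "U' \<subseteq> U" "holomorphic_map_on U' \<pi>"
    "\<And>x h. x \<in> U' \<Longrightarrow> frechet_derivative \<pi> (at x) h = 0 \<longleftrightarrow> h \<in> W x"
proof -
  obtain co :: "nat \<Rightarrow> complex^'n \<Rightarrow> complex" and \<Theta> :: "complex^'n \<Rightarrow> complex^'k"
    where co: "\<And>i u v. co i (u + v) = co i u + co i v" "\<And>i c v. co i (c *s v) = c * co i v"
    "\<And>i j. i < r \<Longrightarrow> j < r \<Longrightarrow> co i (f j p) = (if i = j then 1 else 0)"
    and \<Theta>: "\<And>u v. \<Theta> (u + v) = \<Theta> u + \<Theta> v" "\<And>c v. \<Theta> (c *s v) = c *s \<Theta> v"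
    "\<And>v. \<Theta> v = 0 \<Longrightarrow> (\<And>i. i < r \<Longrightarrow> co i v = 0) \<Longrightarrow> v = 0"
    using complex_dual_basis[where b = "\<lambda>i. f i p", OF ind[OF U(2)] card] by blast
  have blco: "bounded_linear (co i)" for i by (rule bounded_linear_complex_functional[OF co(1,2)])
  have bl\<Theta>: "bounded_linear \<Theta>" by (rule bounded_linear_complex_map[OF \<Theta>(1,2)])
  define S where "S x h = (\<Sum>i<r. co i h *s f i x)" for x h
  define Q where "Q = S p"
  (* R x is the identity on ker Q and sends the vectors f i p to f i x; it is invertible near p. *)
  define R where "R x h = S x h + (h - Q h)" for x h
  have S_add: "S x (u + v) = S x u + S x v" for x u v
    unfolding S_def by (simp add: co vec.scale_left_distrib sum.distrib)
  have S_scale: "S x (c *s v) = c *s S x v" for x c v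
    unfolding S_def by (simp add: co vec.scale_sum_right)
  have linS: "linear (S x)" for x
    using bounded_linear_complex_map[of "S x", OF S_add S_scale] bounded_linear.linear by blast
  have linQ: "linear Q" unfolding Q_def by (rule linS)
  have linR: "linear (R x)" for x
    unfolding R_def by (intro linear_compose_add linear_compose_sub linS linQ linear_ident)
  have R_scale: "R x (c *s v) = c *s R x v" for x c v
    unfolding R_def Q_def S_scale by (simp add: vec.scale_right_distrib vec.scale_right_diff_distrib)
  have co_sum: "co i (\<Sum>j<r. a j *s f j p) = a i" if "i < r" for i a
  proof -
    have "co i (\<Sum>j<r. a j *s f j p) = (\<Sum>j<r. co i (a j *s f j p))"
      using blco bounded_linear.linear linear_sum by blast
    also have "\<dots> = (\<Sum>j<r. if j = i then a j else 0)"
      by (intro sum.cong refl) (use that in \<open>auto simp: co\<close>)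
    finally show ?thesis using that by simp
  qed
  have coQ: "co i (Q h) = co i h" if "i < r" for i h
    unfolding Q_def S_def by (rule co_sum[OF that])
  have SQ: "S x (Q h) = S x h" for x h
    unfolding S_def by (intro sum.cong refl) (simp add: coQ)
  have Rp: "R p h = h" for h unfolding R_def Q_def by simp
  have smS: "holomorphic_map_on U (\<lambda>x. S x h)" for h
  proof (rule complex_differentiable_imp_holomorphic_map_on[OF U(1)])
    show "((\<lambda>x. S x h) has_derivative (\<lambda>v. \<Sum>i<r. co i h *s frechet_derivative (f i) (at x) v)) (at x)" if "x \<in> U" for x
      unfolding S_def
      by (intro has_derivative_sum bounded_linear.has_derivative[OF bounded_linear_scalar_mult_right]
          smooth_on_has_derivative[OF holomorphic_map_onD(1)[OF f] that]) auto
    show "(\<Sum>i<r. co i h *s frechet_derivative (f i) (at x) (\<i> *s v)) = \<i> *s (\<Sum>i<r. co i h *s frechet_derivative (f i) (at x) v)" if "x \<in> U" for x v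
      unfolding vec.scale_sum_right
      by (intro sum.cong refl) (simp add: holomorphic_map_onD(2)[OF f that] vec.scale_scale mult.commute)
  qed
  have derS: "((\<lambda>x. S x h) has_derivative frechet_derivative (\<lambda>x. S x h) (at x)) (at x)" if "x \<in> U" for x h
    by (rule smooth_on_has_derivative[OF holomorphic_map_onD(1)[OF smS] that])
  have derR: "((\<lambda>x. R x h) has_derivative frechet_derivative (\<lambda>x. S x h) (at x)) (at x)" if "x \<in> U" for x h
    unfolding R_def using has_derivative_add[OF derS[OF that] has_derivative_const[of "h - Q h"]] by simp
  have contR: "continuous_on U (\<lambda>x. R x b)" for b
    by (intro continuous_at_imp_continuous_on ballI has_derivative_continuous[OF derR])
  have "inj (R p)" by (simp add: Rp inj_on_def)
  from injective_linear_family_open[OF U linR contR this]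
  obtain T where T: "open T" "p \<in> T" "T \<subseteq> U" "\<And>x. x \<in> T \<Longrightarrow> inj (R x)" by blast
  have bijR: "bij (R x)" if "x \<in> T" for x by (rule linear_inj_imp_bij[OF linR T(4)[OF that] refl])
  define K where "K x = inv (R x)" for x
  have KR: "K x (R x v) = v" and RK: "R x (K x w) = w" if "x \<in> T" for x v w
    using bijR[OF that] unfolding K_def by (auto simp: bij_is_inj surj_f_inv_f bij_is_surj)
  have linK: "linear (K x)" if "x \<in> T" for x
    by (rule linear_inverse_of_linear[OF linR KR[OF that] RK[OF that]])
  have K_i: "K x (\<i> *s w) = \<i> *s K x w" if "x \<in> T" for x w
    using KR[OF that, of "\<i> *s K x w"] by (simp add: R_scale RK[OF that])
  (* A x is R x composed with Q and the inverse of R x: the projection onto W x along ker Q. *)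
  define A where "A x h = S x (K x h)" for x h
  have linA: "linear (A x)" if "x \<in> T" for x
    using linear_compose[OF linK[OF that] linS] unfolding A_def o_def .
  have A_i: "A x (\<i> *s h) = \<i> *s A x h" if "x \<in> T" for x h
    unfolding A_def by (simp add: K_i[OF that] S_scale)
  have QQ: "Q (Q h) = Q h" for h unfolding Q_def by (rule SQ[unfolded Q_def])
  have AR: "A x (R x h) = S x h" if "x \<in> T" for x h unfolding A_def by (simp add: KR[OF that])
  have AS: "A x (S x h) = S x h" if "x \<in> T" for x h
  proof -
    have "R x (Q h) = S x h" unfolding R_def by (simp add: SQ QQ)
    then have "A x (S x h) = S x (Q h)" using AR[OF that, of "Q h"] by simp
    then show ?thesis by (simp add: SQ)
  qed
  have AQ: "A x (Q h) = A x h" if "x \<in> T" for x h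
  proof -
    have "A x (R x h) = A x (S x h) + (A x h - A x (Q h))"
      unfolding R_def by (simp add: linear_add[OF linA[OF that]] linear_diff[OF linA[OF that]])
    then show ?thesis by (simp add: AR[OF that] AS[OF that])
  qed
  have QA: "Q (A x h) = Q h" if "x \<in> T" for x h
  proof -
    have "Q (R x v) = Q (S x v)" for v unfolding R_def by (simp add: linear_add[OF linQ] linear_diff[OF linQ] QQ)
    from this[of "K x h"] show ?thesis unfolding A_def RK[OF that] by simp
  qed
  have holA: "holomorphic_map_on T (\<lambda>x. A x h)" for h
  proof (rule complex_differentiable_imp_holomorphic_map_on[OF T(1)])
    fix x assume x: "x \<in> T"
    then have xU: "x \<in> U" using T(3) by blast
    let ?K' = "\<lambda>v. - K x (frechet_derivative (\<lambda>y. S y (K x h)) (at x) v)"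
    have K': "((\<lambda>y. K y h) has_derivative ?K') (at x)"
      by (rule has_derivative_inverse_family[OF T(1) x linR KR RK derR[OF xU]])
    show "((\<lambda>x. A x h) has_derivative (\<lambda>v. frechet_derivative (\<lambda>y. S y (K x h)) (at x) v + S x (?K' v))) (at x)"
      unfolding A_def by (rule has_derivative_linear_family[OF U(1) xU linS _ K']) (use derS[OF xU] in \<open>auto simp: differentiable_def\<close>)
    show "frechet_derivative (\<lambda>y. S y (K x h)) (at x) (\<i> *s v) + S x (?K' (\<i> *s v)) =
        \<i> *s (frechet_derivative (\<lambda>y. S y (K x h)) (at x) v + S x (?K' v))" for v
      using S_scale[of x \<i>] by (simp add: holomorphic_map_onD(2)[OF smS xU] K_i[OF x] linear_neg[OF linS] vec.scale_right_distrib)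
  qed
  have rangeA: "range (A x) = W x" if x: "x \<in> T" for x
  proof -
    have xU: "x \<in> U" using T(3) x by blast
    have "range (A x) = range (S x)"
      using AR[OF x] unfolding A_def by (metis (no_types, lifting) image_image[of "S x" "K x" UNIV] bijR[OF x] K_def bij_imp_bij_inv bij_is_surj)
    also have "\<dots> = W x"
    proof (rule set_eqI, rule iffI)
      show "v \<in> W x" if "v \<in> range (S x)" for v using that unfolding W[OF xU] S_def by auto
      fix v assume "v \<in> W x"
      then obtain a where "v = (\<Sum>i<r. a i *s f i x)" unfolding W[OF xU] by blast
      also have "\<dots> = S x (\<Sum>j<r. a j *s f j p)" unfolding S_def by (intro sum.cong refl) (simp add: co_sum)
      finally show "v \<in> range (S x)" by blast
    qed
    finally show ?thesis .
  qed
  have comm: "frechet_derivative (\<lambda>y. A y k) (at x) (A x h) = frechet_derivative (\<lambda>y. A y h) (at x) (A x k)"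
    if x: "x \<in> T" for x h k
  proof -
    let ?D = "\<lambda>k. frechet_derivative (\<lambda>y. A y k) (at x)"
    have "?D k (A x h) - ?D h (A x k) \<in> W x"
      using rangeA T(3) by (intro inv[OF T(1) T(3) x holomorphic_map_onD(1)[OF holA] holomorphic_map_onD(1)[OF holA]]) blast
    then obtain g where g: "?D k (A x h) - ?D h (A x k) = A x g" using rangeA[OF x] by (metis imageE)
    have Q0: "Q (?D k v) = 0" for k v
    proof -
      have "((\<lambda>y. Q (A y k)) has_derivative (\<lambda>v. Q (?D k v))) (at x)"
        using linQ linear_conv_bounded_linear smooth_on_has_derivative[OF holomorphic_map_onD(1)[OF holA] x]
        by (intro bounded_linear.has_derivative[of Q]) auto
      moreover have "((\<lambda>y. Q (A y k)) has_derivative (\<lambda>v. 0)) (at x)"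
        by (rule has_derivative_transform_within_open[OF has_derivative_const[of "Q k"] T(1) x]) (simp add: QA)
      ultimately have "(\<lambda>v. Q (?D k v)) = (\<lambda>v. 0)" by (rule has_derivative_unique)
      then show ?thesis by metis
    qed
    have "Q (A x g) = 0" unfolding g[symmetric] by (simp add: linear_diff[OF linQ] Q0)
    then have "A x g = 0" using QA[OF x, of g] AQ[OF x, of g] linear_0[OF linA[OF x]] by simp
    then show ?thesis using g by simp
  qed
  obtain U' \<pi> where \<pi>: "open U'" "p \<in> U'" "U' \<subseteq> T" "holomorphic_map_on U' \<pi>"
    "\<And>x h. x \<in> U' \<Longrightarrow> frechet_derivative \<pi> (at x) h = 0 \<longleftrightarrow> h \<in> range (A x)"
    "\<And>x. x \<in> U' \<Longrightarrow> Q (\<pi> x) = Q p"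
    using first_integral_of_commuting_projections[OF T(1,2) linA A_i holA linQ QA AQ comm] by blast
  let ?D\<pi> = "\<lambda>x. frechet_derivative \<pi> (at x)"
  have der\<pi>: "(\<pi> has_derivative ?D\<pi> x) (at x)" if "x \<in> U'" for x
    by (rule smooth_on_has_derivative[OF holomorphic_map_onD(1)[OF \<pi>(4)] that])
  have der\<Theta>: "((\<lambda>x. \<Theta> (\<pi> x)) has_derivative (\<lambda>v. \<Theta> (?D\<pi> x v))) (at x)" if "x \<in> U'" for x
    by (rule bounded_linear.has_derivative[OF bl\<Theta> der\<pi>[OF that]])
  have QD: "Q (?D\<pi> x v) = 0" if x: "x \<in> U'" for x v
  proof -
    have "((\<lambda>y. Q (\<pi> y)) has_derivative (\<lambda>v. Q (?D\<pi> x v))) (at x)"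
      using linQ linear_conv_bounded_linear der\<pi>[OF x]
      by (intro bounded_linear.has_derivative[of Q]) auto
    moreover have "((\<lambda>y. Q (\<pi> y)) has_derivative (\<lambda>v. 0)) (at x)"
      by (rule has_derivative_transform_within_open[OF has_derivative_const[of "Q p"] \<pi>(1) x]) (simp add: \<pi>(6))
    ultimately have "(\<lambda>v. Q (?D\<pi> x v)) = (\<lambda>v. 0)" by (rule has_derivative_unique)
    then show ?thesis by metis
  qed
  show thesis
  proof (rule that[of U' "\<lambda>x. \<Theta> (\<pi> x)"])
    show "U' \<subseteq> U" using \<pi>(3) T(3) by blast
    show "holomorphic_map_on U' (\<lambda>x. \<Theta> (\<pi> x))"
      by (rule complex_differentiable_imp_holomorphic_map_on[OF \<pi>(1) der\<Theta>])
         (simp_all add: holomorphic_map_onD(2)[OF \<pi>(4)] \<Theta>)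
    fix x h assume x: "x \<in> U'"
    have "frechet_derivative (\<lambda>x. \<Theta> (\<pi> x)) (at x) h = \<Theta> (?D\<pi> x h)"
      unfolding frechet_derivative_at[OF der\<Theta>[OF x], symmetric] ..
    also have "\<dots> = 0 \<longleftrightarrow> ?D\<pi> x h = 0"
    proof
      assume *: "\<Theta> (?D\<pi> x h) = 0"
      show "?D\<pi> x h = 0"
      proof (rule \<Theta>(3)[OF *])
        have "\<forall>i<r. co i (?D\<pi> x h) = 0"
          using QD[OF x, of h] unfolding Q_def S_def by (rule ind[OF U(2)])
        then show "co i (?D\<pi> x h) = 0" if "i < r" for i using that by blast
      qed
    next
      show "\<Theta> (?D\<pi> x h) = 0" if "?D\<pi> x h = 0" using that \<Theta>(2)[of 0 0] by simp
    qed
    also have "\<dots> \<longleftrightarrow> h \<in> W x" using \<pi>(5)[OF x] rangeA \<pi>(3) x by blast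
    finally show "frechet_derivative (\<lambda>x. \<Theta> (\<pi> x)) (at x) h = 0 \<longleftrightarrow> h \<in> W x" .
  qed (use \<pi> in auto)
qed

section \<open>Charts and differentials\<close>

lemma chart_onD:
  assumes "chart_on M c"
  shows "openin (top_of_set M) (fst c)" "open (snd c ` fst c)" "continuous_on (fst c) (snd c)"
    "continuous_on (snd c ` fst c) (chart_inv c)"
    "p \<in> fst c \<Longrightarrow> chart_inv c (snd c p) = p"
    "x \<in> snd c ` fst c \<Longrightarrow> snd c (chart_inv c x) = x"
    "x \<in> snd c ` fst c \<Longrightarrow> chart_inv c x \<in> fst c" "fst c \<subseteq> M"
  using assms unfolding chart_on_def homeomorphism_def by (auto simp: inv_into_into dest: openin_imp_subset)

lemma open_chart_image:
  assumes c: "chart_on M c" and U: "openin (top_of_set M) U"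
  shows "open (snd c ` (U \<inter> fst c))"
proof -
  obtain T where "open T" "U = M \<inter> T" using U openin_open by blast
  then have "openin (top_of_set (fst c)) (U \<inter> fst c)"
    unfolding openin_open using chart_onD(8)[OF c] by (intro exI[of _ T]) auto
  then have "openin (top_of_set (snd c ` fst c)) (snd c ` (U \<inter> fst c))"
    using c unfolding chart_on_def by (meson homeomorphism_imp_open_map)
  then show ?thesis using chart_onD(2)[OF c] openin_open_trans by blast
qed

lemma openin_chart_preimage:
  assumes c: "chart_on M c" and T: "open T"
  shows "openin (top_of_set M) {p \<in> fst c. snd c p \<in> T}"
proof -
  have "openin (top_of_set (fst c)) (fst c \<inter> snd c -` T)"
    by (rule continuous_openin_preimage_gen[OF chart_onD(3)[OF c] T])
  then have "openin (top_of_set M) (fst c \<inter> snd c -` T)" using chart_onD(1)[OF c] openin_trans by blast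
  moreover have "fst c \<inter> snd c -` T = {p \<in> fst c. snd c p \<in> T}" by blast
  ultimately show ?thesis by simp
qed

lemma chart_image_mem:
  assumes c: "chart_on M c" and p: "p \<in> fst c" "snd c p \<in> snd c ` (U \<inter> fst c)"
  shows "p \<in> U"
proof -
  obtain q where q: "snd c p = snd c q" "q \<in> U \<inter> fst c" using p(2) by (rule imageE)
  have "chart_inv c (snd c p) = chart_inv c (snd c q)" by (rule arg_cong[OF q(1)])
  also have "\<dots> = q" by (rule chart_onD(5)[OF c]) (use q(2) in simp)
  finally show ?thesis using chart_onD(5)[OF c p(1)] q(2) by simp
qed

definition smooth_in_charts ::
    "('a::topological_space, 'e::euclidean_space) chart set \<Rightarrow> 'a set \<Rightarrow> ('a \<Rightarrow> 'f::euclidean_space) \<Rightarrow> bool" where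
  "smooth_in_charts A U g \<longleftrightarrow> (\<forall>c\<in>A. smooth_on (snd c ` (U \<inter> fst c)) (g \<circ> chart_inv c))"

lemma smooth_in_chartsD: "smooth_in_charts A U g \<Longrightarrow> c \<in> A \<Longrightarrow> smooth_on (snd c ` (U \<inter> fst c)) (g \<circ> chart_inv c)"
  unfolding smooth_in_charts_def by blast

lemma smooth_in_charts_subset: "smooth_in_charts A U g \<Longrightarrow> U' \<subseteq> U \<Longrightarrow> smooth_in_charts A U' g"
  unfolding smooth_in_charts_def by (meson image_mono Int_mono order_refl smooth_on_subset)

lemma atlas_chart_on: "smooth_atlas M A \<Longrightarrow> c \<in> A \<Longrightarrow> chart_on M c"
  unfolding smooth_atlas_def by blast

lemma complex_atlas_imp_smooth: "complex_atlas M A \<Longrightarrow> smooth_atlas M A"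
  unfolding complex_atlas_def smooth_atlas_def holomorphic_map_on_def by blast

lemma chart_at_in:
  assumes "smooth_atlas M A" "p \<in> M"
  shows "chart_at A p \<in> A" "p \<in> fst (chart_at A p)"
proof -
  have "\<exists>c. c \<in> A \<and> p \<in> fst c" using assms unfolding smooth_atlas_def by blast
  from someI_ex[OF this] show "chart_at A p \<in> A" "p \<in> fst (chart_at A p)" unfolding chart_at_def by auto
qed

lemma smooth_transition:
  assumes "smooth_atlas M A" "c \<in> A" "d \<in> A"
  shows "smooth_on (snd c ` (fst d \<inter> fst c)) (snd d \<circ> chart_inv c)"
  using assms unfolding smooth_atlas_def by (simp add: inf_commute)

lemma smooth_in_charts_chart: "smooth_atlas M A \<Longrightarrow> d \<in> A \<Longrightarrow> smooth_in_charts A (fst d) (snd d)"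
  unfolding smooth_in_charts_def using smooth_transition by blast

lemma smooth_vector_field_subset: "smooth_vector_field A U \<xi> \<Longrightarrow> U' \<subseteq> U \<Longrightarrow> smooth_vector_field A U' \<xi>"
  unfolding smooth_vector_field_def by (meson image_mono Int_mono order_refl smooth_on_subset)

lemma chain_rule_charts:
  assumes "chart_on M c" "chart_on M d" "openin (top_of_set M) U" "q \<in> U" "q \<in> fst c" "q \<in> fst d"
    and "smooth_on (snd c ` (U \<inter> fst c)) (g \<circ> chart_inv c)"
    and "smooth_on (snd d ` (fst c \<inter> fst d)) (snd c \<circ> chart_inv d)"
  shows "((g \<circ> chart_inv d) has_derivative (\<lambda>v. frechet_derivative (g \<circ> chart_inv c) (at (snd c q))
      (frechet_derivative (snd c \<circ> chart_inv d) (at (snd d q)) v))) (at (snd d q))"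
proof -
  let ?\<tau> = "snd c \<circ> chart_inv d"
  have \<tau>q: "?\<tau> (snd d q) = snd c q" using chart_onD(5)[OF assms(2,6)] by simp
  have "(?\<tau> has_derivative frechet_derivative ?\<tau> (at (snd d q))) (at (snd d q))"
    by (rule smooth_on_has_derivative[OF assms(8)]) (use assms in auto)
  moreover have "((g \<circ> chart_inv c) has_derivative frechet_derivative (g \<circ> chart_inv c) (at (snd c q))) (at (?\<tau> (snd d q)))"
    unfolding \<tau>q by (rule smooth_on_has_derivative[OF assms(7)]) (use assms in auto)
  ultimately have "((\<lambda>x. (g \<circ> chart_inv c) (?\<tau> x)) has_derivative (\<lambda>v. frechet_derivative (g \<circ> chart_inv c) (at (snd c q))
      (frechet_derivative ?\<tau> (at (snd d q)) v))) (at (snd d q))"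
    by (rule has_derivative_compose)
  then show ?thesis
  proof (rule has_derivative_transform_within_open)
    show "open (snd d ` ((U \<inter> fst c) \<inter> fst d))"
      by (intro open_chart_image[OF assms(2)] openin_Int assms chart_onD(1)[OF assms(1)])
    show "snd d q \<in> snd d ` ((U \<inter> fst c) \<inter> fst d)" using assms by blast
    show "(g \<circ> chart_inv c) (?\<tau> x) = (g \<circ> chart_inv d) x" if "x \<in> snd d ` ((U \<inter> fst c) \<inter> fst d)" for x
      using that chart_onD(5)[OF assms(1)] chart_onD(5)[OF assms(2)] by auto
  qed
qed

abbreviation to_chart :: "('a, 'e::euclidean_space) chart set \<Rightarrow> ('a, 'e) chart \<Rightarrow> 'a \<Rightarrow> 'e \<Rightarrow> 'e" where
  "to_chart A c q \<equiv> diff_at A (snd c) q"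

context
  fixes M :: "'a::{t2_space, second_countable_topology} set" and A :: "('a, 'e::euclidean_space) chart set"
  assumes A: "smooth_atlas M A"
begin

text \<open>The differential is computed in the chart selected at the point; this expresses it in any other chart.\<close>

lemma diff_at_in_chart:
  assumes "c \<in> A" "openin (top_of_set M) U" "q \<in> U" "q \<in> fst c" "smooth_in_charts A U g"
  shows "diff_at A g q v = frechet_derivative (g \<circ> chart_inv c) (at (snd c q)) (to_chart A c q v)"
proof -
  have qM: "q \<in> M" using assms(2,3) openin_imp_subset by blast
  note d = chart_at_in[OF A qM]
  note fd = chain_rule_charts[OF atlas_chart_on[OF A assms(1)] atlas_chart_on[OF A d(1)] assms(2-4) d(2)
    smooth_in_chartsD[OF assms(5,1)] smooth_transition[OF A d(1) assms(1)]]
  show ?thesis unfolding diff_at_def frechet_derivative_at[OF fd, symmetric] ..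
qed

lemma diff_at_has_derivative:
  assumes "openin (top_of_set M) U" "q \<in> U" "smooth_in_charts A U g"
  shows "((g \<circ> chart_inv (chart_at A q)) has_derivative diff_at A g q) (at (snd (chart_at A q) q))"
proof -
  have qM: "q \<in> M" using assms(1,2) openin_imp_subset by blast
  note d = chart_at_in[OF A qM]
  show ?thesis unfolding diff_at_def
    by (rule smooth_on_has_derivative[OF smooth_in_chartsD[OF assms(3) d(1)]]) (use assms d in auto)
qed

lemma linear_diff_at:
  assumes "openin (top_of_set M) U" "q \<in> U" "smooth_in_charts A U g"
  shows "linear (diff_at A g q)"
  by (rule has_derivative_linear[OF diff_at_has_derivative[OF assms]])

lemma linear_to_chart: "c \<in> A \<Longrightarrow> q \<in> fst c \<Longrightarrow> linear (to_chart A c q)"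
  by (rule linear_diff_at[OF chart_onD(1)[OF atlas_chart_on[OF A]] _ smooth_in_charts_chart[OF A]])

lemma to_chart_at: "q \<in> M \<Longrightarrow> to_chart A (chart_at A q) q v = v"
proof -
  assume q: "q \<in> M"
  let ?d = "chart_at A q"
  note d = chart_at_in[OF A q] and cd = atlas_chart_on[OF A chart_at_in(1)[OF A q]]
  have "((snd ?d \<circ> chart_inv ?d) has_derivative (\<lambda>x. x)) (at (snd ?d q))"
  proof (rule has_derivative_transform_within_open[OF has_derivative_ident chart_onD(2)[OF cd]])
    show "x = (snd ?d \<circ> chart_inv ?d) x" if "x \<in> snd ?d ` fst ?d" for x using chart_onD(6)[OF cd that] by simp
  qed (use d in auto)
  from frechet_derivative_at[OF this] show ?thesis unfolding diff_at_def by metis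
qed

lemma inj_to_chart:
  assumes c: "c \<in> A" "q \<in> fst c"
  shows "inj (to_chart A c q)"
proof -
  have q: "q \<in> M" using c chart_onD(8)[OF atlas_chart_on[OF A c(1)]] by blast
  note d = chart_at_in[OF A q]
  have "frechet_derivative (snd (chart_at A q) \<circ> chart_inv c) (at (snd c q)) (to_chart A c q v) = v" for v
    using diff_at_in_chart[OF c(1) chart_onD(1)[OF atlas_chart_on[OF A d(1)]] d(2) c(2) smooth_in_charts_chart[OF A d(1)]]
      to_chart_at[OF q] by metis
  then show ?thesis by (rule inj_on_inverseI)
qed

lemma bij_to_chart: "c \<in> A \<Longrightarrow> q \<in> fst c \<Longrightarrow> bij (to_chart A c q)"
  by (rule linear_inj_imp_bij[OF linear_to_chart inj_to_chart refl])

lemma to_chart_change: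
  assumes "c \<in> A" "d \<in> A" "q \<in> fst c" "q \<in> fst d"
  shows "to_chart A d q v = frechet_derivative (snd d \<circ> chart_inv c) (at (snd c q)) (to_chart A c q v)"
  by (rule diff_at_in_chart[OF assms(1) chart_onD(1)[OF atlas_chart_on[OF A assms(2)]] assms(4,3)
        smooth_in_charts_chart[OF A assms(2)]])

lemma coord_rep_chart:
  "c \<in> A \<Longrightarrow> q \<in> fst c \<Longrightarrow> coord_rep A c \<xi> (snd c q) = to_chart A c q (\<xi> q)"
  unfolding coord_rep_def using chart_onD(5)[OF atlas_chart_on[OF A]] by simp

lemma smooth_on_transition_compose:
  assumes cd: "c \<in> A" "d \<in> A" and U: "openin (top_of_set M) U" "U \<subseteq> fst c" and g: "smooth_on (snd c ` U) g"
  shows "smooth_on (snd d ` (U \<inter> fst d)) (\<lambda>x. g (snd c (chart_inv d x)))"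
proof -
  note cc = atlas_chart_on[OF A cd(1)] and ccd = atlas_chart_on[OF A cd(2)]
  have \<tau>: "smooth_on (snd d ` (U \<inter> fst d)) (snd c \<circ> chart_inv d)"
    by (rule smooth_on_subset[OF smooth_transition[OF A cd(2,1)]]) (use U in auto)
  have "open (snd c ` U)" using open_chart_image[OF cc U(1)] U(2) by (simp add: inf.absorb1)
  then have "smooth_on (snd d ` (U \<inter> fst d)) (\<lambda>x. g ((snd c \<circ> chart_inv d) x))"
    by (rule smooth_on_compose[OF open_chart_image[OF ccd U(1)] _ \<tau> g]) (use chart_onD(5)[OF ccd] in auto)
  then show ?thesis by simp
qed

lemma smooth_in_charts_local:
  assumes U: "U \<subseteq> M"
    and loc: "\<And>p. p \<in> U \<Longrightarrow> \<exists>c U'. c \<in> A \<and> openin (top_of_set M) U' \<and> p \<in> U' \<and> U' \<subseteq> fst c \<and>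
      smooth_on (snd c ` U') (g \<circ> chart_inv c)"
  shows "smooth_in_charts A U g"
  unfolding smooth_in_charts_def
proof (intro ballI smooth_on_local)
  fix d x assume d: "d \<in> A" and "x \<in> snd d ` (U \<inter> fst d)"
  then obtain p where p: "p \<in> U" "p \<in> fst d" "x = snd d p" by blast
  obtain c U' where c: "c \<in> A" "openin (top_of_set M) U'" "p \<in> U'" "U' \<subseteq> fst c"
    "smooth_on (snd c ` U') (g \<circ> chart_inv c)" using loc[OF p(1)] by blast
  note cc = atlas_chart_on[OF A c(1)] and cd = atlas_chart_on[OF A d]
  have op: "open (snd d ` (U' \<inter> fst d))" by (rule open_chart_image[OF cd c(2)])
  have "smooth_on (snd d ` (U' \<inter> fst d)) (g \<circ> chart_inv d)"
    by (rule smooth_on_cong[OF op _ smooth_on_transition_compose[OF c(1) d c(2,4,5)]])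
       (use chart_onD(5)[OF cc] chart_onD(5)[OF cd] c(4) in auto)
  then show "\<exists>T. open T \<and> x \<in> T \<and> smooth_on T (g \<circ> chart_inv d)" using op p c(3) by blast
qed

text \<open>Coordinate representations in two charts differ by the derivative of the transition map, which is
smooth, so one chart around each point decides smoothness in all charts.\<close>

lemma smooth_vector_field_local:
  assumes U: "U \<subseteq> M"
    and loc: "\<And>p. p \<in> U \<Longrightarrow> \<exists>c U'. c \<in> A \<and> openin (top_of_set M) U' \<and> p \<in> U' \<and> U' \<subseteq> fst c \<and>
      smooth_on (snd c ` U') (coord_rep A c \<xi>)"
  shows "smooth_vector_field A U \<xi>"
  unfolding smooth_vector_field_def
proof (intro ballI smooth_on_local)
  fix d x assume d: "d \<in> A" and "x \<in> snd d ` (U \<inter> fst d)"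
  then obtain p where p: "p \<in> U" "p \<in> fst d" "x = snd d p" by blast
  obtain c U' where c: "c \<in> A" "openin (top_of_set M) U'" "p \<in> U'" "U' \<subseteq> fst c"
    "smooth_on (snd c ` U') (coord_rep A c \<xi>)" using loc[OF p(1)] by blast
  note cc = atlas_chart_on[OF A c(1)] and cd = atlas_chart_on[OF A d]
  define U2 where "U2 = U' \<inter> fst d"
  have U2: "openin (top_of_set M) U2" "U2 \<subseteq> fst c" "U2 \<subseteq> fst d" "p \<in> U2"
    unfolding U2_def using c p chart_onD(1)[OF cd] by auto
  have op: "open (snd d ` U2)" "open (snd c ` U2)"
    using open_chart_image[OF cd U2(1)] open_chart_image[OF cc U2(1)] U2 by (simp_all add: inf.absorb1)
  have "smooth_on (snd c ` U2) (\<lambda>x. frechet_derivative (snd d \<circ> chart_inv c) (at x) (coord_rep A c \<xi> x))"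
    by (intro smooth_on_derivative_field op smooth_on_subset[OF smooth_transition[OF A c(1) d]] smooth_on_subset[OF c(5)])
       (use U2 U2_def in auto)
  from smooth_on_transition_compose[OF c(1) d U2(1,2) this]
  have "smooth_on (snd d ` U2) (\<lambda>x. frechet_derivative (snd d \<circ> chart_inv c) (at (snd c (chart_inv d x)))
      (coord_rep A c \<xi> (snd c (chart_inv d x))))" using U2(3) by (simp add: inf.absorb1)
  then have "smooth_on (snd d ` U2) (coord_rep A d \<xi>)"
  proof (rule smooth_on_cong[OF op(1), rotated])
    fix y assume "y \<in> snd d ` U2"
    then obtain q where q: "q \<in> U2" "y = snd d q" by blast
    then have qc: "q \<in> fst c" "q \<in> fst d" using U2 by auto
    show "frechet_derivative (snd d \<circ> chart_inv c) (at (snd c (chart_inv d y)))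
      (coord_rep A c \<xi> (snd c (chart_inv d y))) = coord_rep A d \<xi> y"
      unfolding q(2) chart_onD(5)[OF cd qc(2)] coord_rep_chart[OF c(1) qc(1)] coord_rep_chart[OF d qc(2)]
      using to_chart_change[OF c(1) d qc] by simp
  qed
  then show "\<exists>T. open T \<and> x \<in> T \<and> smooth_on T (coord_rep A d \<xi>)" using op(1) U2(4) p(3) by blast
qed

end

section \<open>Lie brackets in charts\<close>

text \<open>Differentiating \<open>\<alpha> \<circ> \<tau> = D\<tau> a\<close> produces a second derivative of \<open>\<tau>\<close>; the two that occur in the bracket
cancel by symmetry.\<close>

lemma bracket_pushforward:
  fixes \<tau> :: "'e::euclidean_space \<Rightarrow> 'f::euclidean_space"
  assumes S: "open S" "x \<in> S" and \<tau>: "smooth_on S \<tau>"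
    and a: "(a has_derivative a') (at x)" and b: "(b has_derivative b') (at x)"
    and \<alpha>: "(\<alpha> has_derivative \<alpha>') (at (\<tau> x))" and \<beta>: "(\<beta> has_derivative \<beta>') (at (\<tau> x))"
    and rel: "\<And>y. y \<in> S \<Longrightarrow> \<alpha> (\<tau> y) = frechet_derivative \<tau> (at y) (a y)"
      "\<And>y. y \<in> S \<Longrightarrow> \<beta> (\<tau> y) = frechet_derivative \<tau> (at y) (b y)"
  shows "\<beta>' (\<alpha> (\<tau> x)) - \<alpha>' (\<beta> (\<tau> x)) = frechet_derivative \<tau> (at x) (b' (a x) - a' (b x))"
proof -
  let ?D = "\<lambda>y. frechet_derivative \<tau> (at y)"
  let ?H = "\<lambda>c. frechet_derivative (\<lambda>y. ?D y c) (at x)"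
  have key: "\<gamma>' (?D x h) = ?H (c x) h + ?D x (c' h)"
    if c: "(c has_derivative c') (at x)" and \<gamma>: "(\<gamma> has_derivative \<gamma>') (at (\<tau> x))"
      and r: "\<And>y. y \<in> S \<Longrightarrow> \<gamma> (\<tau> y) = ?D y (c y)" for c c' \<gamma> \<gamma>' h
  proof -
    have "((\<lambda>y. \<gamma> (\<tau> y)) has_derivative (\<lambda>h. \<gamma>' (?D x h))) (at x)"
      by (rule has_derivative_compose[OF smooth_on_has_derivative[OF \<tau> S(2)] \<gamma>])
    moreover have "((\<lambda>y. \<gamma> (\<tau> y)) has_derivative (\<lambda>h. ?H (c x) h + ?D x (c' h))) (at x)"
      by (rule has_derivative_transform_within_open[OF has_derivative_derivative_field[OF S \<tau> c] S]) (simp add: r)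
    ultimately have "(\<lambda>h. \<gamma>' (?D x h)) = (\<lambda>h. ?H (c x) h + ?D x (c' h))" by (rule has_derivative_unique)
    then show ?thesis by metis
  qed
  have "\<beta>' (\<alpha> (\<tau> x)) = ?H (b x) (a x) + ?D x (b' (a x))"
    unfolding rel(1)[OF S(2)] by (rule key[OF b \<beta> rel(2)])
  moreover have "\<alpha>' (\<beta> (\<tau> x)) = ?H (a x) (b x) + ?D x (a' (b x))"
    unfolding rel(2)[OF S(2)] by (rule key[OF a \<alpha> rel(1)])
  moreover have "?H (b x) (a x) = ?H (a x) (b x)" by (rule smooth_on_second_derivative_symmetric[OF S \<tau>])
  ultimately show ?thesis by (simp add: linear_diff[OF smooth_on_linear_frechet[OF \<tau> S(2)]])
qed

text \<open>The relation says that the complex field \<open>u + i w\<close> annihilates the conjugate of \<open>f\<close>, and the claim is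
that the bracket of \<open>u + i w\<close> and \<open>u' + i w'\<close> does so too.  Differentiating the two relations expresses
the derivatives of \<open>u\<close> and \<open>u'\<close> under \<open>Df\<close> by those of \<open>w\<close> and \<open>w'\<close> and by second derivatives of \<open>f\<close>; the
latter cancel by symmetry.\<close>

lemma bracket_antiholomorphic_kernel:
  fixes f :: "'e::euclidean_space \<Rightarrow> complex^'k"
  assumes S: "open S" "x \<in> S" and f: "smooth_on S f"
    and u: "(u has_derivative du) (at x)" and w: "(w has_derivative dw) (at x)"
    and u': "(u' has_derivative du') (at x)" and w': "(w' has_derivative dw') (at x)"
    and rel: "\<And>y. y \<in> S \<Longrightarrow> frechet_derivative f (at y) (u y) = \<i> *s frechet_derivative f (at y) (w y)"
      "\<And>y. y \<in> S \<Longrightarrow> frechet_derivative f (at y) (u' y) = \<i> *s frechet_derivative f (at y) (w' y)"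
  shows "frechet_derivative f (at x) ((du' (u x) - du (u' x)) - (dw' (w x) - dw (w' x))) =
    \<i> *s frechet_derivative f (at x) ((dw' (u x) - du (w' x)) + (du' (w x) - dw (u' x)))"
proof -
  let ?D = "\<lambda>y. frechet_derivative f (at y)"
  let ?H = "\<lambda>c. frechet_derivative (\<lambda>y. ?D y c) (at x)"
  have key: "?D x (da h) = \<i> *s (?H (b x) h + ?D x (db h)) - ?H (a x) h"
    if a: "(a has_derivative da) (at x)" and b: "(b has_derivative db) (at x)"
      and r: "\<forall>y\<in>S. ?D y (a y) = \<i> *s ?D y (b y)" for a da b db h
  proof -
    have "((\<lambda>y. ?D y (a y)) has_derivative (\<lambda>h. ?H (a x) h + ?D x (da h))) (at x)"
      by (rule has_derivative_derivative_field[OF S f a])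
    moreover have "((\<lambda>y. \<i> *s ?D y (b y)) has_derivative (\<lambda>h. \<i> *s (?H (b x) h + ?D x (db h)))) (at x)"
      by (rule bounded_linear.has_derivative[OF bounded_linear_scalar_mult_right has_derivative_derivative_field[OF S f b]])
    then have "((\<lambda>y. ?D y (a y)) has_derivative (\<lambda>h. \<i> *s (?H (b x) h + ?D x (db h)))) (at x)"
      by (rule has_derivative_transform_within_open[OF _ S]) (simp add: r)
    ultimately have "(\<lambda>h. ?H (a x) h + ?D x (da h)) = (\<lambda>h. \<i> *s (?H (b x) h + ?D x (db h)))"
      by (rule has_derivative_unique)
    then have "?H (a x) h + ?D x (da h) = \<i> *s (?H (b x) h + ?D x (db h))" by metis
    then show ?thesis by (simp add: algebra_simps)
  qed
  have rel': "\<forall>y\<in>S. ?D y (u y) = \<i> *s ?D y (w y)" "\<forall>y\<in>S. ?D y (u' y) = \<i> *s ?D y (w' y)"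
    using rel by auto
  note sym = smooth_on_second_derivative_symmetric[OF S f]
  have lin: "linear (?D x)" by (rule smooth_on_linear_frechet[OF f S(2)])
  have ii: "\<i> *s (\<i> *s v) = - v" for v :: "complex^'k" by (simp add: vec_eq_iff)
  have k: "?D x (da h) = \<i> *s ?H (b x) h + \<i> *s ?D x (db h) - ?H (a x) h"
    "\<i> *s ?D x (da h) = - ?H (b x) h - ?D x (db h) - \<i> *s ?H (a x) h"
    if a: "(a has_derivative da) (at x)" and b: "(b has_derivative db) (at x)"
      and r: "\<forall>y\<in>S. ?D y (a y) = \<i> *s ?D y (b y)" for a da b db h
    unfolding key[OF a b r] by (simp_all add: vec.scale_right_distrib vec.scale_right_diff_distrib ii)
  show ?thesis
    unfolding linear_diff[OF lin] linear_add[OF lin] vec.scale_right_distrib vec.scale_right_diff_distrib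
      k(1)[OF u w rel'(1), of "u' x"] k(2)[OF u w rel'(1), of "w' x"]
      k(1)[OF u' w' rel'(2), of "u x"] k(2)[OF u' w' rel'(2), of "w x"]
      sym[of "u' x" "u x"] sym[of "w' x" "w x"] sym[of "w' x" "u x"] sym[of "w x" "u' x"]
    by simp
qed

text \<open>The bracket at \<open>p\<close> is defined in the chart selected at \<open>p\<close>.  Involutivity has to be used at all points of
a neighbourhood in one and the same chart, hence this invariance.\<close>

lemma lie_bracket_in_chart:
  fixes A :: "('a::{t2_space, second_countable_topology}, 'e::euclidean_space) chart set"
  assumes A: "smooth_atlas M A" and U: "openin (top_of_set M) U" "p \<in> U"
    and sm: "smooth_vector_field A U \<xi>" "smooth_vector_field A U \<eta>" and c: "c \<in> A" "p \<in> fst c"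
  shows "to_chart A c p (lie_bracket A \<xi> \<eta> p) =
      frechet_derivative (coord_rep A c \<eta>) (at (snd c p)) (coord_rep A c \<xi> (snd c p))
    - frechet_derivative (coord_rep A c \<xi>) (at (snd c p)) (coord_rep A c \<eta> (snd c p))"
proof -
  have pM: "p \<in> M" using U openin_imp_subset by blast
  define d where "d = chart_at A p"
  have d: "d \<in> A" "p \<in> fst d" using chart_at_in[OF A pM] unfolding d_def by auto
  note cc = atlas_chart_on[OF A c(1)] and cd = atlas_chart_on[OF A d(1)]
  let ?\<tau> = "snd c \<circ> chart_inv d"
  let ?S = "snd d ` ((U \<inter> fst c) \<inter> fst d)"
  have S: "open ?S" "snd d p \<in> ?S"
    using U c d by (auto intro!: open_chart_image[OF cd] openin_Int chart_onD(1)[OF cc])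
  have \<tau>: "smooth_on ?S ?\<tau>" by (rule smooth_on_subset[OF smooth_transition[OF A d(1) c(1)]]) auto
  have \<tau>p: "?\<tau> (snd d p) = snd c p" using chart_onD(5)[OF cd d(2)] by simp
  have der: "(coord_rep A e \<zeta> has_derivative frechet_derivative (coord_rep A e \<zeta>) (at (snd e p))) (at (snd e p))"
    if "e \<in> A" "p \<in> fst e" "smooth_vector_field A U \<zeta>" for e \<zeta>
    using that U(2) unfolding smooth_vector_field_def by (intro smooth_on_has_derivative[of "snd e ` (U \<inter> fst e)"]) auto
  have rel: "coord_rep A c \<zeta> (?\<tau> y) = frechet_derivative ?\<tau> (at y) (coord_rep A d \<zeta> y)" if y: "y \<in> ?S" for y \<zeta>
  proof -
    obtain q where q: "q \<in> U" "q \<in> fst c" "q \<in> fst d" "y = snd d q" using y by blast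
    show ?thesis unfolding q(4) comp_apply chart_onD(5)[OF cd q(3)] coord_rep_chart[OF A c(1) q(2)]
        coord_rep_chart[OF A d(1) q(3)] using to_chart_change[OF A d(1) c(1) q(3,2)] unfolding comp_def by simp
  qed
  have at: "coord_rep A d \<zeta> (snd d p) = \<zeta> p" for \<zeta>
    unfolding coord_rep_chart[OF A d] using to_chart_at[OF A pM] unfolding d_def by simp
  have "frechet_derivative (coord_rep A c \<eta>) (at (snd c p)) (coord_rep A c \<xi> (?\<tau> (snd d p)))
    - frechet_derivative (coord_rep A c \<xi>) (at (snd c p)) (coord_rep A c \<eta> (?\<tau> (snd d p))) =
    frechet_derivative ?\<tau> (at (snd d p)) (frechet_derivative (coord_rep A d \<eta>) (at (snd d p)) (coord_rep A d \<xi> (snd d p))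
     - frechet_derivative (coord_rep A d \<xi>) (at (snd d p)) (coord_rep A d \<eta> (snd d p)))"
    by (rule bracket_pushforward[OF S \<tau> der[OF d sm(1)] der[OF d sm(2)] _ _ rel rel])
       (use der[OF c sm(1)] der[OF c sm(2)] \<tau>p in auto)
  also have "\<dots> = to_chart A c p (lie_bracket A \<xi> \<eta> p)"
    unfolding at lie_bracket_def Let_def d_def[symmetric] to_chart_change[OF A d(1) c(1) d(2) c(2)]
    using to_chart_at[OF A pM] unfolding d_def by simp
  finally show ?thesis unfolding \<tau>p ..
qed

section \<open>First integrals of a holomorphic foliation\<close>

lemma part10_eq: "part10 \<xi> = ((1/2) *\<^sub>R \<xi>, - ((1/2) *\<^sub>R (\<i> *s \<xi>)))"
  unfolding part10_def cscale_def of_tangent_def J_def by simp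

lemma part10_inj: "part10 \<xi> = part10 \<eta> \<longleftrightarrow> \<xi> = \<eta>"
  unfolding part10_eq by auto

lemma inj_part10: "inj part10"
  by (rule injI) (simp only: part10_inj)

lemma T10_iff: "(a, b) \<in> T10 \<longleftrightarrow> a = \<i> *s b"
proof
  assume "(a, b) \<in> T10"
  then obtain \<xi> where "a = (1/2) *\<^sub>R \<xi>" "b = - ((1/2) *\<^sub>R (\<i> *s \<xi>))" unfolding T10_def part10_eq by auto
  then show "a = \<i> *s b" unfolding scaleR_eq_scalar_mult vec_eq_iff by simp
next
  assume "a = \<i> *s b"
  then have "(a, b) = part10 (2 *\<^sub>R a)"
    unfolding part10_eq scaleR_eq_scalar_mult prod_eq_iff vec_eq_iff by simp
  then show "(a, b) \<in> T10" unfolding T10_def by simp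
qed

lemma part10_scale: "part10 (z *s \<xi>) = cscale z (part10 \<xi>)"
  unfolding part10_eq cscale_def prod_eq_iff vec_eq_iff
  by (auto simp: complex_eq_iff field_simps)

lemma part10_sum: "part10 (\<Sum>i\<in>I. f i) = (\<Sum>i\<in>I. part10 (f i))"
proof -
  have "linear part10"
    by (rule linearI)
       (simp_all add: part10_eq vec.scale_right_distrib scaleR_right_distrib scaleR_eq_scalar_mult mult.commute)
  then show ?thesis by (rule linear_sum)
qed

lemma to_chart_complex_linear:
  assumes A: "complex_atlas X A" and c: "c \<in> A" "q \<in> fst c"
  shows "to_chart A c q (\<i> *s v) = \<i> *s to_chart A c q v"
proof -
  have A': "smooth_atlas X A" by (rule complex_atlas_imp_smooth[OF A])
  have q: "q \<in> X" using c chart_onD(8)[OF atlas_chart_on[OF A' c(1)]] by blast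
  note d = chart_at_in[OF A' q]
  have "holomorphic_map_on (snd (chart_at A q) ` (fst (chart_at A q) \<inter> fst c)) (snd c \<circ> chart_inv (chart_at A q))"
    using A d(1) c(1) unfolding complex_atlas_def by blast
  from holomorphic_map_onD(2)[OF this] show ?thesis unfolding diff_at_def using d(2) c(2) by blast
qed

text \<open>Taking \<open>(1,0)\<close> parts is injective and turns multiplication by complex scalars into \<open>cscale\<close>, so a frame
of \<open>E\<close> is the same as a complex frame of \<open>V\<close>.\<close>

lemma holomorphic_frame:
  assumes E: "holomorphic_subbundle_T10 A X r E" and V: "\<forall>p\<in>X. part10 ` V p = E p" and p: "p \<in> X"
  obtains U \<xi> where "openin (top_of_set X) U" "p \<in> U"
    "\<And>i c. i < r \<Longrightarrow> c \<in> A \<Longrightarrow> holomorphic_map_on (snd c ` (U \<inter> fst c)) (coord_rep A c (\<xi> i))"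
    "\<And>q. q \<in> U \<Longrightarrow> V q = {\<Sum>i<r. a i *s \<xi> i q | a. True}"
    "\<And>q a. q \<in> U \<Longrightarrow> (\<Sum>i<r. a i *s \<xi> i q) = 0 \<Longrightarrow> \<forall>i<r. a i = 0"
proof -
  obtain U s where Us: "openin (top_of_set X) U \<and> p \<in> U \<and> (\<forall>i<r. holomorphic_section A U (s i)) \<and>
      (\<forall>q\<in>U. is_frame cscale r (\<lambda>i. s i q) (E q))"
    using bspec[OF E[unfolded holomorphic_subbundle_T10_def locally_framed_def] p] by (elim exE)
  then have U: "openin (top_of_set X) U" "p \<in> U" and s: "\<And>i. i < r \<Longrightarrow> holomorphic_section A U (s i)"
    and fr: "\<And>q. q \<in> U \<Longrightarrow> is_frame cscale r (\<lambda>i. s i q) (E q)" by simp_all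
  have "\<forall>i. \<exists>\<xi>. i < r \<longrightarrow> (\<forall>c\<in>A. holomorphic_map_on (snd c ` (U \<inter> fst c)) (coord_rep A c \<xi>)) \<and>
          (\<forall>p\<in>U. s i p = part10 (\<xi> p))" using s unfolding holomorphic_section_def by blast
  then obtain \<xi> where \<xi>: "\<And>i c. i < r \<Longrightarrow> c \<in> A \<Longrightarrow> holomorphic_map_on (snd c ` (U \<inter> fst c)) (coord_rep A c (\<xi> i))"
    "\<And>i q. i < r \<Longrightarrow> q \<in> U \<Longrightarrow> s i q = part10 (\<xi> i q)" by metis
  have eq: "(\<Sum>i<r. cscale (a i) (s i q)) = part10 (\<Sum>i<r. a i *s \<xi> i q)" if "q \<in> U" for a q
    unfolding part10_sum by (intro sum.cong refl) (simp add: \<xi>(2)[OF _ that] part10_scale)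
  show thesis
  proof (rule that[OF U \<xi>(1)])
    fix q assume q: "q \<in> U"
    then have qX: "q \<in> X" using U openin_imp_subset by blast
    have "part10 ` V q = {\<Sum>i<r. cscale (a i) (s i q) | a. True}"
      using bspec[OF V qX] fr[OF q, unfolded is_frame_def, THEN conjunct1] by (rule trans)
    also have "\<dots> = part10 ` {\<Sum>i<r. a i *s \<xi> i q | a. True}" unfolding eq[OF q] by blast
    finally show "V q = {\<Sum>i<r. a i *s \<xi> i q | a. True}"
      by (simp only: inj_image_eq_iff[OF inj_part10])
    show "\<forall>i<r. a i = 0" if "(\<Sum>i<r. a i *s \<xi> i q) = 0" for a
    proof -
      have "part10 0 = 0" unfolding part10_eq by (simp add: zero_prod_def)
      then have "(\<Sum>i<r. cscale (a i) (s i q)) = 0" unfolding eq[OF q] that .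
      then show ?thesis using fr[OF q, unfolded is_frame_def, THEN conjunct2] by simp
    qed
  qed
qed

text \<open>The Frobenius theorem in one chart, applied to the image \<open>W\<close> of \<open>V\<close> there.  Vector fields with values in \<open>W\<close>
are lifted to the manifold in order to use the involutivity of \<open>V\<close>.\<close>

lemma local_first_integral:
  fixes X :: "'a::{t2_space, second_countable_topology} set" and A :: "('a, complex^'n) chart set"
  assumes X: "complex_atlas X A" and E: "holomorphic_subbundle_T10 A X r E"
    and V: "real_involutive A X V" "\<forall>p\<in>X. part10 ` V p = E p" and p: "p \<in> X"
    and card: "CARD('n) \<le> CARD('k) + r"
  obtains U and g :: "'a \<Rightarrow> complex^'k" where "openin (top_of_set X) U" "p \<in> U" "smooth_in_charts A U g"
    "\<And>q v. q \<in> U \<Longrightarrow> diff_at A g q (\<i> *s v) = \<i> *s diff_at A g q v"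
    "\<And>q v. q \<in> U \<Longrightarrow> diff_at A g q v = 0 \<longleftrightarrow> v \<in> V q"
proof -
  have A: "smooth_atlas X A" by (rule complex_atlas_imp_smooth[OF X])
  define c where "c = chart_at A p"
  have c: "c \<in> A" "p \<in> fst c" using chart_at_in[OF A p] unfolding c_def by auto
  note cc = atlas_chart_on[OF A c(1)]
  obtain U0 \<xi> where U0: "openin (top_of_set X) U0" "p \<in> U0"
    and \<xi>: "\<And>i c. i < r \<Longrightarrow> c \<in> A \<Longrightarrow> holomorphic_map_on (snd c ` (U0 \<inter> fst c)) (coord_rep A c (\<xi> i))"
    and Vq: "\<And>q. q \<in> U0 \<Longrightarrow> V q = {\<Sum>i<r. a i *s \<xi> i q | a. True}"
    and ind: "\<And>q a. q \<in> U0 \<Longrightarrow> (\<Sum>i<r. a i *s \<xi> i q) = 0 \<Longrightarrow> \<forall>i<r. a i = 0"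
    using holomorphic_frame[OF E V(2) p] by blast
  define O' where "O' = snd c ` (U0 \<inter> fst c)"
  have O': "open O'" "snd c p \<in> O'" unfolding O'_def using open_chart_image[OF cc U0(1)] U0 c by auto
  define f where "f i = coord_rep A c (\<xi> i)" for i
  define W where "W x = to_chart A c (chart_inv c x) ` V (chart_inv c x)" for x
  have lin: "linear (to_chart A c q)" if "q \<in> fst c" for q by (rule linear_to_chart[OF A c(1) that])
  have scale: "to_chart A c q (z *s v) = z *s to_chart A c q v" if "q \<in> fst c" for q z v
    by (rule complex_linear_scale[OF lin[OF that] to_chart_complex_linear[OF X c(1) that]])
  have bij: "bij (to_chart A c q)" if "q \<in> fst c" for q by (rule bij_to_chart[OF A c(1) that])
  have fsum: "(\<Sum>i<r. a i *s f i (snd c q)) = to_chart A c q (\<Sum>i<r. a i *s \<xi> i q)" if "q \<in> fst c" for a q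
    unfolding linear_sum[OF lin[OF that]] f_def
    by (intro sum.cong refl) (simp add: scale[OF that] coord_rep_chart[OF A c(1) that])
  have Wq: "W (snd c q) = to_chart A c q ` V q" if "q \<in> fst c" for q
    unfolding W_def chart_onD(5)[OF cc that] ..
  obtain U' and \<pi> :: "complex^'n \<Rightarrow> complex^'k" where U': "open U'" "snd c p \<in> U'" "U' \<subseteq> O'" "holomorphic_map_on U' \<pi>"
    and ker: "\<And>x h. x \<in> U' \<Longrightarrow> frechet_derivative \<pi> (at x) h = 0 \<longleftrightarrow> h \<in> W x"
  proof (rule holomorphic_frobenius[OF O' _ _ _ _ card, of f W])
    show "holomorphic_map_on O' (f i)" if "i < r" for i unfolding f_def O'_def by (rule \<xi>[OF that c(1)])
    show "W x = {\<Sum>i<r. a i *s f i x | a. True}" if "x \<in> O'" for x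
    proof -
      obtain q where q: "q \<in> U0" "q \<in> fst c" "x = snd c q" using \<open>x \<in> O'\<close> unfolding O'_def by blast
      show ?thesis unfolding q(3) Wq[OF q(2)] fsum[OF q(2)] Vq[OF q(1)] by blast
    qed
    show "\<forall>i<r. a i = 0" if "x \<in> O'" "(\<Sum>i<r. a i *s f i x) = 0" for x a
    proof -
      obtain q where q: "q \<in> U0" "q \<in> fst c" "x = snd c q" using \<open>x \<in> O'\<close> unfolding O'_def by blast
      have "to_chart A c q (\<Sum>i<r. a i *s \<xi> i q) = 0" using that(2) unfolding q(3) fsum[OF q(2)] .
      then have "(\<Sum>i<r. a i *s \<xi> i q) = 0"
        using bij[OF q(2)] lin[OF q(2)] by (simp add: bij_def linear_injective_0)
      then show ?thesis by (rule ind[OF q(1)])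
    qed
    fix T a b x assume T: "open T" "T \<subseteq> O'" "x \<in> T" "smooth_on T a" "smooth_on T b"
      and ab: "\<And>y. y \<in> T \<Longrightarrow> a y \<in> W y \<and> b y \<in> W y"
    define UT where "UT = {q \<in> fst c. snd c q \<in> T}"
    have UT: "openin (top_of_set X) UT" unfolding UT_def by (rule openin_chart_preimage[OF cc T(1)])
    have UTc: "UT \<subseteq> fst c" "UT \<subseteq> X" using openin_imp_subset[OF UT] unfolding UT_def by auto
    have imT: "snd c ` UT = T" using T(2) unfolding UT_def O'_def by blast
    (* The vector field on X whose representation in the chart c is the given one. *)
    define lift where "lift a q = inv (to_chart A c q) (a (snd c q))" for a :: "complex^'n \<Rightarrow> complex^'n" and q
    have rep: "coord_rep A c (lift a) y = a y" if "y \<in> T" for a y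
    proof -
      have "y \<in> snd c ` UT" unfolding imT by (rule that)
      then obtain q where q: "q \<in> fst c" "y = snd c q" using UTc(1) by blast
      show ?thesis unfolding q(2) coord_rep_chart[OF A c(1) q(1)] lift_def
        using bij[OF q(1)] by (simp add: bij_is_surj surj_f_inv_f)
    qed
    have sm: "smooth_vector_field A UT (lift a)" if "smooth_on T a" for a
    proof (rule smooth_vector_field_local[OF A UTc(2)])
      have "smooth_on (snd c ` UT) (coord_rep A c (lift a))"
        unfolding imT by (rule smooth_on_cong[OF T(1) _ that]) (simp add: rep)
      then show "\<exists>c U'. c \<in> A \<and> openin (top_of_set X) U' \<and> q \<in> U' \<and> U' \<subseteq> fst c \<and> smooth_on (snd c ` U') (coord_rep A c (lift a))"
        if "q \<in> UT" for q using c(1) UT UTc(1) that by blast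
    qed
    have inV: "lift a q \<in> V q" if qT: "q \<in> UT" and aW: "a (snd c q) \<in> W (snd c q)" for a q
    proof -
      have qc: "q \<in> fst c" using qT UTc(1) by blast
      then obtain v where "v \<in> V q" "a (snd c q) = to_chart A c q v" using aW unfolding Wq[OF qc] by blast
      then show ?thesis unfolding lift_def using bij[OF qc] by (simp add: bij_is_inj)
    qed
    obtain q where q: "q \<in> UT" "x = snd c q" using T(3) imT by blast
    have qc: "q \<in> fst c" using q(1) UTc(1) by blast
    have "\<forall>q\<in>UT. lift a q \<in> V q \<and> lift b q \<in> V q"
      using inV ab unfolding UT_def by blast
    then have "lie_bracket A (lift a) (lift b) q \<in> V q"
      using V(1) UT sm[OF T(4)] sm[OF T(5)] q(1) unfolding real_involutive_def by blast
    moreover have "to_chart A c q (lie_bracket A (lift a) (lift b) q) =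
      frechet_derivative b (at x) (a x) - frechet_derivative a (at x) (b x)"
    proof -
      have fr: "frechet_derivative (coord_rep A c (lift a)) (at x) = frechet_derivative a (at x)"
        if "smooth_on T a" for a
        by (rule frechet_derivative_transform_within_open[symmetric, OF smooth_on_imp_differentiable[OF that T(3)] T(1,3)])
           (simp add: rep)
      show ?thesis
        using lie_bracket_in_chart[OF A UT q(1) sm[OF T(4)] sm[OF T(5)] c(1) qc]
        unfolding q(2)[symmetric] fr[OF T(4)] fr[OF T(5)] rep[OF T(3)] .
    qed
    ultimately show "frechet_derivative b (at x) (a x) - frechet_derivative a (at x) (b x) \<in> W x"
      unfolding q(2) Wq[OF qc] by (metis imageI)
  qed blast
  define U where "U = {q \<in> fst c. snd c q \<in> U'}"
  have U: "openin (top_of_set X) U" unfolding U_def by (rule openin_chart_preimage[OF cc U'(1)])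
  have Uc: "U \<subseteq> fst c" "U \<subseteq> X" using openin_imp_subset[OF U] unfolding U_def by auto
  have imU: "snd c ` U = U'" using U'(3) unfolding U_def O'_def by blast
  define g where "g = \<pi> \<circ> snd c"
  have gc: "smooth_on (snd c ` U) (g \<circ> chart_inv c)"
    unfolding imU
  proof (rule smooth_on_cong[OF U'(1) _ holomorphic_map_onD(1)[OF U'(4)]])
    show "\<pi> x = (g \<circ> chart_inv c) x" if "x \<in> U'" for x
    proof -
      have "x \<in> snd c ` fst c" using that imU Uc(1) by blast
      then show ?thesis unfolding g_def using chart_onD(6)[OF cc] by simp
    qed
  qed
  have sg: "smooth_in_charts A U g"
    by (rule smooth_in_charts_local[OF A Uc(2)]) (use c(1) U Uc(1) gc in blast)
  have dg: "diff_at A g q v = frechet_derivative \<pi> (at (snd c q)) (to_chart A c q v)" if q: "q \<in> U" for q v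
  proof -
    have qc: "q \<in> fst c" "snd c q \<in> U'" using q unfolding U_def by auto
    have "frechet_derivative \<pi> (at (snd c q)) = frechet_derivative (g \<circ> chart_inv c) (at (snd c q))"
    proof (rule frechet_derivative_transform_within_open[OF smooth_on_imp_differentiable[OF holomorphic_map_onD(1)[OF U'(4)] qc(2)] U'(1) qc(2)])
      show "\<pi> x = (g \<circ> chart_inv c) x" if "x \<in> U'" for x
      proof -
        have "x \<in> snd c ` fst c" using that imU Uc(1) by blast
        then show ?thesis unfolding g_def using chart_onD(6)[OF cc] by simp
      qed
    qed
    then show ?thesis using diff_at_in_chart[OF A c(1) U q qc(1) sg] by simp
  qed
  show thesis
  proof (rule that[OF U _ sg])
    show "p \<in> U" unfolding U_def using c U'(2) by simp
    fix q v assume q: "q \<in> U"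
    then have qc: "q \<in> fst c" "snd c q \<in> U'" unfolding U_def by auto
    show "diff_at A g q (\<i> *s v) = \<i> *s diff_at A g q v"
      unfolding dg[OF q] using holomorphic_map_onD(2)[OF U'(4) qc(2)] scale[OF qc(1)] by simp
    show "diff_at A g q v = 0 \<longleftrightarrow> v \<in> V q"
      unfolding dg[OF q] ker[OF qc(2)] Wq[OF qc(1)] using bij[OF qc(1)] by (simp add: bij_is_inj inj_image_mem_iff)
  qed
qed

section \<open>Restriction to a totally real submanifold\<close>

lemma openin_restrict:
  assumes "openin (top_of_set X) U" "N \<subseteq> X"
  shows "openin (top_of_set N) (U \<inter> N)"
proof -
  obtain T where "open T" "U = X \<inter> T" using assms(1) openin_open by blast
  then show ?thesis unfolding openin_open using assms(2) by (intro exI[of _ T]) auto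
qed

lemma submanifold_inclusion_smooth:
  assumes "submanifold A X B N" "b \<in> B" "c \<in> A"
  shows "smooth_on (snd b ` (N \<inter> fst b \<inter> fst c)) (snd c \<circ> chart_inv b)"
  using assms unfolding submanifold_def smooth_map_def comp_def by (auto simp: vimage_def)

text \<open>The derivative of \<open>g\<close> along \<open>N\<close> is that of \<open>g\<close> on the ambient manifold composed with the inclusion.\<close>

lemma submanifold_pullback:
  fixes A :: "('a::{t2_space, second_countable_topology}, 'e::euclidean_space) chart set"
    and B :: "('a, 'f::euclidean_space) chart set" and g :: "'a \<Rightarrow> 'g::euclidean_space"
  assumes A: "smooth_atlas X A" and N: "submanifold A X B N" and U: "openin (top_of_set X) U"
    and g: "smooth_in_charts A U g"
  shows "openin (top_of_set N) (U \<inter> N)" "smooth_in_charts B (U \<inter> N) g"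
    "q \<in> U \<inter> N \<Longrightarrow> diff_at B g q u = diff_at A g q (incl_diff A B q u)"
proof -
  have B: "smooth_atlas N B" and NX: "N \<subseteq> X" using N unfolding submanifold_def by auto
  have opN: "openin (top_of_set N) (U \<inter> N)" if "openin (top_of_set X) U" for U
    by (rule openin_restrict[OF that NX])
  show "openin (top_of_set N) (U \<inter> N)" by (rule opN[OF U])
  have loc: "openin (top_of_set N) U'" "open (snd b ` U')" "q \<in> U'" "smooth_on (snd b ` U') (snd c \<circ> chart_inv b)"
    "(snd c \<circ> chart_inv b) ` snd b ` U' \<subseteq> snd c ` (U \<inter> fst c)"
    "\<And>x. x \<in> snd b ` U' \<Longrightarrow> (g \<circ> chart_inv c) ((snd c \<circ> chart_inv b) x) = (g \<circ> chart_inv b) x"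
    "b \<in> B" "c \<in> A" "U' \<subseteq> fst b" "q \<in> fst b" "q \<in> fst c"
    if "q \<in> U \<inter> N" "b = chart_at B q" "c = chart_at A q" "U' = (U \<inter> fst c) \<inter> N \<inter> fst b" for q b c U'
  proof -
    have b: "b \<in> B" "q \<in> fst b" and c: "c \<in> A" "q \<in> fst c"
      using that chart_at_in[OF B] chart_at_in[OF A] NX by auto
    note cb = atlas_chart_on[OF B b(1)] and cc = atlas_chart_on[OF A c(1)]
    show U': "openin (top_of_set N) U'"
      unfolding that(4) by (intro openin_Int opN U chart_onD(1)[OF cc] chart_onD(1)[OF cb])
    show "U' \<subseteq> fst b" "b \<in> B" "c \<in> A" "q \<in> fst b" "q \<in> fst c" using that b c by auto
    then show "open (snd b ` U')" using open_chart_image[OF cb U'] by (simp add: inf.absorb1)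
    show "q \<in> U'" using that b c by auto
    show "smooth_on (snd b ` U') (snd c \<circ> chart_inv b)"
      by (rule smooth_on_subset[OF submanifold_inclusion_smooth[OF N b(1) c(1)]]) (auto simp: that(4))
    show "(snd c \<circ> chart_inv b) ` snd b ` U' \<subseteq> snd c ` (U \<inter> fst c)"
      "\<And>x. x \<in> snd b ` U' \<Longrightarrow> (g \<circ> chart_inv c) ((snd c \<circ> chart_inv b) x) = (g \<circ> chart_inv b) x"
      using chart_onD(5)[OF cb] chart_onD(5)[OF cc] by (auto simp: that(4))
  qed
  show "smooth_in_charts B (U \<inter> N) g"
  proof (rule smooth_in_charts_local[OF B])
    fix q assume q: "q \<in> U \<inter> N"
    note l = loc[OF q refl refl refl]
    have "smooth_on (snd (chart_at B q) ` (U \<inter> fst (chart_at A q) \<inter> N \<inter> fst (chart_at B q))) (g \<circ> chart_inv (chart_at B q))"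
      by (rule smooth_on_cong[OF l(2) l(6) smooth_on_compose[OF l(2) open_chart_image[OF atlas_chart_on[OF A l(8)] U] l(4)
            smooth_in_chartsD[OF g l(8)] l(5)]])
    then show "\<exists>c U'. c \<in> B \<and> openin (top_of_set N) U' \<and> q \<in> U' \<and> U' \<subseteq> fst c \<and> smooth_on (snd c ` U') (g \<circ> chart_inv c)"
      using l by blast
  qed auto
  assume q: "q \<in> U \<inter> N"
  define b c U' where bc: "b = chart_at B q" "c = chart_at A q" "U' = (U \<inter> fst c) \<inter> N \<inter> fst b"
  note l = loc[OF q bc]
  have bq: "(snd c \<circ> chart_inv b) (snd b q) = snd c q" using chart_onD(5)[OF atlas_chart_on[OF B l(7)] l(10)] by simp
  have qb: "snd b q \<in> snd b ` U'" using l(3) by blast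
  have "((\<lambda>x. (g \<circ> chart_inv c) ((snd c \<circ> chart_inv b) x)) has_derivative
     (\<lambda>v. frechet_derivative (g \<circ> chart_inv c) (at (snd c q)) (frechet_derivative (snd c \<circ> chart_inv b) (at (snd b q)) v))) (at (snd b q))"
  proof (rule has_derivative_compose[OF smooth_on_has_derivative[OF l(4) qb]])
    show "((g \<circ> chart_inv c) has_derivative frechet_derivative (g \<circ> chart_inv c) (at (snd c q))) (at ((snd c \<circ> chart_inv b) (snd b q)))"
      unfolding bq by (rule smooth_on_has_derivative[OF smooth_in_chartsD[OF g l(8)]]) (use q l(11) in auto)
  qed
  then have "((g \<circ> chart_inv b) has_derivative
     (\<lambda>v. frechet_derivative (g \<circ> chart_inv c) (at (snd c q)) (frechet_derivative (snd c \<circ> chart_inv b) (at (snd b q)) v))) (at (snd b q))"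
    by (rule has_derivative_transform_within_open[OF _ l(2) qb l(6)])
  from frechet_derivative_at[OF this]
  show "diff_at B g q u = diff_at A g q (incl_diff A B q u)"
    unfolding incl_diff_def tangent_map_def diff_at_def bc by (metis comp_def[of "snd (chart_at A q)" "\<lambda>q. q"])
qed

lemma linear_incl_diff:
  assumes A: "smooth_atlas X A" and N: "submanifold A X B N" and q: "q \<in> N"
  shows "linear (incl_diff A B q)"
proof -
  have B: "smooth_atlas N B" and NX: "N \<subseteq> X" using N unfolding submanifold_def by auto
  have "linear (frechet_derivative (snd (chart_at A q) \<circ> chart_inv (chart_at B q)) (at (snd (chart_at B q) q)))"
    by (rule smooth_on_linear_frechet[OF submanifold_inclusion_smooth[OF N]])
       (use chart_at_in[OF B q] chart_at_in[OF A] NX q in auto)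
  then show ?thesis unfolding incl_diff_def tangent_map_def diff_at_def by (simp add: comp_def)
qed

text \<open>A vector in the kernel of \<open>l\<close> satisfies \<open>u = J w\<close> with \<open>u\<close> and \<open>w\<close> tangent to \<open>N\<close>, so it vanishes as \<open>N\<close> is
totally real; maximality makes the real dimensions equal.\<close>

lemma bij_l_map:
  fixes A :: "('a::{t2_space, second_countable_topology}, complex^'n) chart set" and B :: "('a, real^'m) chart set"
  assumes A: "smooth_atlas X A" and N: "submanifold A X B N" "maximally_totally_real A B N" and q: "q \<in> N"
  shows "linear (l_map A B q)" "bij (l_map A B q)"
proof -
  note lin = linear_incl_diff[OF A N(1) q]
  show l: "linear (l_map A B q)"
    by (rule linearI) (simp_all add: l_map_def J_def linear_add[OF lin] linear_scale[OF lin] vec.scale_right_distrib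
        scaleR_right_diff_distrib scaleR_eq_scalar_mult mult.commute)
  have inj: "inj (incl_diff A B q)" using N(1) q unfolding submanifold_def by blast
  have "\<zeta> = 0" if "l_map A B q \<zeta> = 0" for \<zeta>
  proof -
    have eq: "incl_diff A B q (fst \<zeta>) = J (incl_diff A B q (snd \<zeta>))" using that unfolding l_map_def by simp
    then have "incl_diff A B q (fst \<zeta>) \<in> range (incl_diff A B q) \<inter> J ` range (incl_diff A B q)" by (metis IntI imageI rangeI)
    then have 0: "incl_diff A B q (fst \<zeta>) = 0" using N(2) q unfolding maximally_totally_real_def by blast
    then have "incl_diff A B q (snd \<zeta>) = 0" using eq unfolding J_def by simp
    with 0 have "fst \<zeta> = 0" "snd \<zeta> = 0" using inj lin by (auto simp: linear_injective_0)
    then show ?thesis by (simp add: prod_eq_iff)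
  qed
  then have "inj (l_map A B q)" using l by (simp add: linear_injective_0)
  moreover have "DIM((real^'m) \<times> (real^'m)) = DIM(complex^'n)"
    using N(2) unfolding maximally_totally_real_def by simp
  ultimately show "bij (l_map A B q)" by (rule linear_inj_imp_bij[OF l])
qed

text \<open>The map \<open>l\<close> is complex linear for the structure \<open>-J\<close> on the target, that is, conjugate linear for \<open>J\<close>.\<close>

lemma l_map_cscale:
  assumes "linear (incl_diff A B q)"
  shows "l_map A B q (cscale z \<zeta>) = cnj z *s l_map A B q \<zeta>"
proof -
  have "l_map A B q (cscale z \<zeta>) = (Re z *\<^sub>R incl_diff A B q (fst \<zeta>) - Im z *\<^sub>R incl_diff A B q (snd \<zeta>))
     - \<i> *s (Re z *\<^sub>R incl_diff A B q (snd \<zeta>) + Im z *\<^sub>R incl_diff A B q (fst \<zeta>))"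
    unfolding l_map_def cscale_def J_def by (simp add: linear_add[OF assms] linear_diff[OF assms] linear_scale[OF assms])
  also have "\<dots> = cnj z *s l_map A B q \<zeta>"
    unfolding l_map_def J_def vec_eq_iff by (auto simp: complex_eq_iff algebra_simps)
  finally show ?thesis .
qed

text \<open>Let \<open>g\<close> be a first integral.  As \<open>dg\<close> is complex linear with kernel \<open>V\<close>, the condition
\<open>u - J w \<in> V\<close> reads \<open>dg u = i dg w\<close>, and \<open>T N \<inter> V = 0\<close> says that no nonzero vector tangent to \<open>N\<close> is in the
kernel of \<open>dg\<close>.\<close>

lemma P_bundle_local:
  fixes A :: "('a::{t2_space, second_countable_topology}, complex^'n) chart set" and B :: "('a, real^'m) chart set"
  assumes X: "complex_atlas X A" and N: "submanifold A X B N"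
    and E: "holomorphic_subbundle_T10 A X r E"
    and V: "real_involutive A X V" "\<forall>p\<in>X. part10 ` V p = E p" and p: "p \<in> N"
    and card: "CARD('n) \<le> CARD('k) + r"
  obtains U and g :: "'a \<Rightarrow> complex^'k" where "openin (top_of_set N) U" "p \<in> U" "smooth_in_charts B U g"
    "\<And>q. q \<in> U \<Longrightarrow> P_bundle A B V q = {\<zeta>. diff_at B g q (fst \<zeta>) = \<i> *s diff_at B g q (snd \<zeta>)}"
    "\<And>q. q \<in> U \<Longrightarrow> q \<in> G_set A B N V \<longleftrightarrow> inj (diff_at B g q)"
proof -
  have A: "smooth_atlas X A" by (rule complex_atlas_imp_smooth[OF X])
  have B: "smooth_atlas N B" and NX: "N \<subseteq> X" using N unfolding submanifold_def by auto
  obtain U and g :: "'a \<Rightarrow> complex^'k" where U: "openin (top_of_set X) U" "p \<in> U" and g: "smooth_in_charts A U g"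
    and dg: "\<And>q v. q \<in> U \<Longrightarrow> diff_at A g q (\<i> *s v) = \<i> *s diff_at A g q v"
      "\<And>q v. q \<in> U \<Longrightarrow> diff_at A g q v = 0 \<longleftrightarrow> v \<in> V q"
    using local_first_integral[OF X E V _ card, of p] p NX by blast
  note pb = submanifold_pullback[OF A N U(1) g]
  show thesis
  proof (rule that[OF pb(1) _ pb(2)])
    show "p \<in> U \<inter> N" using U p by simp
    fix q assume q: "q \<in> U \<inter> N"
    then have qU: "q \<in> U" "q \<in> N" by auto
    note lin = linear_incl_diff[OF A N qU(2)]
    note linA = linear_diff_at[OF A U(1) qU(1) g]
    have linB: "linear (diff_at B g q)" by (rule linear_diff_at[OF B pb(1) q pb(2)])
    show "P_bundle A B V q = {\<zeta>. diff_at B g q (fst \<zeta>) = \<i> *s diff_at B g q (snd \<zeta>)}"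
      unfolding P_bundle_def vimage_def dg(2)[OF qU(1), symmetric] l_map_def J_def pb(3)[OF q]
      by (simp add: linear_diff[OF linA] dg(1)[OF qU(1)])
    have inj: "inj (incl_diff A B q)" using N qU(2) unfolding submanifold_def by blast
    have "q \<in> G_set A B N V \<longleftrightarrow> (\<forall>u. incl_diff A B q u \<in> V q \<longrightarrow> incl_diff A B q u = 0)"
    proof -
      have "0 \<in> range (incl_diff A B q) \<inter> V q"
        using linear_0[OF lin] dg(2)[OF qU(1), of 0] linear_0[OF linA] by (metis IntI rangeI)
      then show ?thesis unfolding G_set_def using qU(2) by blast
    qed
    also have "\<dots> \<longleftrightarrow> (\<forall>u. diff_at B g q u = 0 \<longrightarrow> u = 0)"
      unfolding dg(2)[OF qU(1), symmetric] pb(3)[OF q] using inj lin linear_0[OF lin] by (metis linear_injective_0)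
    also have "\<dots> \<longleftrightarrow> inj (diff_at B g q)" using linB by (simp add: linear_injective_0)
    finally show "q \<in> G_set A B N V \<longleftrightarrow> inj (diff_at B g q)" .
  qed
qed

section \<open>Involutivity and rank of P\<close>

lemma complex_involutive_antiholomorphic_kernel:
  fixes B :: "('a::{t2_space, second_countable_topology}, 'e::euclidean_space) chart set"
  assumes B: "smooth_atlas N B"
    and loc: "\<And>p. p \<in> N \<Longrightarrow> \<exists>U (g :: 'a \<Rightarrow> complex^'k). openin (top_of_set N) U \<and> p \<in> U \<and> smooth_in_charts B U g \<and>
      (\<forall>q\<in>U. F q = {\<zeta>. diff_at B g q (fst \<zeta>) = \<i> *s diff_at B g q (snd \<zeta>)})"
  shows "complex_involutive B N F"
  unfolding complex_involutive_def
proof (intro allI impI ballI)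
  fix U Z W p
  assume U: "openin (top_of_set N) U" and Z: "smooth_complex_field B U Z" and W: "smooth_complex_field B U W"
    and F: "\<forall>p\<in>U. Z p \<in> F p \<and> W p \<in> F p" and p: "p \<in> U"
  have pN: "p \<in> N" using U p openin_imp_subset by blast
  obtain U1 and g :: "'a \<Rightarrow> complex^'k" where U1: "openin (top_of_set N) U1" "p \<in> U1" and g: "smooth_in_charts B U1 g"
    and Fq: "\<And>q. q \<in> U1 \<Longrightarrow> F q = {\<zeta>. diff_at B g q (fst \<zeta>) = \<i> *s diff_at B g q (snd \<zeta>)}"
    using loc[OF pN] by blast
  define d where "d = chart_at B p"
  have d: "d \<in> B" "p \<in> fst d" using chart_at_in[OF B pN] unfolding d_def by auto
  note cd = atlas_chart_on[OF B d(1)]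
  define S where "S = snd d ` ((U \<inter> U1) \<inter> fst d)"
  have S: "open S" "snd d p \<in> S"
    unfolding S_def using p U1 d by (auto intro!: open_chart_image[OF cd] openin_Int U)
  define f where "f = g \<circ> chart_inv d"
  have f: "smooth_on S f"
    unfolding S_def f_def by (rule smooth_on_subset[OF smooth_in_chartsD[OF g d(1)]]) auto
  have der: "(coord_rep B d \<zeta> has_derivative frechet_derivative (coord_rep B d \<zeta>) (at (snd d p))) (at (snd d p))"
    if "smooth_vector_field B U \<zeta>" for \<zeta>
    using that p d unfolding smooth_vector_field_def by (intro smooth_on_has_derivative[of "snd d ` (U \<inter> fst d)"]) auto
  note ZW = Z[unfolded smooth_complex_field_def, THEN conjunct1] Z[unfolded smooth_complex_field_def, THEN conjunct2]
    W[unfolded smooth_complex_field_def, THEN conjunct1] W[unfolded smooth_complex_field_def, THEN conjunct2]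
  have rel: "frechet_derivative f (at y) (coord_rep B d (fst \<circ> Y) y) = \<i> *s frechet_derivative f (at y) (coord_rep B d (snd \<circ> Y) y)"
    if y: "y \<in> S" and Y: "\<forall>q\<in>U. Y q \<in> F q" for y Y
  proof -
    obtain q where q: "q \<in> U" "q \<in> U1" "q \<in> fst d" "y = snd d q" using y unfolding S_def by blast
    have "diff_at B g q (fst (Y q)) = \<i> *s diff_at B g q (snd (Y q))" using Y q(1) Fq[OF q(2)] by auto
    then show ?thesis
      unfolding q(4) coord_rep_chart[OF B d(1) q(3)] f_def diff_at_in_chart[OF B d(1) U1(1) q(2,3) g] by simp
  qed
  have at: "coord_rep B d \<zeta> (snd d p) = \<zeta> p" for \<zeta>
    unfolding coord_rep_chart[OF B d] using to_chart_at[OF B pN] unfolding d_def by simp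
  have FZ: "\<forall>q\<in>U. Z q \<in> F q" and FW: "\<forall>q\<in>U. W q \<in> F q" using F by auto
  have dgf: "diff_at B g p = frechet_derivative f (at (snd d p))" unfolding diff_at_def f_def d_def ..
  show "complex_lie_bracket B Z W p \<in> F p"
    unfolding Fq[OF U1(2)] complex_lie_bracket_def lie_bracket_def Let_def d_def[symmetric] dgf mem_Collect_eq fst_conv snd_conv
    using bracket_antiholomorphic_kernel[OF S f der[OF ZW(1)] der[OF ZW(2)] der[OF ZW(3)] der[OF ZW(4)]
        rel[OF _ FZ] rel[OF _ FW]] unfolding at .
qed

lemma complex_subbundle_open_subset:
  assumes F: "complex_subbundle B N r F" and G: "openin (top_of_set N) G"
  shows "complex_subbundle B G r F"
  unfolding complex_subbundle_def locally_framed_def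
proof
  fix p assume p: "p \<in> G"
  then have "p \<in> N" using G openin_imp_subset by blast
  then obtain U s where U: "openin (top_of_set N) U \<and> p \<in> U \<and> (\<forall>i<r. smooth_complex_field B U (s i)) \<and>
      (\<forall>q\<in>U. is_frame cscale r (\<lambda>i. s i q) (F q))"
    using bspec[OF F[unfolded complex_subbundle_def locally_framed_def], of p] by blast
  have "openin (top_of_set G) (U \<inter> G)"
    using U G by (meson openin_Int openin_imp_subset openin_subset_trans inf_le2)
  moreover have "smooth_complex_field B (U \<inter> G) (s i)" if "i < r" for i
    using U that unfolding smooth_complex_field_def by (meson inf_le1 smooth_vector_field_subset)
  ultimately show "\<exists>U s. openin (top_of_set G) U \<and> p \<in> U \<and> (\<forall>i<r. smooth_complex_field B U (s i)) \<and>
      (\<forall>q\<in>U. is_frame cscale r (\<lambda>i. s i q) (F q))"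
    using U p by (intro exI[of _ "U \<inter> G"] exI[of _ s]) auto
qed

lemma complex_involutive_open_subset:
  assumes "complex_involutive B N F" "openin (top_of_set N) G"
  shows "complex_involutive B G F"
  using assms openin_trans unfolding complex_involutive_def by blast

text \<open>The preimages \<open>s\<^sub>i\<close> under \<open>l\<close> of a frame \<open>\<xi>\<^sub>i\<close> of \<open>V\<close> form a frame of \<open>P\<close>, with conjugate coefficients because \<open>l\<close>
is conjugate linear.  In charts of \<open>N\<close> and \<open>X\<close> the map \<open>l\<close> becomes \<open>(u, w) \<mapsto> D\<tau> u - i D\<tau> w\<close>, where \<open>\<tau>\<close> is
the inclusion, and smoothness of the \<open>s\<^sub>i\<close> is that of the inverse of a smooth family of linear maps.\<close>

lemma complex_subbundle_P_bundle:
  fixes A :: "('a::{t2_space, second_countable_topology}, complex^'n) chart set" and B :: "('a, real^'m) chart set"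
  assumes X: "complex_atlas X A" and N: "submanifold A X B N" "maximally_totally_real A B N"
    and E: "holomorphic_subbundle_T10 A X r E" and V: "\<forall>p\<in>X. part10 ` V p = E p"
  shows "complex_subbundle B N r (P_bundle A B V)"
  unfolding complex_subbundle_def locally_framed_def
proof
  have A: "smooth_atlas X A" by (rule complex_atlas_imp_smooth[OF X])
  have B: "smooth_atlas N B" and NX: "N \<subseteq> X" using N unfolding submanifold_def by auto
  fix p assume p: "p \<in> N"
  obtain U0 \<xi> where U0: "openin (top_of_set X) U0" "p \<in> U0"
    and \<xi>: "\<And>i c. i < r \<Longrightarrow> c \<in> A \<Longrightarrow> holomorphic_map_on (snd c ` (U0 \<inter> fst c)) (coord_rep A c (\<xi> i))"
    and Vq: "\<And>q. q \<in> U0 \<Longrightarrow> V q = {\<Sum>i<r. a i *s \<xi> i q | a. True}"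
    and ind: "\<And>q a. q \<in> U0 \<Longrightarrow> (\<Sum>i<r. a i *s \<xi> i q) = 0 \<Longrightarrow> \<forall>i<r. a i = 0"
    using holomorphic_frame[OF E V, of p] p NX by blast
  define s where "s i q = inv (l_map A B q) (\<xi> i q)" for i q
  note bl = bij_l_map[OF A N]
  have ls: "l_map A B q (s i q) = \<xi> i q" if "q \<in> N" for i q
    unfolding s_def using bl(2)[OF that] by (simp add: bij_is_surj surj_f_inv_f)
  have opN: "openin (top_of_set N) (U \<inter> N)" if "openin (top_of_set X) U" for U
    by (rule openin_restrict[OF that NX])
  define U where "U = U0 \<inter> N"
  have U: "openin (top_of_set N) U" "p \<in> U" "U \<subseteq> N" unfolding U_def using opN[OF U0(1)] U0(2) p by auto
  have local: "\<exists>d U'. d \<in> B \<and> openin (top_of_set N) U' \<and> p' \<in> U' \<and> U' \<subseteq> fst d \<and>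
      smooth_on (snd d ` U') (coord_rep B d (fst \<circ> s i)) \<and> smooth_on (snd d ` U') (coord_rep B d (snd \<circ> s i))"
    if p': "p' \<in> U" and i: "i < r" for p' i
  proof -
    define c d where cd: "c = chart_at A p'" "d = chart_at B p'"
    have p'N: "p' \<in> N" "p' \<in> X" using p' U(3) NX by auto
    have c: "c \<in> A" "p' \<in> fst c" and d: "d \<in> B" "p' \<in> fst d"
      using chart_at_in[OF A p'N(2)] chart_at_in[OF B p'N(1)] unfolding cd by auto
    note cc = atlas_chart_on[OF A c(1)] and ccd = atlas_chart_on[OF B d(1)]
    define U' where "U' = (U0 \<inter> fst c) \<inter> N \<inter> fst d"
    have U': "openin (top_of_set N) U'"
      unfolding U'_def by (intro openin_Int opN U0 chart_onD(1)[OF cc] chart_onD(1)[OF ccd])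
    have U'd: "U' \<subseteq> fst d" "p' \<in> U'" unfolding U'_def using p' c d unfolding U_def by auto
    have opU': "open (snd d ` U')" using open_chart_image[OF ccd U'] U'd by (simp add: inf.absorb1)
    define \<tau> where "\<tau> = snd c \<circ> chart_inv d"
    have \<tau>: "smooth_on (snd d ` U') \<tau>"
      unfolding \<tau>_def by (rule smooth_on_subset[OF submanifold_inclusion_smooth[OF N(1) d(1) c(1)]]) (auto simp: U'_def)
    define L where "L x \<zeta> = frechet_derivative \<tau> (at x) (fst \<zeta>) - \<i> *s frechet_derivative \<tau> (at x) (snd \<zeta>)" for x and \<zeta> :: "(real^'m) \<times> (real^'m)"
    note pb = submanifold_pullback[OF A N(1) chart_onD(1)[OF cc] smooth_in_charts_chart[OF A c(1)]]
    have D\<tau>: "frechet_derivative \<tau> (at (snd d q)) (to_chart B d q u) = to_chart A c q (incl_diff A B q u)" if q: "q \<in> U'" for q u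
      using diff_at_in_chart[OF B d(1) pb(1) _ _ pb(2), of q u] pb(3)[of q u] q unfolding \<tau>_def U'_def by auto
    have Lrel: "L (snd d q) (to_chart B d q u, to_chart B d q w) = to_chart A c q (l_map A B q (u, w))" if q: "q \<in> U'" for q u w
    proof -
      have qc: "q \<in> fst c" using q unfolding U'_def by blast
      show ?thesis unfolding L_def l_map_def fst_conv snd_conv D\<tau>[OF q] J_def
        by (simp add: linear_diff[OF linear_to_chart[OF A c(1) qc]] to_chart_complex_linear[OF X c(1) qc])
    qed
    have linL: "linear (L x)" if "x \<in> snd d ` U'" for x
    proof -
      note lin = smooth_on_linear_frechet[OF \<tau> that]
      show ?thesis
        by (rule linearI) (simp_all add: L_def linear_add[OF lin] linear_scale[OF lin] vec.scale_right_distrib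
        scaleR_right_diff_distrib scaleR_eq_scalar_mult mult.commute)
    qed
    have bijL: "bij (L x)" if x: "x \<in> snd d ` U'" for x
    proof (rule linear_inj_imp_bij[OF linL[OF x]])
      obtain q where q: "q \<in> U'" "x = snd d q" using x by blast
      have qc: "q \<in> fst c" "q \<in> fst d" "q \<in> N" using q unfolding U'_def by auto
      have "\<zeta> = 0" if z: "L x \<zeta> = 0" for \<zeta>
      proof -
        obtain u w where uw: "fst \<zeta> = to_chart B d q u" "snd \<zeta> = to_chart B d q w"
          using bij_to_chart[OF B d(1) qc(2)] by (metis bij_pointE)
        then have "\<zeta> = (to_chart B d q u, to_chart B d q w)" by (simp add: prod_eq_iff)
        then have "to_chart A c q (l_map A B q (u, w)) = 0" using z Lrel[OF q(1)] q(2) by simp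
        then have "l_map A B q (u, w) = 0"
          using inj_to_chart[OF A c(1) qc(1)] linear_to_chart[OF A c(1) qc(1)] by (simp add: linear_injective_0)
        then have "(u, w) = 0" using bl[OF qc(3)] by (simp add: bij_def linear_injective_0)
        then show ?thesis using uw linear_0[OF linear_to_chart[OF B d(1) qc(2)]] by (simp add: prod_eq_iff)
      qed
      then show "inj (L x)" using linL[OF x] by (simp add: linear_injective_0)
      show "DIM((real^'m) \<times> (real^'m)) = DIM(complex^'n)"
        using N(2) unfolding maximally_totally_real_def by simp
    qed
    define K where "K x = inv (L x)" for x
    have KL: "K x (L x v) = v" and LK: "L x (K x w) = w" if "x \<in> snd d ` U'" for x v w
      using bijL[OF that] unfolding K_def by (auto simp: bij_is_inj surj_f_inv_f bij_is_surj)
    have smL: "smooth_on (snd d ` U') (\<lambda>x. L x \<zeta>)" for \<zeta>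
    proof -
      have "smooth_on (snd d ` U') (\<lambda>x. frechet_derivative \<tau> (at x) (fst \<zeta>) + (- \<i>) *s frechet_derivative \<tau> (at x) (snd \<zeta>))"
        by (intro smooth_on_add opU' smooth_on_directional \<tau> smooth_on_linear[OF bounded_linear_scalar_mult_right])
      then show ?thesis unfolding L_def by simp
    qed
    (* In charts the frame field s i is the solution of L = rhs. *)
    define rhs where "rhs x = coord_rep A c (\<xi> i) (\<tau> x)" for x
    have smr: "smooth_on (snd d ` U') rhs"
      unfolding rhs_def
    proof (rule smooth_on_compose[OF opU' open_chart_image[OF cc U0(1)] \<tau> holomorphic_map_onD(1)[OF \<xi>[OF i c(1)]]])
      show "\<tau> ` snd d ` U' \<subseteq> snd c ` (U0 \<inter> fst c)"
        unfolding \<tau>_def U'_def using chart_onD(5)[OF ccd] by auto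
    qed
    have smK: "smooth_on (snd d ` U') (\<lambda>x. K x (rhs x))"
      by (rule smooth_on_inverse_family[OF opU' linL KL LK smL smr])
    have eq: "K x (rhs x) = (coord_rep B d (fst \<circ> s i) x, coord_rep B d (snd \<circ> s i) x)" if x: "x \<in> snd d ` U'" for x
    proof -
      obtain q where q: "q \<in> U'" "x = snd d q" using x by blast
      have qc: "q \<in> fst c" "q \<in> fst d" "q \<in> N" using q unfolding U'_def by auto
      have "\<tau> x = snd c q" unfolding \<tau>_def q(2) using chart_onD(5)[OF ccd qc(2)] by simp
      then have "rhs x = to_chart A c q (l_map A B q (s i q))"
        unfolding rhs_def ls[OF qc(3)] by (simp add: coord_rep_chart[OF A c(1) qc(1)])
      also have "\<dots> = L x (to_chart B d q (fst (s i q)), to_chart B d q (snd (s i q)))"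
        unfolding q(2) Lrel[OF q(1)] by simp
      finally have "K x (rhs x) = (to_chart B d q (fst (s i q)), to_chart B d q (snd (s i q)))" using KL[OF x] by simp
      then show ?thesis unfolding q(2) coord_rep_chart[OF B d(1) qc(2)] by simp
    qed
    have "smooth_on (snd d ` U') (coord_rep B d (fst \<circ> s i))"
      by (rule smooth_on_cong[OF opU' _ smooth_on_linear[OF bounded_linear_fst opU' smK]]) (simp add: eq)
    moreover have "smooth_on (snd d ` U') (coord_rep B d (snd \<circ> s i))"
      by (rule smooth_on_cong[OF opU' _ smooth_on_linear[OF bounded_linear_snd opU' smK]]) (simp add: eq)
    ultimately show ?thesis using d(1) U' U'd by blast
  qed
  have sec: "smooth_complex_field B U (s i)" if i: "i < r" for i
    unfolding smooth_complex_field_def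
  proof (intro conjI)
    show "smooth_vector_field B U (fst \<circ> s i)"
      by (rule smooth_vector_field_local[OF B U(3)], drule local[OF _ i], elim exE conjE)
         (intro exI conjI, assumption+)
    show "smooth_vector_field B U (snd \<circ> s i)"
      by (rule smooth_vector_field_local[OF B U(3)], drule local[OF _ i], elim exE conjE)
         (intro exI conjI, assumption+)
  qed
  have frame: "is_frame cscale r (\<lambda>i. s i q) (P_bundle A B V q)" if q: "q \<in> U" for q
  proof -
    have qN: "q \<in> N" "q \<in> U0" using q unfolding U_def by auto
    note lin = bl(1)[OF qN(1)]
    have lsum: "l_map A B q (\<Sum>i<r. cscale (a i) (s i q)) = (\<Sum>i<r. cnj (a i) *s \<xi> i q)" for a
      unfolding linear_sum[OF lin] l_map_cscale[OF linear_incl_diff[OF A N(1) qN(1)]] ls[OF qN(1)] ..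
    show ?thesis unfolding is_frame_def
    proof (intro conjI allI impI)
      show "P_bundle A B V q = {\<Sum>i<r. cscale (a i) (s i q) | a. True}"
      proof (intro set_eqI iffI)
        fix \<zeta> assume "\<zeta> \<in> P_bundle A B V q"
        then obtain a where "l_map A B q \<zeta> = (\<Sum>i<r. a i *s \<xi> i q)" unfolding P_bundle_def Vq[OF qN(2)] by auto
        then have "l_map A B q \<zeta> = l_map A B q (\<Sum>i<r. cscale (cnj (a i)) (s i q))" unfolding lsum by simp
        then have "\<zeta> = (\<Sum>i<r. cscale (cnj (a i)) (s i q))" using bl(2)[OF qN(1)] by (meson bij_is_inj injD)
        then show "\<zeta> \<in> {\<Sum>i<r. cscale (a i) (s i q) | a. True}"
          by (intro CollectI exI[of _ "\<lambda>i. cnj (a i)"]) simp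
      next
        fix \<zeta> assume "\<zeta> \<in> {\<Sum>i<r. cscale (a i) (s i q) | a. True}"
        then obtain a where "\<zeta> = (\<Sum>i<r. cscale (a i) (s i q))" by blast
        then show "\<zeta> \<in> P_bundle A B V q" unfolding P_bundle_def Vq[OF qN(2)] using lsum by auto
      qed
      fix a i assume "(\<Sum>i<r. cscale (a i) (s i q)) = 0" "i < r"
      then have "(\<Sum>i<r. cnj (a i) *s \<xi> i q) = 0" using lsum[of a] linear_0[OF lin] by simp
      from ind[OF qN(2) this] \<open>i < r\<close> show "a i = 0" by simp
    qed
  qed
  show "\<exists>U s. openin (top_of_set N) U \<and> p \<in> U \<and> (\<forall>i<r. smooth_complex_field B U (s i)) \<and>
        (\<forall>q\<in>U. is_frame cscale r (\<lambda>i. s i q) (P_bundle A B V q))"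
    using U sec frame by blast
qed

section \<open>Complex structures from local first integrals\<close>

text \<open>The last condition says that the differential of the chart sends exactly the vectors of \<open>F\<close> to type
\<open>(1,0)\<close>, compare \<open>T10_iff\<close>.  A pair \<open>(u, w)\<close> stands for \<open>u + i w\<close>.\<close>

definition adapted_chart ::
    "('a::topological_space, 'e::euclidean_space) chart set \<Rightarrow> 'a set \<Rightarrow> ('a \<Rightarrow> ('e \<times> 'e) set) \<Rightarrow>
     ('a, complex^'k) chart \<Rightarrow> bool" where
  "adapted_chart B G F c \<longleftrightarrow> chart_on G c \<and> smooth_in_charts B (fst c) (snd c) \<and>
     (\<forall>b\<in>B. smooth_on (snd c ` (fst c \<inter> fst b)) (snd b \<circ> chart_inv c)) \<and>
     (\<forall>q\<in>fst c. inj (diff_at B (snd c) q) \<and>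
        F q = {\<zeta>. diff_at B (snd c) q (fst \<zeta>) = \<i> *s diff_at B (snd c) q (snd \<zeta>)})"

text \<open>The derivative of \<open>g\<close> is injective on \<open>G\<close>, hence bijective for reasons of dimension, and the inverse
function theorem makes \<open>g\<close> itself a chart on a small open set.\<close>

lemma adapted_chart_exists:
  fixes B :: "('a::{t2_space, second_countable_topology}, 'e::euclidean_space) chart set"
    and g :: "'a \<Rightarrow> complex^'k"
  assumes B: "smooth_atlas N B" and G: "openin (top_of_set N) G" and dim: "DIM('e) = DIM(complex^'k)"
    and U: "openin (top_of_set N) U" "p \<in> U" and g: "smooth_in_charts B U g"
    and F: "\<And>q. q \<in> U \<Longrightarrow> F q = {\<zeta>. diff_at B g q (fst \<zeta>) = \<i> *s diff_at B g q (snd \<zeta>)}"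
    and inj: "\<And>q. q \<in> U \<Longrightarrow> q \<in> G \<Longrightarrow> inj (diff_at B g q)" and p: "p \<in> G"
  shows "\<exists>c :: ('a, complex^'k) chart. adapted_chart B G F c \<and> p \<in> fst c"
proof -
  have pN: "p \<in> N" using G p openin_imp_subset by blast
  define d where "d = chart_at B p"
  have d: "d \<in> B" "p \<in> fst d" using chart_at_in[OF B pN] unfolding d_def by auto
  note cd = atlas_chart_on[OF B d(1)]
  define U2 where "U2 = (U \<inter> G) \<inter> fst d"
  define S where "S = snd d ` U2"
  have S: "open S" "snd d p \<in> S"
    unfolding S_def U2_def using U p d by (auto intro!: open_chart_image[OF cd] openin_Int G)
  define f where "f = g \<circ> chart_inv d"
  have f: "smooth_on S f"
    unfolding S_def U2_def f_def by (rule smooth_on_subset[OF smooth_in_chartsD[OF g d(1)]]) auto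
  have injS: "inj (frechet_derivative f (at x))" if x: "x \<in> S" for x
  proof -
    obtain q where q: "q \<in> U" "q \<in> G" "q \<in> fst d" "x = snd d q" using x unfolding S_def U2_def by blast
    have "frechet_derivative f (at x) \<circ> to_chart B d q = diff_at B g q"
      unfolding f_def q(4) comp_def[of "frechet_derivative _ _"] using diff_at_in_chart[OF B d(1) U(1) q(1,3) g] by auto
    then have "inj (frechet_derivative f (at x) \<circ> to_chart B d q)" using inj[OF q(1,2)] by simp
    then show ?thesis using bij_to_chart[OF B d(1) q(3)] by (metis bij_is_surj inj_on_imageI)
  qed
  obtain U1 V1 h where U1: "open U1" "U1 \<subseteq> S" "snd d p \<in> U1" and V1: "open V1" "homeomorphism U1 V1 f h"
    and h: "smooth_on V1 h"
  proof (rule smooth_inverse_function[OF S f injS[OF S(2)] dim])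
    show "inj (frechet_derivative f (at x))" if "x \<in> S" for x using that by (rule injS)
    fix U1 V1 h assume "open U1" "U1 \<subseteq> S" "snd d p \<in> U1" "open V1" "homeomorphism U1 V1 f h" "smooth_on V1 h"
    then show thesis by (rule that)
  qed
  define D1 where "D1 = {q \<in> fst d. snd d q \<in> U1}"
  have D1: "openin (top_of_set N) D1" unfolding D1_def by (rule openin_chart_preimage[OF cd U1(1)])
  have D1U: "D1 \<subseteq> U2"
  proof
    fix q assume "q \<in> D1"
    then have q: "q \<in> fst d" "snd d q \<in> U1" unfolding D1_def by auto
    have "q \<in> U \<inter> G"
      by (rule chart_image_mem[OF cd q(1)]) (use subsetD[OF U1(2) q(2)] in \<open>simp add: S_def U2_def\<close>)
    then show "q \<in> U2" using q(1) unfolding U2_def by blast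
  qed
  have dD1: "snd d q \<in> U1" "chart_inv d (snd d q) = q" if "q \<in> D1" for q
    using that chart_onD(5)[OF cd] unfolding D1_def by auto
  have gf: "g q = f (snd d q)" if "q \<in> D1" for q unfolding f_def using dD1(2)[OF that] by simp
  have hV: "h y \<in> U1" "f (h y) = y" if "y \<in> V1" for y using V1(2) that unfolding homeomorphism_def by auto
  have fU: "f x \<in> V1" "h (f x) = x" if "x \<in> U1" for x using V1(2) that unfolding homeomorphism_def by auto
  have hdom: "h y \<in> snd d ` fst d" if "y \<in> V1" for y
    using subsetD[OF U1(2) hV(1)[OF that]] unfolding S_def U2_def by blast
  define k where "k y = chart_inv d (h y)" for y
  have k: "k y \<in> D1" "g (k y) = y" if "y \<in> V1" for y
  proof -
    note hy = hdom[OF that]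
    then show kD: "k y \<in> D1" unfolding D1_def k_def using chart_onD(6,7)[OF cd] hV(1)[OF that] by auto
    show "g (k y) = y" unfolding gf[OF kD] unfolding k_def chart_onD(6)[OF cd hy] by (rule hV(2)[OF that])
  qed
  have kg: "k (g q) = q" if "q \<in> D1" for q
    unfolding gf[OF that] k_def fU(2)[OF dD1(1)[OF that]] by (rule dD1(2)[OF that])
  have gV: "g q \<in> V1" if "q \<in> D1" for q unfolding gf[OF that] by (rule fU(1)[OF dD1(1)[OF that]])
  have gD1: "g ` D1 = V1" using gV k by force
  have injg: "inj_on g D1" using kg by (rule inj_on_inverseI)
  define c where "c = (D1, g)"
  have cc: "fst c = D1" "snd c = g" unfolding c_def by auto
  have ci: "chart_inv c y = k y" if "y \<in> V1" for y
    unfolding cc by (rule inv_into_f_eq[OF injg k[OF that]])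
  have contg: "continuous_on D1 g"
  proof -
    have "continuous_on D1 (\<lambda>q. f (snd d q))"
      by (rule continuous_on_compose2[OF homeomorphism_cont1[OF V1(2)] continuous_on_subset[OF chart_onD(3)[OF cd]]])
         (auto simp: D1_def)
    then show ?thesis by (rule continuous_on_eq) (simp add: gf)
  qed
  have contk: "continuous_on V1 k"
    unfolding k_def
    by (rule continuous_on_compose2[OF chart_onD(4)[OF cd] homeomorphism_cont2[OF V1(2)]])
       (use hdom in blast)
  have chart: "chart_on G c"
    unfolding chart_on_def
  proof (intro conjI)
    show "openin (top_of_set G) (fst c)"
      unfolding cc by (rule openin_subset_trans[OF D1]) (use D1U G openin_imp_subset in \<open>auto simp: U2_def\<close>)
    show "open (snd c ` fst c)" unfolding cc gD1 by (rule V1(1))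
    have "homeomorphism D1 V1 g k" by (rule homeomorphismI[OF contg contk]) (use gD1 k kg in auto)
    then show "homeomorphism (fst c) (snd c ` fst c) (snd c) (chart_inv c)"
      unfolding cc(1,2) gD1 by (rule homeomorphism_cong) (use ci cc in auto)
  qed
  have inv: "smooth_on (snd c ` (fst c \<inter> fst b)) (snd b \<circ> chart_inv c)" if b: "b \<in> B" for b
  proof -
    note cb = atlas_chart_on[OF B b]
    have "openin (top_of_set G) (G \<inter> fst b)"
      by (rule openin_subset_trans[OF openin_Int[OF G chart_onD(1)[OF cb]]]) (use G openin_imp_subset in auto)
    from open_chart_image[OF chart this]
    have op: "open (g ` (D1 \<inter> fst b))"
      using chart_onD(8)[OF chart] unfolding cc by (metis Int_assoc Int_commute inf.absorb2)
    have "smooth_on (g ` (D1 \<inter> fst b)) (\<lambda>y. (snd b \<circ> chart_inv d) (h y))"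
    proof (rule smooth_on_compose[OF op _ _ smooth_transition[OF B d(1) b]])
      show "open (snd d ` (fst b \<inter> fst d))" by (rule open_chart_image[OF cd chart_onD(1)[OF cb]])
      show "smooth_on (g ` (D1 \<inter> fst b)) h" by (rule smooth_on_subset[OF h]) (use gV in auto)
      show "h ` g ` (D1 \<inter> fst b) \<subseteq> snd d ` (fst b \<inter> fst d)"
      proof safe
        fix q assume q: "q \<in> D1" "q \<in> fst b"
        then have "h (g q) = snd d q" unfolding gf[OF q(1)] using fU(2) dD1(1) by blast
        then show "h (g q) \<in> snd d ` (fst b \<inter> fst d)" using q unfolding D1_def by blast
      qed
    qed
    then have "smooth_on (g ` (D1 \<inter> fst b)) (snd b \<circ> chart_inv c)"
      by (rule smooth_on_cong[OF op, rotated]) (use gV ci in \<open>auto simp: k_def\<close>)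
    then show ?thesis unfolding cc .
  qed
  have "adapted_chart B G F c"
    unfolding adapted_chart_def
  proof (intro conjI chart ballI inv)
    show "smooth_in_charts B (fst c) (snd c)"
      unfolding cc by (rule smooth_in_charts_subset[OF g]) (use D1U in \<open>auto simp: U2_def\<close>)
    fix q assume "q \<in> fst c"
    then have q: "q \<in> U" "q \<in> G" using D1U unfolding cc U2_def by auto
    show "inj (diff_at B (snd c) q)" unfolding cc by (rule inj[OF q])
    show "F q = {\<zeta>. diff_at B (snd c) q (fst \<zeta>) = \<i> *s diff_at B (snd c) q (snd \<zeta>)}" unfolding cc by (rule F[OF q(1)])
  qed
  moreover have "p \<in> fst c" unfolding cc D1_def using d(2) U1(3) by simp
  ultimately show ?thesis by blast
qed

text \<open>The transition map carries \<open>dc v\<close> to \<open>de v\<close>.  Given \<open>v\<close>, choose \<open>u\<close> and \<open>w\<close> tangent to the manifold with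
\<open>dc u = i v\<close> and \<open>dc w = v\<close>.  Then \<open>u + i w\<close> lies in \<open>F\<close>, and \<open>F\<close> is described in the same way by the
chart \<open>e\<close>, whence \<open>de u = i de w\<close>.\<close>

lemma adapted_transition_holomorphic:
  fixes B :: "('a::{t2_space, second_countable_topology}, 'e::euclidean_space) chart set"
    and c e :: "('a, complex^'k) chart"
  assumes B: "smooth_atlas N B" and G: "openin (top_of_set N) G" and dim: "DIM('e) = DIM(complex^'k)"
    and c: "adapted_chart B G F c" and e: "adapted_chart B G F e"
  shows "holomorphic_map_on (snd c ` (fst c \<inter> fst e)) (snd e \<circ> chart_inv c)"
proof -
  note cc = c[unfolded adapted_chart_def, THEN conjunct1] and ce = e[unfolded adapted_chart_def, THEN conjunct1]
  have sc: "smooth_in_charts B (fst c) (snd c)" "\<And>b. b \<in> B \<Longrightarrow> smooth_on (snd c ` (fst c \<inter> fst b)) (snd b \<circ> chart_inv c)"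
    "\<And>q. q \<in> fst c \<Longrightarrow> inj (diff_at B (snd c) q)"
    "\<And>q. q \<in> fst c \<Longrightarrow> F q = {\<zeta>. diff_at B (snd c) q (fst \<zeta>) = \<i> *s diff_at B (snd c) q (snd \<zeta>)}"
    using c unfolding adapted_chart_def by blast+
  have se: "smooth_in_charts B (fst e) (snd e)"
    "\<And>q. q \<in> fst e \<Longrightarrow> F q = {\<zeta>. diff_at B (snd e) q (fst \<zeta>) = \<i> *s diff_at B (snd e) q (snd \<zeta>)}"
    using e unfolding adapted_chart_def by blast+
  have GN: "G \<subseteq> N" using G openin_imp_subset by blast
  have opN: "openin (top_of_set N) (fst c)" "openin (top_of_set N) (fst e)"
    using openin_trans[OF chart_onD(1)[OF cc] G] openin_trans[OF chart_onD(1)[OF ce] G] by auto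
  define S where "S = snd c ` (fst c \<inter> fst e)"
  define \<tau> where "\<tau> = snd e \<circ> chart_inv c"
  have S: "open S" unfolding S_def using open_chart_image[OF cc chart_onD(1)[OF ce]] by (simp add: Int_commute)
  have sm: "smooth_on S \<tau>"
  proof (rule smooth_on_local)
    fix x assume "x \<in> S"
    then obtain q where q: "q \<in> fst c" "q \<in> fst e" "x = snd c q" unfolding S_def by blast
    have qN: "q \<in> N" using q(1) chart_onD(8)[OF cc] GN by blast
    define b where "b = chart_at B q"
    have b: "b \<in> B" "q \<in> fst b" using chart_at_in[OF B qN] unfolding b_def by auto
    note cb = atlas_chart_on[OF B b(1)]
    define T where "T = snd c ` ((fst e \<inter> (G \<inter> fst b)) \<inter> fst c)"
    have "openin (top_of_set G) (G \<inter> fst b)"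
      by (rule openin_subset_trans[OF openin_Int[OF G chart_onD(1)[OF cb]]]) (use GN in auto)
    from open_chart_image[OF cc openin_Int[OF chart_onD(1)[OF ce] this]]
    have T: "open T" unfolding T_def .
    have "smooth_on T (\<lambda>x. (snd e \<circ> chart_inv b) ((snd b \<circ> chart_inv c) x))"
    proof (rule smooth_on_compose[OF T _ _ smooth_in_chartsD[OF se(1) b(1)]])
      show "open (snd b ` (fst e \<inter> fst b))" by (rule open_chart_image[OF cb opN(2)])
      show "smooth_on T (snd b \<circ> chart_inv c)" by (rule smooth_on_subset[OF sc(2)[OF b(1)]]) (auto simp: T_def)
      show "(snd b \<circ> chart_inv c) ` T \<subseteq> snd b ` (fst e \<inter> fst b)" unfolding T_def using chart_onD(5)[OF cc] by auto
    qed
    then have "smooth_on T \<tau>"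
      by (rule smooth_on_cong[OF T, rotated]) (auto simp: T_def \<tau>_def chart_onD(5)[OF cc] chart_onD(5)[OF cb])
    moreover have "x \<in> T" unfolding T_def using q b chart_onD(8)[OF cc] by auto
    ultimately show "\<exists>T. open T \<and> x \<in> T \<and> smooth_on T \<tau>" using T by blast
  qed
  have "frechet_derivative \<tau> (at x) (\<i> *s v) = \<i> *s frechet_derivative \<tau> (at x) v" if x: "x \<in> S" for x v
  proof -
    obtain q where q: "q \<in> fst c" "q \<in> fst e" "x = snd c q" using x unfolding S_def by blast
    have qN: "q \<in> N" using q(1) chart_onD(8)[OF cc] GN by blast
    define b where "b = chart_at B q"
    have b: "b \<in> B" "q \<in> fst b" using chart_at_in[OF B qN] unfolding b_def by auto
    note cb = atlas_chart_on[OF B b(1)]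
    let ?bq = "snd b q"
    have chain: "frechet_derivative \<tau> (at x) (diff_at B (snd c) q w) = diff_at B (snd e) q w" for w
    proof -
      have bq: "(snd c \<circ> chart_inv b) ?bq = x" using chart_onD(5)[OF cb b(2)] q(3) by simp
      have dc: "((snd c \<circ> chart_inv b) has_derivative diff_at B (snd c) q) (at ?bq)"
        unfolding b_def by (rule diff_at_has_derivative[OF B opN(1) q(1) sc(1)])
      have "(\<tau> has_derivative frechet_derivative \<tau> (at x)) (at ((snd c \<circ> chart_inv b) ?bq))"
        unfolding bq by (rule smooth_on_has_derivative[OF sm x])
      from has_derivative_compose[OF dc this]
      have "((\<lambda>y. \<tau> ((snd c \<circ> chart_inv b) y)) has_derivative (\<lambda>w. frechet_derivative \<tau> (at x) (diff_at B (snd c) q w))) (at ?bq)" .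
      then have "((snd e \<circ> chart_inv b) has_derivative (\<lambda>w. frechet_derivative \<tau> (at x) (diff_at B (snd c) q w))) (at ?bq)"
      proof (rule has_derivative_transform_within_open)
        show "open (snd b ` ((fst c \<inter> fst e) \<inter> fst b))" by (intro open_chart_image[OF cb] openin_Int opN)
        show "?bq \<in> snd b ` ((fst c \<inter> fst e) \<inter> fst b)" using q b by blast
        show "\<tau> ((snd c \<circ> chart_inv b) y) = (snd e \<circ> chart_inv b) y" if "y \<in> snd b ` ((fst c \<inter> fst e) \<inter> fst b)" for y
          using that chart_onD(5)[OF cb] chart_onD(5)[OF cc] unfolding \<tau>_def by auto
      qed
      moreover have "((snd e \<circ> chart_inv b) has_derivative diff_at B (snd e) q) (at ?bq)"
        unfolding b_def by (rule diff_at_has_derivative[OF B opN(2) q(2) se(1)])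
      ultimately have "(\<lambda>w. frechet_derivative \<tau> (at x) (diff_at B (snd c) q w)) = diff_at B (snd e) q"
        by (rule has_derivative_unique)
      then show ?thesis by metis
    qed
    have "bij (diff_at B (snd c) q)"
      by (rule linear_inj_imp_bij[OF linear_diff_at[OF B opN(1) q(1) sc(1)] sc(3)[OF q(1)] dim])
    then obtain u w where uw: "diff_at B (snd c) q u = \<i> *s v" "diff_at B (snd c) q w = v" by (metis bij_pointE)
    then have "(u, w) \<in> F q" unfolding sc(4)[OF q(1)] by simp
    then have "diff_at B (snd e) q u = \<i> *s diff_at B (snd e) q w" unfolding se(2)[OF q(2)] by simp
    then show ?thesis unfolding chain[symmetric] uw .
  qed
  then show ?thesis using sm unfolding holomorphic_map_on_def S_def[symmetric] \<tau>_def[symmetric] by blast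
qed

lemma complex_structure_of_local_kernel:
  fixes B :: "('a::{t2_space, second_countable_topology}, 'e::euclidean_space) chart set"
  assumes B: "smooth_atlas N B" and G: "openin (top_of_set N) G" and dim: "DIM('e) = DIM(complex^'k)"
    and loc: "\<And>p. p \<in> G \<Longrightarrow> \<exists>U (g :: 'a \<Rightarrow> complex^'k). openin (top_of_set N) U \<and> p \<in> U \<and> smooth_in_charts B U g \<and>
      (\<forall>q\<in>U. F q = {\<zeta>. diff_at B g q (fst \<zeta>) = \<i> *s diff_at B g q (snd \<zeta>)}) \<and>
      (\<forall>q\<in>U. q \<in> G \<longrightarrow> inj (diff_at B g q))"
  shows "\<exists>C :: ('a, complex^'k) chart set. complex_structure_with_T10 B G F C"
proof -
  define C :: "('a, complex^'k) chart set" where "C = {c. adapted_chart B G F c}"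
  have cov: "\<exists>c\<in>C. p \<in> fst c" if p: "p \<in> G" for p
  proof -
    obtain U and g :: "'a \<Rightarrow> complex^'k" where U: "openin (top_of_set N) U \<and> p \<in> U \<and> smooth_in_charts B U g \<and>
      (\<forall>q\<in>U. F q = {\<zeta>. diff_at B g q (fst \<zeta>) = \<i> *s diff_at B g q (snd \<zeta>)}) \<and>
      (\<forall>q\<in>U. q \<in> G \<longrightarrow> inj (diff_at B g q))" using loc[OF p] by (elim exE)
    have "\<exists>c :: ('a, complex^'k) chart. adapted_chart B G F c \<and> p \<in> fst c"
      by (rule adapted_chart_exists[OF B G dim _ _ _ _ _ p, of U g]) (use U in auto)
    then show ?thesis unfolding C_def by blast
  qed
  have chart: "chart_on G c" if "c \<in> C" for c using that unfolding C_def adapted_chart_def by blast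
  have sub: "fst c \<subseteq> G" if "c \<in> C" for c by (rule chart_onD(8)[OF chart[OF that]])
  have "complex_atlas G C"
    unfolding complex_atlas_def
  proof (intro conjI ballI chart)
    show "\<Union> (fst ` C) = G" using cov sub by blast
    show "holomorphic_map_on (snd c ` (fst c \<inter> fst d)) (snd d \<circ> chart_inv c)" if "c \<in> C" "d \<in> C" for c d
      using adapted_transition_holomorphic[OF B G dim] that unfolding C_def by blast
  qed
  moreover have "smooth_map B C G (\<lambda>p. p)"
    unfolding smooth_map_def
  proof (intro conjI ballI continuous_on_id)
    fix b c assume b: "b \<in> B" and c: "c \<in> C"
    have "smooth_in_charts B (fst c) (snd c)" using c unfolding C_def adapted_chart_def by blast
    from smooth_in_chartsD[OF this b]
    show "smooth_on (snd b ` (G \<inter> fst b \<inter> (\<lambda>p. p) -` fst c)) (snd c \<circ> (\<lambda>p. p) \<circ> chart_inv b)"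
      unfolding comp_def by (rule smooth_on_subset) auto
  qed
  moreover have "smooth_map C B G (\<lambda>p. p)"
    unfolding smooth_map_def
  proof (intro conjI ballI continuous_on_id)
    fix b c assume b: "b \<in> B" and c: "c \<in> C"
    then have "smooth_on (snd c ` (fst c \<inter> fst b)) (snd b \<circ> chart_inv c)"
      unfolding C_def adapted_chart_def by blast
    then show "smooth_on (snd c ` (G \<inter> fst c \<inter> (\<lambda>p. p) -` fst b)) (snd b \<circ> (\<lambda>p. p) \<circ> chart_inv c)"
      unfolding comp_def by (rule smooth_on_subset) auto
  qed
  moreover have "F p = {\<zeta>. complexify (tangent_map B C (\<lambda>q. q) p) \<zeta> \<in> T10}" if p: "p \<in> G" for p
  proof -
    define c where "c = chart_at C p"
    have "\<exists>c. c \<in> C \<and> p \<in> fst c" using cov[OF p] by blast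
    from someI_ex[OF this] have c: "c \<in> C" "p \<in> fst c" unfolding c_def chart_at_def by auto
    have "tangent_map B C (\<lambda>q. q) p = diff_at B (snd c) p" unfolding tangent_map_def c_def comp_def by simp
    moreover have "F p = {\<zeta>. diff_at B (snd c) p (fst \<zeta>) = \<i> *s diff_at B (snd c) p (snd \<zeta>)}"
      using c unfolding C_def adapted_chart_def by blast
    ultimately show ?thesis unfolding complexify_def T10_iff by simp
  qed
  ultimately show ?thesis unfolding complex_structure_with_T10_def by blast
qed

section \<open>The decomposition of P and the CR structure\<close>

lemma V01_iff:
  assumes "\<And>z v. v \<in> V p \<Longrightarrow> z *s v \<in> V p"
  shows "(a, b) \<in> V01 V p \<longleftrightarrow> b = \<i> *s a \<and> a \<in> V p"
proof -
  have "(a, b) \<in> V01 V p \<longleftrightarrow> (\<exists>v\<in>V p. a = (1/2) *\<^sub>R v \<and> b = (1/2) *\<^sub>R (\<i> *s v))"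
    unfolding V01_def conj_vec_def part10_eq by (auto simp: image_iff)
  also have "\<dots> \<longleftrightarrow> b = \<i> *s a \<and> a \<in> V p"
  proof safe
    fix v assume "v \<in> V p"
    then show "(1/2) *\<^sub>R v \<in> V p" unfolding scaleR_eq_scalar_mult by (rule assms)
    show "(1/2) *\<^sub>R (\<i> *s v) = \<i> *s ((1/2) *\<^sub>R v)" unfolding scaleR_eq_scalar_mult by (simp add: mult.commute)
  next
    assume "a \<in> V p"
    then have "2 *s a \<in> V p" by (rule assms)
    then show "\<exists>v\<in>V p. a = (1/2) *\<^sub>R v \<and> \<i> *s a = (1/2) *\<^sub>R (\<i> *s v)"
      by (rule rev_bexI) (simp add: scaleR_eq_scalar_mult)
  qed
  finally show ?thesis .
qed

text \<open>Elements of \<open>T10\<close> are the pairs \<open>(i b, b)\<close> and those of \<open>V01\<close> the pairs \<open>(a, i a)\<close> with \<open>a \<in> V\<close>.  The map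
\<open>(u, w) \<mapsto> u - i w\<close> kills the former and doubles \<open>a\<close> on the latter, so a sum of the two is recognised
by \<open>u - i w \<in> V\<close>, which is the condition that defines \<open>P\<close>.\<close>

lemma P_bundle_decomposition:
  fixes V :: "'a \<Rightarrow> (complex^'n) set"
  assumes V: "\<And>z v. v \<in> V p \<Longrightarrow> z *s v \<in> V p" "0 \<in> V p" 
  shows "T10 \<inter> V01 V p = {0}"
    "complexify (incl_diff A B p) ` P_bundle A B V p
          = range (complexify (incl_diff A B p)) \<inter> {a + b | a b. a \<in> T10 \<and> b \<in> V01 V p}"
proof -
  have V01: "(a, b) \<in> V01 V p \<longleftrightarrow> b = \<i> *s a \<and> a \<in> V p" for a b
    by (rule V01_iff) (rule V(1))
  have ii: "\<i> *s (\<i> *s v) = - v" for v :: "complex^'n" by (simp add: vec_eq_iff)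
  show "T10 \<inter> V01 V p = {0}"
  proof (intro equalityI subsetI)
    fix x assume x: "x \<in> T10 \<inter> V01 V p"
    obtain a b where ab: "x = (a, b)" by (cases x)
    have "(a, b) \<in> T10" and V: "(a, b) \<in> V01 V p" using x unfolding ab by simp_all
    then have 1: "a = \<i> *s b" by (simp only: T10_iff)
    have 2: "b = \<i> *s a" using V unfolding V01 by (rule conjunct1)
    have "a = \<i> *s (\<i> *s a)" using 1 by (subst (asm) 2)
    then have "a = - a" by (simp only: ii)
    then have "a = 0" by (simp add: vec_eq_iff)
    then show "x \<in> {0}" using 2 unfolding ab by (simp add: zero_prod_def)
  next
    fix x assume "x \<in> {0 :: (complex^'n) \<times> (complex^'n)}"
    then have "x = (0, 0)" by (simp add: zero_prod_def)
    then show "x \<in> T10 \<inter> V01 V p" using V(2) by (simp add: T10_iff V01)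
  qed
  have key: "u - \<i> *s w \<in> V p \<longleftrightarrow> (u, w) \<in> {a + b | a b. a \<in> T10 \<and> b \<in> V01 V p}" for u w :: "complex^'n"
  proof
    assume v: "u - \<i> *s w \<in> V p"
    (* The component in V01 is forced, since u - i w is twice its first entry. *)
    define h where "h = (1/2) *s (u - \<i> *s w)"
    have "h \<in> V p" unfolding h_def by (rule V(1)[OF v])
    then have "(h, \<i> *s h) \<in> V01 V p" unfolding V01 by simp
    moreover have "(u - h, w - \<i> *s h) \<in> T10" unfolding T10_iff h_def vec_eq_iff by (simp add: field_simps)
    moreover have "(u, w) = (u - h, w - \<i> *s h) + (h, \<i> *s h)" by simp
    ultimately show "(u, w) \<in> {a + b | a b. a \<in> T10 \<and> b \<in> V01 V p}" by blast
  next
    assume "(u, w) \<in> {a + b | a b. a \<in> T10 \<and> b \<in> V01 V p}"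
    then obtain x y where xy: "(u, w) = x + y" "x \<in> T10" "y \<in> V01 V p" by blast
    obtain a1 b1 a2 b2 where ab: "x = (a1, b1)" "y = (a2, b2)" by (cases x, cases y) blast
    have "(u, w) = (a1, b1) + (a2, b2)" "(a1, b1) \<in> T10" "(a2, b2) \<in> V01 V p" using xy unfolding ab by simp_all
    then have "a1 = \<i> *s b1" "b2 = \<i> *s a2" "a2 \<in> V p" "u = a1 + a2" "w = b1 + b2" unfolding T10_iff V01 by auto
    then have "u - \<i> *s w = 2 *s a2" by (simp add: vec_eq_iff algebra_simps)
    then show "u - \<i> *s w \<in> V p" using V(1)[OF \<open>a2 \<in> V p\<close>] by simp
  qed
  have P: "\<zeta> \<in> P_bundle A B V p \<longleftrightarrow> complexify (incl_diff A B p) \<zeta> \<in> {a + b | a b. a \<in> T10 \<and> b \<in> V01 V p}" for \<zeta>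
    unfolding complexify_def key[symmetric] P_bundle_def l_map_def J_def by simp
  show "complexify (incl_diff A B p) ` P_bundle A B V p
          = range (complexify (incl_diff A B p)) \<inter> {a + b | a b. a \<in> T10 \<and> b \<in> V01 V p}"
    using P by blast
qed

text \<open>If both \<open>u - J w\<close> and \<open>u + J w\<close> lie in the complex subspace \<open>V\<close>, then so do \<open>u\<close> and \<open>w\<close>, which are tangent
to \<open>N\<close>.\<close>

lemma P_bundle_inter_conj:
  fixes V :: "'a::{t2_space, second_countable_topology} \<Rightarrow> (complex^'n) set"
  assumes A: "smooth_atlas X A" and N: "submanifold A X B N" and p: "p \<in> G_set A B N V"
    and V: "\<And>z v. v \<in> V p \<Longrightarrow> z *s v \<in> V p" "\<And>u v. u \<in> V p \<Longrightarrow> v \<in> V p \<Longrightarrow> u + v \<in> V p"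
  shows "P_bundle A B V p \<inter> conj_vec ` P_bundle A B V p = {0}"
proof -
  have pN: "p \<in> N" and R: "range (incl_diff A B p) \<inter> V p = {0}" using p unfolding G_set_def by auto
  note lin = linear_incl_diff[OF A N pN]
  have inj: "inj (incl_diff A B p)" using N pN unfolding submanifold_def by blast
  have zero: "u = 0" if "incl_diff A B p u \<in> V p" for u
  proof -
    have "incl_diff A B p u = 0" using R that by blast
    then show ?thesis using inj lin by (simp add: linear_injective_0)
  qed
  have "0 \<in> P_bundle A B V p"
    unfolding P_bundle_def l_map_def J_def using R linear_0[OF lin] by auto
  moreover have "0 \<in> conj_vec ` P_bundle A B V p"
    by (rule image_eqI[OF _ \<open>0 \<in> P_bundle A B V p\<close>]) (simp add: conj_vec_def zero_prod_def)
  moreover have "\<zeta> = 0" if \<zeta>: "\<zeta> \<in> P_bundle A B V p" "\<zeta> \<in> conj_vec ` P_bundle A B V p" for \<zeta>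
  proof -
    let ?u = "incl_diff A B p (fst \<zeta>)" and ?w = "incl_diff A B p (snd \<zeta>)"
    have 1: "?u - \<i> *s ?w \<in> V p" using \<zeta>(1) unfolding P_bundle_def l_map_def J_def by simp
    obtain \<eta> where "\<eta> \<in> P_bundle A B V p" "\<zeta> = conj_vec \<eta>" using \<zeta>(2) by blast
    then have "incl_diff A B p (fst \<zeta>) - \<i> *s incl_diff A B p (- snd \<zeta>) \<in> V p"
      unfolding P_bundle_def l_map_def J_def conj_vec_def by simp
    then have 2: "?u + \<i> *s ?w \<in> V p" by (simp add: linear_neg[OF lin])
    have "?u = (1/2) *s ((?u - \<i> *s ?w) + (?u + \<i> *s ?w))" by (simp add: vec_eq_iff)
    moreover have "?w = (\<i>/2) *s ((?u - \<i> *s ?w) + (-1) *s (?u + \<i> *s ?w))" by (simp add: vec_eq_iff field_simps)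
    moreover have "(1/2) *s ((?u - \<i> *s ?w) + (?u + \<i> *s ?w)) \<in> V p"
      by (rule V(1)[OF V(2)[OF 1 2]])
    moreover have "(\<i>/2) *s ((?u - \<i> *s ?w) + (-1) *s (?u + \<i> *s ?w)) \<in> V p"
      by (rule V(1)[OF V(2)[OF 1 V(1)[OF 2]]])
    ultimately have "?u \<in> V p" "?w \<in> V p" by simp_all
    then have "fst \<zeta> = 0" "snd \<zeta> = 0" using zero by auto
    then show ?thesis by (simp add: prod_eq_iff)
  qed
  ultimately show ?thesis by blast
qed

theorem theorem3p1:
  fixes X N :: "'a::{t2_space, second_countable_topology} set"
    and A :: "('a, complex^'n) chart set"
    and B :: "('a, real^'m) chart set"
    and E :: "'a \<Rightarrow> ((complex^'n) \<times> (complex^'n)) set"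
    and V :: "'a \<Rightarrow> (complex^'n) set"
    and r :: nat
  assumes X: "complex_atlas X A"
    and N: "submanifold A X B N" "maximally_totally_real A B N"
    and E: "holomorphic_subbundle_T10 A X r E" "complex_involutive A X E"
    and V: "\<exists>m. real_subbundle A X m V" "\<forall>p\<in>X. J ` V p \<subseteq> V p" "real_involutive A X V"
      "\<forall>p\<in>X. part10 ` V p = E p"
  shows
    "(\<forall>p\<in>N. T10 \<inter> V01 V p = {0} \<and>
        complexify (incl_diff A B p) ` P_bundle A B V p
          = range (complexify (incl_diff A B p)) \<inter> {a + b | a b. a \<in> T10 \<and> b \<in> V01 V p}) \<and>
     complex_subbundle B N r (P_bundle A B V) \<and> complex_involutive B N (P_bundle A B V) \<and>
     openin (top_of_set N) (G_set A B N V) \<and>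
     CR_structure B (G_set A B N V) r (P_bundle A B V) \<and>
     (CARD('n) = 2 * r \<longrightarrow> CARD('k) = r \<longrightarrow>
        (\<exists>C :: ('a, complex^'k) chart set.
           complex_structure_with_T10 B (G_set A B N V) (P_bundle A B V) C))"
proof -
  have A: "smooth_atlas X A" by (rule complex_atlas_imp_smooth[OF X])
  have B: "smooth_atlas N B" and NX: "N \<subseteq> X" using N unfolding submanifold_def by auto
  let ?P = "P_bundle A B V" and ?G = "G_set A B N V"
  have Vspace: "0 \<in> V p" "v \<in> V p \<Longrightarrow> z *s v \<in> V p" "u \<in> V p \<Longrightarrow> v \<in> V p \<Longrightarrow> u + v \<in> V p"
    if p: "p \<in> N" for p z u v
  proof -
    have pX: "p \<in> X" using p NX by blast
    obtain U \<xi> where U: "p \<in> U" "\<And>q. q \<in> U \<Longrightarrow> V q = {\<Sum>i<r. a i *s \<xi> i q | a. True}"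
    proof (rule holomorphic_frame[OF E(1) V(4) pX])
      fix U \<xi> assume "p \<in> U" and "\<And>q. q \<in> U \<Longrightarrow> V q = {\<Sum>i<r. a i *s \<xi> i q | a. True}"
      then show thesis by (rule that)
    qed
    note Vp = U(2)[OF U(1)]
    have "(\<Sum>i<r. 0 *s \<xi> i p) = 0" by simp
    then show "0 \<in> V p" unfolding Vp by (intro CollectI exI[of _ "\<lambda>i. 0"]) simp
    show "z *s v \<in> V p" if "v \<in> V p"
    proof -
      obtain a where "v = (\<Sum>i<r. a i *s \<xi> i p)" using \<open>v \<in> V p\<close> unfolding Vp by blast
      then have "z *s v = (\<Sum>i<r. (z * a i) *s \<xi> i p)" by (simp add: vec.scale_sum_right)
      then show ?thesis unfolding Vp by (intro CollectI exI[of _ "\<lambda>i. z * a i"]) simp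
    qed
    show "u + v \<in> V p" if "u \<in> V p" "v \<in> V p"
    proof -
      obtain a b where "u = (\<Sum>i<r. a i *s \<xi> i p)" "v = (\<Sum>i<r. b i *s \<xi> i p)"
        using \<open>u \<in> V p\<close> \<open>v \<in> V p\<close> unfolding Vp by blast
      then have "u + v = (\<Sum>i<r. (a i + b i) *s \<xi> i p)" by (simp add: vec.scale_left_distrib sum.distrib)
      then show ?thesis unfolding Vp by (intro CollectI exI[of _ "\<lambda>i. a i + b i"]) simp
    qed
  qed
  have a: "T10 \<inter> V01 V p = {0} \<and> complexify (incl_diff A B p) ` ?P p
      = range (complexify (incl_diff A B p)) \<inter> {a + b | a b. a \<in> T10 \<and> b \<in> V01 V p}" if "p \<in> N" for p
    by (intro conjI P_bundle_decomposition Vspace[OF that])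
  have sub: "complex_subbundle B N r ?P" by (rule complex_subbundle_P_bundle[OF X N E(1) V(4)])
  have loc: "\<exists>U (g :: 'a \<Rightarrow> complex^'n). openin (top_of_set N) U \<and> p \<in> U \<and> smooth_in_charts B U g \<and>
      (\<forall>q\<in>U. ?P q = {\<zeta>. diff_at B g q (fst \<zeta>) = \<i> *s diff_at B g q (snd \<zeta>)}) \<and>
      (\<forall>q\<in>U. q \<in> ?G \<longleftrightarrow> inj (diff_at B g q))" if p: "p \<in> N" for p
  proof (rule P_bundle_local[OF X N(1) E(1) V(3,4) p le_add1])
    fix U and g :: "'a \<Rightarrow> complex^'n"
    assume "openin (top_of_set N) U" "p \<in> U" "smooth_in_charts B U g"
      "\<And>q. q \<in> U \<Longrightarrow> ?P q = {\<zeta>. diff_at B g q (fst \<zeta>) = \<i> *s diff_at B g q (snd \<zeta>)}"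
      "\<And>q. q \<in> U \<Longrightarrow> q \<in> ?G \<longleftrightarrow> inj (diff_at B g q)"
    then show ?thesis by (intro exI[of _ U] exI[of _ g] conjI ballI)
  qed
  have inv: "complex_involutive B N ?P"
  proof (rule complex_involutive_antiholomorphic_kernel[OF B])
    fix p assume "p \<in> N"
    from loc[OF this] show "\<exists>U (g :: 'a \<Rightarrow> complex^'n). openin (top_of_set N) U \<and> p \<in> U \<and> smooth_in_charts B U g \<and>
      (\<forall>q\<in>U. ?P q = {\<zeta>. diff_at B g q (fst \<zeta>) = \<i> *s diff_at B g q (snd \<zeta>)})"
      by (elim exE conjE) (intro exI conjI, assumption+)
  qed
  have GN: "?G \<subseteq> N" unfolding G_set_def by blast
  have op: "openin (top_of_set N) ?G"
  proof (subst openin_subopen, intro ballI)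
    fix p assume p: "p \<in> ?G"
    then have pN: "p \<in> N" using GN by blast
    obtain U and g :: "'a \<Rightarrow> complex^'n" where Ug: "openin (top_of_set N) U \<and> p \<in> U \<and> smooth_in_charts B U g \<and>
        (\<forall>q\<in>U. q \<in> ?G \<longleftrightarrow> inj (diff_at B g q))"
      using loc[OF pN] by (elim exE conjE) simp
    then have U: "openin (top_of_set N) U" "p \<in> U" and g: "smooth_in_charts B U g"
      and inj: "\<And>q. q \<in> U \<Longrightarrow> q \<in> ?G \<longleftrightarrow> inj (diff_at B g q)" by simp_all
    define d where "d = chart_at B p"
    have d: "d \<in> B" "p \<in> fst d" using chart_at_in[OF B pN] unfolding d_def by auto
    note cd = atlas_chart_on[OF B d(1)]
    let ?S = "snd d ` (U \<inter> fst d)" and ?f = "g \<circ> chart_inv d"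
    have S: "open ?S" "snd d p \<in> ?S" using open_chart_image[OF cd U(1)] U d by auto
    have f: "smooth_on ?S ?f" by (rule smooth_in_chartsD[OF g d(1)])
    have dg: "diff_at B g q = frechet_derivative ?f (at (snd d q)) \<circ> to_chart B d q" if "q \<in> U" "q \<in> fst d" for q
      using diff_at_in_chart[OF B d(1) U(1) that g] by auto
    have "inj (diff_at B g p)" using inj[OF U(2)] p by blast
    then have "inj (frechet_derivative ?f (at (snd d p)))"
      unfolding dg[OF U(2) d(2)]
      using inj_on_imageI[of _ "to_chart B d p" UNIV] bij_is_surj[OF bij_to_chart[OF B d]] by fastforce
    from injective_linear_family_open[OF S smooth_on_linear_frechet[OF f] smooth_on_continuous[OF smooth_on_directional[OF f]] this]
    obtain T where T: "open T" "snd d p \<in> T" "T \<subseteq> ?S" "\<And>x. x \<in> T \<Longrightarrow> inj (frechet_derivative ?f (at x))" by blast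
    define D where "D = {q \<in> fst d. snd d q \<in> T}"
    have "openin (top_of_set N) D" unfolding D_def by (rule openin_chart_preimage[OF cd T(1)])
    moreover have "p \<in> D" unfolding D_def using d T by simp
    moreover have "D \<subseteq> ?G"
    proof
      fix q assume "q \<in> D"
      then have q: "q \<in> fst d" "snd d q \<in> T" unfolding D_def by auto
      have qU: "q \<in> U" by (rule chart_image_mem[OF cd q(1) subsetD[OF T(3) q(2)]])
      have "inj (diff_at B g q)"
        unfolding dg[OF qU q(1)] by (rule inj_compose[OF T(4)[OF q(2)] inj_to_chart[OF B d(1) q(1)]])
      then show "q \<in> ?G" using inj[OF qU] by blast
    qed
    ultimately show "\<exists>T. openin (top_of_set N) T \<and> p \<in> T \<and> T \<subseteq> ?G" by blast
  qed
  have CR: "CR_structure B ?G r ?P"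
    unfolding CR_structure_def
  proof (intro conjI ballI)
    show "complex_subbundle B ?G r ?P" by (rule complex_subbundle_open_subset[OF sub op])
    show "complex_involutive B ?G ?P" by (rule complex_involutive_open_subset[OF inv op])
    fix p assume p: "p \<in> ?G"
    then have pN: "p \<in> N" using GN by blast
    show "?P p \<inter> conj_vec ` ?P p = {0}"
      by (rule P_bundle_inter_conj[OF A N(1) p]) (use Vspace[OF pN] in auto)
  qed
  have "\<exists>C :: ('a, complex^'k) chart set. complex_structure_with_T10 B ?G ?P C"
    if n: "CARD('n) = 2 * r" and k: "CARD('k) = r"
  proof (rule complex_structure_of_local_kernel[OF B op])
    show "DIM(real^'m) = DIM(complex^'k)" using N(2) n k unfolding maximally_totally_real_def by simp
    fix p assume "p \<in> ?G"
    then have pN: "p \<in> N" using GN by blast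
    have card: "CARD('n) \<le> CARD('k) + r" using n k by simp
    show "\<exists>U (g :: 'a \<Rightarrow> complex^'k). openin (top_of_set N) U \<and> p \<in> U \<and> smooth_in_charts B U g \<and>
      (\<forall>q\<in>U. ?P q = {\<zeta>. diff_at B g q (fst \<zeta>) = \<i> *s diff_at B g q (snd \<zeta>)}) \<and>
      (\<forall>q\<in>U. q \<in> ?G \<longrightarrow> inj (diff_at B g q))"
    proof (rule P_bundle_local[OF X N(1) E(1) V(3,4) pN card])
      fix U and g :: "'a \<Rightarrow> complex^'k"
      assume "openin (top_of_set N) U" "p \<in> U" "smooth_in_charts B U g"
        "\<And>q. q \<in> U \<Longrightarrow> ?P q = {\<zeta>. diff_at B g q (fst \<zeta>) = \<i> *s diff_at B g q (snd \<zeta>)}"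
        "\<And>q. q \<in> U \<Longrightarrow> q \<in> ?G \<longleftrightarrow> inj (diff_at B g q)"
      then show ?thesis by (intro exI[of _ U] exI[of _ g] conjI ballI impI) simp_all
    qed
  qed
  then show ?thesis using a sub inv op CR by blast
qed

end
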